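(* Let $\Lambda_0=e^{2\pi in_0/m_0}\in\mathcal R$, with $m_0\ge1$, $0\le n_0\le m_0-1$, $n_0$ and $m_0$ coprime, and let $\hat\Phi^\delta(\xi,z)$ be the Borel transform at $\Lambda_0$ of the fundamental solution. For each $z\in\mathbb D^*$, the function $\xi\mapsto\hat\Phi^\delta(\xi,z)$ extends analytically to the universal covering of $\mathbb C\setminus\{\xi_{a,b}(z):\ a\in\mathbb Z^*,\ b\in\mathbb Z\}$ (i.e. the germ at $0$ can be continued analytically along every path issuing from the origin and lying in $\mathbb C\setminus\{\xi_{a,b}(z)\}$); near a moving singular point $\omega=\xi_{a,b}(z)$ on the main sheet of this Riemann surface, one can write $$\hat\Phi^\delta(\xi,z)=\Lambda_0C_{a,b}\Big(\frac{e^{-\omega/2}}{\xi-\omega}+\hat L_\omega(\xi-\omega)\log(\xi-\omega)\Big)+\text{regular function},$$ where $\hat L_\omega$ is an entire function. Moreover, for any $z\in\mathbb D^*$ and for any line $\Delta$ of $\mathbb C$ passing through the origin and avoiding the singular points $\xi_{a,b}(z)$, the function $\hat\Phi^\delta(\xi,z)$ has at most exponential growth for $\xi\in\Delta$.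
   Context: $\mathcal R$ is the set of complex roots of unity, $\mathbb D=\{|q|<1\}$, $\mathbb E=\{|q|>1\}$, $\mathbb S^1=\{|q|=1\}$, $\mathbb D^*=\mathbb D\setminus\{0\}$. $B_r$ ($0<r<1$) is the Banach space of bounded holomorphic functions on $\{|z|<r\}$ vanishing at $0$. **Borel transform at $\Lambda_0$.** $f_\delta(q,z)=\sum_{n\ge1}\frac{z^n}{q^n-1}$, viewed as a function of $q\in\mathbb D\cup\mathbb E$ with values in $B_r$ for all $r\in\,]0,1[$. The function $(q-\Lambda_0)f_\delta$ has at $\Lambda_0$ a Gevrey-1 asymptotic expansion $\sum_{n\ge0}a_nQ^n$ with $a_n\in B_r$: for each $r\in\,]0,1[$ there are open disks $\Delta^-\subset\mathbb D$, $\Delta^+\subset\mathbb E$ tangent to $\mathbb S^1$ at $\Lambda_0$ and $c_0,c_1>0$ with $\|(q-\Lambda_0)f_\delta(q,\cdot)-\sum_{0\le n\le N-1}a_n(q-\Lambda_0)^n\|_{B_r}\le c_0c_1^N\,N!\,|q-\Lambda_0|^N$ for all $N\ge0$, $q\in\Delta^-\cup\Delta^+$; and $a_0=-\frac{\Lambda_0}{m_0}\log(1-z^{m_0})$. The Borel transform is $$\hat\Phi^\delta(\xi,z)=\sum_{n\ge0}\Lambda_0^{n+1}a_{n+1}(z)\frac{\xi^n}{n!},$$ a holomorphic germ in $\xi$ at $0$ for each $z\in\mathbb D$. **Moving singular points.** For $a\in\mathbb Z^*=\mathbb Z\setminus\{0\}$, $b\in\mathbb Z$, $z\in\mathbb D^*$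 (with a determination of $\log$ chosen once and for all), $$\xi_{a,b}(z)=\frac{2\pi a}{m_0}\Big(-i\log z+\frac{2\pi b}{m_0}\Big),\qquad C_{a,b}=\frac1{m_0}\,e^{2\pi iab\,n_0'/m_0},$$ where $n_0'+m_0\mathbb Z$ is the multiplicative inverse of $n_0+m_0\mathbb Z$ in $\mathbb Z/m_0\mathbb Z$. **Main sheet.** The main sheet consists of what is reached by continuation along straight segments from the origin (it is identified with the holomorphic star of the germ). "Regular function" means a function holomorphic near $\omega$. *)

theory Defs
  imports "HOL-Complex_Analysis.Complex_Analysis" "HOL-Number_Theory.Cong"
begin

definition f_delta :: "complex \<Rightarrow> complex \<Rightarrow> complex" where
  "f_delta q z = (\<Sum>n. z ^ Suc n / (q ^ Suc n - 1))"

text \<open>The Banach space \<open>B\<^sub>r\<close>. Its elements are represented by functions on the whole plane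
  whose values outside the disk of radius \<open>r\<close> are irrelevant.\<close>

definition B_space :: "real \<Rightarrow> (complex \<Rightarrow> complex) set" where
  "B_space r = {g. g holomorphic_on ball 0 r \<and> bounded (g ` ball 0 r) \<and> g 0 = 0}"

definition B_norm :: "real \<Rightarrow> (complex \<Rightarrow> complex) \<Rightarrow> real" where
  "B_norm r g = (SUP z\<in>ball 0 r. norm (g z))"

text \<open>Two circles are tangent at a point iff this is their only common point.\<close>

definition tangent_disk :: "complex \<Rightarrow> complex set \<Rightarrow> bool" where
  "tangent_disk \<Lambda> \<Delta> \<longleftrightarrow>
     (\<exists>c \<rho>. 0 < \<rho> \<and> \<Delta> = ball c \<rho> \<and> sphere c \<rho> \<inter> sphere 0 1 = {\<Lambda>})"

definition gevrey1_expansion ::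
    "complex \<Rightarrow> (complex \<Rightarrow> complex \<Rightarrow> complex) \<Rightarrow> (nat \<Rightarrow> complex \<Rightarrow> complex) \<Rightarrow> bool" where
  "gevrey1_expansion \<Lambda> g a \<longleftrightarrow>
     (\<forall>r. 0 < r \<and> r < 1 \<longrightarrow>
        (\<forall>n. a n \<in> B_space r) \<and>
        (\<exists>\<Delta>m \<Delta>p c0 c1.
           tangent_disk \<Lambda> \<Delta>m \<and> \<Delta>m \<subseteq> ball 0 1 \<and>
           tangent_disk \<Lambda> \<Delta>p \<and> \<Delta>p \<subseteq> - cball 0 1 \<and>
           0 < c0 \<and> 0 < c1 \<and>
           (\<forall>N. \<forall>q\<in>\<Delta>m \<union> \<Delta>p.
              B_norm r (\<lambda>z. g q z - (\<Sum>n<N. a n z * (q - \<Lambda>) ^ n))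
                \<le> c0 * c1 ^ N * fact N * norm (q - \<Lambda>) ^ N)))"

text \<open>The coefficients of an asymptotic expansion are uniquely determined on the unit disk;
  the choice operator only fixes irrelevant values outside of it.\<close>

definition exp_coeff :: "complex \<Rightarrow> nat \<Rightarrow> complex \<Rightarrow> complex" where
  "exp_coeff \<Lambda> = (SOME a. gevrey1_expansion \<Lambda> (\<lambda>q z. (q - \<Lambda>) * f_delta q z) a)"

text \<open>Only the germ at \<open>\<xi> = 0\<close> of this power series is meaningful: outside the disk of
  convergence the value of the sum is arbitrary.\<close>

definition Phi_delta :: "complex \<Rightarrow> complex \<Rightarrow> complex \<Rightarrow> complex" where
  "Phi_delta \<Lambda> z \<xi> = (\<Sum>n. \<Lambda> ^ (n + 1) * exp_coeff \<Lambda> (n + 1) z * \<xi> ^ n / fact n)"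

text \<open>In the next two definitions, \<open>lg\<close> is the chosen determination of the logarithm, and
  \<open>n0'\<close> is an inverse of \<open>n0\<close> modulo \<open>m0\<close>.\<close>

definition moving_point :: "(complex \<Rightarrow> complex) \<Rightarrow> nat \<Rightarrow> int \<Rightarrow> int \<Rightarrow> complex \<Rightarrow> complex" where
  "moving_point lg m0 a b z =
     2 * of_real pi * of_int a / of_nat m0 *
       (- \<i> * lg z + 2 * of_real pi * of_int b / of_nat m0)"

definition C_coeff :: "nat \<Rightarrow> int \<Rightarrow> int \<Rightarrow> int \<Rightarrow> complex" where
  "C_coeff m0 n0' a b =
     1 / of_nat m0 *
       exp (2 * of_real pi * \<i> * of_int a * of_int b * of_int n0' / of_nat m0)"

definition moving_points :: "(complex \<Rightarrow> complex) \<Rightarrow> nat \<Rightarrow> complex \<Rightarrow> complex set" where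
  "moving_points lg m0 z = {moving_point lg m0 a b z |a b. a \<noteq> 0}"

text \<open>\<open>F\<close> is an analytic continuation along \<open>\<gamma>\<close> of the germ of \<open>f\<close> at the origin of \<open>\<gamma>\<close>:
  \<open>F t\<close> represents a holomorphic germ at \<open>\<gamma> t\<close>, and the germs fit together locally in \<open>t\<close>.\<close>

definition continuation_along ::
    "(complex \<Rightarrow> complex) \<Rightarrow> (real \<Rightarrow> complex) \<Rightarrow> (real \<Rightarrow> complex \<Rightarrow> complex) \<Rightarrow> bool" where
  "continuation_along f \<gamma> F \<longleftrightarrow>
     (\<forall>\<^sub>F w in nhds (\<gamma> 0). F 0 w = f w) \<and>
     (\<forall>t\<in>{0..1}. F t analytic_on {\<gamma> t}) \<and>
     (\<forall>t\<in>{0..1}. \<forall>\<^sub>F s in at t within {0..1}. \<forall>\<^sub>F w in nhds (\<gamma> s). F s w = F t w)"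

text \<open>The holomorphic star of the germ of \<open>f\<close> at \<open>0\<close>, and the continuation of \<open>f\<close> to it.\<close>

definition main_sheet :: "(complex \<Rightarrow> complex) \<Rightarrow> complex set" where
  "main_sheet f = {\<xi>. \<exists>F. continuation_along f (linepath 0 \<xi>) F}"

definition main_branch :: "(complex \<Rightarrow> complex) \<Rightarrow> complex \<Rightarrow> complex" where
  "main_branch f \<xi> = (THE w. \<exists>F. continuation_along f (linepath 0 \<xi>) F \<and> w = F 1 \<xi>)"

end

theory Submission
  imports Defs "HOL-Real_Asymp.Real_Asymp"
begin

text \<open>
  Decomposing \<open>1 / (q ^ n - 1)\<close> into partial fractions over the \<open>n\<close>-th roots of unity
  \<open>\<Lambda>\<close> and expanding each \<open>1 / (q - \<Lambda>)\<close> at \<open>\<Lambda>\<^sub>0\<close> gives the coefficients of the expansion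
  explicitly, and for small \<open>\<xi>\<close> the Borel transform is
  \<open>-\<Lambda>\<^sub>0 \<Sum> (z ^ n / n) exp (\<i> \<theta>) v exp (v \<xi>)\<close>, summed over \<open>n\<close> and over
  \<open>\<Lambda> = \<Lambda>\<^sub>0 exp (\<i> \<theta>) \<noteq> \<Lambda>\<^sub>0\<close> with \<open>\<Lambda> ^ n = 1\<close>, where \<open>v = 1 / (exp (\<i> \<theta>) - 1)\<close>. Here
  \<open>\<theta> = c / n\<close> with \<open>c = 2 \<pi> k / m\<^sub>0\<close>, and \<open>v + \<i> / \<theta>\<close> is regular at \<open>\<theta> = 0\<close>; so a summand is
  \<open>z ^ n exp (- \<i> \<xi> n / c) G(\<xi>, \<theta>) / c\<close> with \<open>G\<close> analytic for \<open>\<bar>\<theta>\<bar> < 2 \<pi>\<close>. Multiplying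
  \<open>exp (- \<i> \<xi> / \<theta>)\<close> by \<open>\<theta> ^ m\<close> amounts to integrating it \<open>m\<close> times from \<open>0\<close>, up to a
  polynomial. Hence the Taylor expansion of \<open>G\<close> in \<open>\<theta>\<close> yields
  \<open>\<Phi> = -\<Lambda>\<^sub>0 (G(\<xi>, 0) M(\<xi>) + \<integral> K(\<xi>, \<xi> - \<eta>) M(\<eta>) d\<eta> + H(\<xi>))\<close>, integrated from \<open>0\<close> to \<open>\<xi>\<close>,
  with \<open>K\<close> and \<open>H\<close> entire of exponential growth and
  \<open>M = \<Sum> z ^ n exp (- \<i> \<xi> n / c) / c\<close>. For fixed \<open>k\<close> the sum over \<open>n\<close> is a
  geometric series, so \<open>M\<close> is meromorphic with simple poles at the moving singular points; the integral
  turns a pole at \<open>\<omega>\<close> into \<open>K(\<xi>, \<xi> - \<omega>) log (1 - \<xi> / \<omega>)\<close> plus an entire function.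
\<close>

section \<open>Analytic continuation along paths\<close>

text \<open>The series for \<open>M\<close> converges only near the origin: on the disk of radius
  \<open>R\<close> the terms of frequency \<open>k\<close> are bounded by powers of
  \<open>\<bar>z\<bar> * exp (R / \<bar>c\<bar>)\<close>, which exceeds 1 for small
  \<open>\<bar>k\<bar>\<close> once \<open>R\<close> is large. But \<open>\<bar>c\<bar>\<close> is
  proportional to \<open>\<bar>k\<bar>\<close>, so on each disk only finitely many frequencies are
  bad. These are summed as geometric series and the rest is a convergent tail; the cutoff grows
  linearly in \<open>R\<close>, which keeps the final growth exponential. The expansion of G works
  for all \<open>k\<close> and \<open>n\<close> at once because the angles are taken in
  \<open>]- pi, pi]\<close> while the Taylor coefficients are controlled on the circle of radius 4,
  and \<open>pi < 4 < 2 * pi\<close>. The main sheet consists of all points reached by some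
  continuation along a segment. To identify it with the plane cut along rays, the existence of
  continuations is not enough: none may pass over a singular point, and this rests on the residues
  being nonzero.\<close>

lemma continuation_along_add:
  assumes "continuation_along f \<gamma> F" "continuation_along g \<gamma> G"
  shows "continuation_along (\<lambda>w. f w + g w) \<gamma> (\<lambda>t w. F t w + G t w)"
  unfolding continuation_along_def
proof (intro conjI ballI)
  show "\<forall>\<^sub>F w in nhds (\<gamma> 0). F 0 w + G 0 w = f w + g w"
    using assms unfolding continuation_along_def by (auto elim: eventually_elim2)
  fix t :: real assume t: "t \<in> {0..1}"
  show "(\<lambda>w. F t w + G t w) analytic_on {\<gamma> t}"
    using assms t unfolding continuation_along_def by (auto intro!: analytic_intros)
  have "\<forall>\<^sub>F s in at t within {0..1}. \<forall>\<^sub>F w in nhds (\<gamma> s). F s w = F t w"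
       "\<forall>\<^sub>F s in at t within {0..1}. \<forall>\<^sub>F w in nhds (\<gamma> s). G s w = G t w"
    using assms t unfolding continuation_along_def by auto
  then show "\<forall>\<^sub>F s in at t within {0..1}. \<forall>\<^sub>F w in nhds (\<gamma> s). F s w + G s w = F t w + G t w"
    by eventually_elim (auto elim: eventually_elim2)
qed

lemma continuation_along_mult:
  assumes "continuation_along f \<gamma> F" "continuation_along g \<gamma> G"
  shows "continuation_along (\<lambda>w. f w * g w) \<gamma> (\<lambda>t w. F t w * G t w)"
  unfolding continuation_along_def
proof (intro conjI ballI)
  show "\<forall>\<^sub>F w in nhds (\<gamma> 0). F 0 w * G 0 w = f w * g w"
    using assms unfolding continuation_along_def by (auto elim: eventually_elim2)
  fix t :: real assume t: "t \<in> {0..1}"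
  show "(\<lambda>w. F t w * G t w) analytic_on {\<gamma> t}"
    using assms t unfolding continuation_along_def by (auto intro!: analytic_intros)
  have "\<forall>\<^sub>F s in at t within {0..1}. \<forall>\<^sub>F w in nhds (\<gamma> s). F s w = F t w"
       "\<forall>\<^sub>F s in at t within {0..1}. \<forall>\<^sub>F w in nhds (\<gamma> s). G s w = G t w"
    using assms t unfolding continuation_along_def by auto
  then show "\<forall>\<^sub>F s in at t within {0..1}. \<forall>\<^sub>F w in nhds (\<gamma> s). F s w * G s w = F t w * G t w"
    by eventually_elim (auto elim: eventually_elim2)
qed

lemma continuation_along_analytic:
  assumes "h analytic_on path_image \<gamma>"
  shows "continuation_along h \<gamma> (\<lambda>t. h)"
  unfolding continuation_along_def
proof (intro conjI ballI)
  fix t :: real assume "t \<in> {0..1}"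
  then show "h analytic_on {\<gamma> t}"
    by (intro analytic_on_subset[OF assms]) (auto simp: path_image_def)
qed auto

lemma continuation_along_cong:
  assumes "continuation_along f \<gamma> F" "\<forall>\<^sub>F w in nhds (\<gamma> 0). f w = g w"
  shows "continuation_along g \<gamma> F"
proof -
  have "\<forall>\<^sub>F w in nhds (\<gamma> 0). F 0 w = f w" using assms(1) by (simp add: continuation_along_def)
  then have "\<forall>\<^sub>F w in nhds (\<gamma> 0). F 0 w = g w" using assms(2) by eventually_elim simp
  then show ?thesis using assms(1) by (simp add: continuation_along_def)
qed

lemma continuation_along_sum:
  assumes "finite I" "\<And>i. i \<in> I \<Longrightarrow> \<exists>F. continuation_along (f i) \<gamma> F"
  shows "\<exists>F. continuation_along (\<lambda>w. \<Sum>i\<in>I. f i w) \<gamma> F"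
  using assms
proof (induction I)
  case empty
  have "continuation_along (\<lambda>w. 0) \<gamma> (\<lambda>t w. 0)"
    by (rule continuation_along_analytic) auto
  then show ?case by auto
next
  case (insert i I)
  then obtain F G where "continuation_along (f i) \<gamma> F"
    "continuation_along (\<lambda>w. \<Sum>i\<in>I. f i w) \<gamma> G" by blast
  from continuation_along_add[OF this] show ?case using insert.hyps by auto
qed

text \<open>Along the path \<open>1 - \<gamma> t / \<omega>\<close> never vanishes, so it has a
  continuous logarithm \<mu>. The germ at parameter t is \<open>\<mu> t\<close> plus the principal
  logarithm of \<open>(w - \<omega>) / (\<gamma> t - \<omega>)\<close>, whose argument is near 1
  when w is near \<open>\<gamma> t\<close>.\<close>

lemma continuation_along_Ln:
  assumes "path \<gamma>" "\<gamma> 0 = 0" "\<omega> \<notin> path_image \<gamma>"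
  shows "\<exists>F. continuation_along (\<lambda>w. Ln (1 - w / \<omega>)) \<gamma> F"
proof -
  have ne: "\<gamma> t - \<omega> \<noteq> 0" if "t \<in> {0..1}" for t
    using assms(3) that by (auto simp: path_image_def)
  have \<omega>0: "\<omega> \<noteq> 0" using ne[of 0] assms(2) by auto
  have contg: "continuous_on {0..1} \<gamma>" using assms(1) by (simp add: path_def)
  obtain lam where lam: "continuous_on {0..1::real} lam" "\<And>t. t \<in> {0..1} \<Longrightarrow> 1 - \<gamma> t / \<omega> = exp (lam t)"
  proof (rule continuous_logarithm_on_contractible[of "{0..1::real}" "\<lambda>t. 1 - \<gamma> t / \<omega>"])
    show "continuous_on {0..1} (\<lambda>t. 1 - \<gamma> t / \<omega>)"
      by (intro continuous_intros contg) (use \<omega>0 in auto)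
    show "contractible {0..1::real}" by (simp add: convex_imp_contractible)
    show "1 - \<gamma> t / \<omega> \<noteq> 0" if "t \<in> {0..1}" for t using ne[OF that] \<omega>0 by (auto simp: field_simps)
  qed auto
  \<comment> \<open>Subtracting the initial value makes the lift start at 0, hence on the principal
    branch; it stays a logarithm because \<open>1 - \<gamma> 0 / \<omega> = 1\<close>.\<close>
  define \<mu> where "\<mu> t = lam t - lam 0" for t
  have \<mu>: "1 - \<gamma> t / \<omega> = exp (\<mu> t)" if "t \<in> {0..1}" for t
    using lam(2)[OF that] lam(2)[of 0] assms(2) by (simp add: \<mu>_def exp_diff)
  have \<mu>c: "continuous_on {0..1} \<mu>" unfolding \<mu>_def by (intro continuous_intros lam)
  have \<mu>0: "\<mu> 0 = 0" by (simp add: \<mu>_def)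
  define F where "F t w = Ln ((w - \<omega>) / (\<gamma> t - \<omega>)) + \<mu> t" for t w
  have "continuation_along (\<lambda>w. Ln (1 - w / \<omega>)) \<gamma> F"
    unfolding continuation_along_def
  proof (intro conjI ballI)
    have "F 0 w = Ln (1 - w / \<omega>)" for w
    proof -
      have "(w - \<omega>) / (\<gamma> 0 - \<omega>) = 1 - w / \<omega>"
        using \<omega>0 assms(2) by (simp add: field_simps)
      then show ?thesis by (simp add: F_def \<mu>0)
    qed
    then show "\<forall>\<^sub>F w in nhds (\<gamma> 0). F 0 w = Ln (1 - w / \<omega>)" by simp
    fix t :: real assume t: "t \<in> {0..1}"
    show "F t analytic_on {\<gamma> t}"
      unfolding F_def using ne[OF t] by (intro analytic_intros) auto
    have g: "(\<gamma> \<longlongrightarrow> \<gamma> t) (at t within {0..1})"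
      using contg t by (auto simp: continuous_on_def)
    have m: "(\<mu> \<longlongrightarrow> \<mu> t) (at t within {0..1})"
      using \<mu>c t by (auto simp: continuous_on_def)
    have lp: "((\<lambda>s. Ln ((\<gamma> s - \<omega>) / (\<gamma> t - \<omega>))) \<longlongrightarrow> Ln ((\<gamma> t - \<omega>) / (\<gamma> t - \<omega>))) (at t within {0..1})"
      by (intro tendsto_intros g) (use ne[OF t] in auto)
    then have lp: "((\<lambda>s. Ln ((\<gamma> s - \<omega>) / (\<gamma> t - \<omega>))) \<longlongrightarrow> 0) (at t within {0..1})"
      using ne[OF t] by simp
    have e1: "\<forall>\<^sub>F s in at t within {0..1}. norm (Ln ((\<gamma> s - \<omega>) / (\<gamma> t - \<omega>))) < 1"
      using tendstoD[OF lp, of 1] by simp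
    have e2: "\<forall>\<^sub>F s in at t within {0..1}. norm (\<mu> s - \<mu> t) < 1"
      using tendstoD[OF m, of 1] by (simp add: dist_norm)
    have e3: "\<forall>\<^sub>F s in at t within {0..1}. s \<in> {0..1}"
      by (auto simp: eventually_at_filter)
    show "\<forall>\<^sub>F s in at t within {0..1}. \<forall>\<^sub>F w in nhds (\<gamma> s). F s w = F t w"
      using e1 e2 e3
    proof eventually_elim
      case (elim s)
      define p where "p = (\<gamma> s - \<omega>) / (\<gamma> t - \<omega>)"
      have p0: "p \<noteq> 0" using ne elim(3) t by (auto simp: p_def)
      \<comment> \<open>Two logarithms of the same number differ by a multiple of 2 pi i; here the
        difference has modulus below 2, so it is 0.\<close>
      have "exp (\<mu> s - \<mu> t - Ln p) = (1 - \<gamma> s / \<omega>) / (1 - \<gamma> t / \<omega>) / p"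
        using p0 \<mu>[OF t] \<mu>[OF elim(3)] by (simp add: exp_diff)
      also have "\<dots> = 1" using ne[OF t] ne[OF elim(3)] \<omega>0 unfolding p_def
        by (simp add: divide_simps) (auto simp: algebra_simps)
      finally have "exp (\<mu> s - \<mu> t - Ln p) = 1" .
      then obtain n where n: "Re (\<mu> s - \<mu> t - Ln p) = 0" "Im (\<mu> s - \<mu> t - Ln p) = of_int (2 * n) * pi"
        unfolding exp_eq_1 by blast
      have "norm (\<mu> s - \<mu> t - Ln p) < 2"
        using elim(1,2) norm_triangle_ineq4[of "\<mu> s - \<mu> t" "Ln p"] unfolding p_def by linarith
      then have "\<bar>of_int (2 * n) * pi\<bar> < 2" using n(2) abs_Im_le_cmod[of "\<mu> s - \<mu> t - Ln p"] by linarith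
      then have "\<bar>real_of_int n\<bar> * pi < 1" by (simp add: abs_mult)
      then have "n = 0"
        using pi_gt3 mult_left_mono[of 1 pi "\<bar>real_of_int n\<bar>"] by linarith
      then have eqp: "Ln p = \<mu> s - \<mu> t" using n by (simp add: complex_eq_iff)
      have "((\<lambda>w. Ln ((w - \<omega>) / (\<gamma> s - \<omega>))) \<longlongrightarrow> Ln ((\<gamma> s - \<omega>) / (\<gamma> s - \<omega>))) (nhds (\<gamma> s))"
        by (intro tendsto_intros filterlim_ident) (use ne[OF elim(3)] in auto)
      then have "((\<lambda>w. Ln ((w - \<omega>) / (\<gamma> s - \<omega>))) \<longlongrightarrow> 0) (nhds (\<gamma> s))"
        using ne[OF elim(3)] by simp
      from tendstoD[OF this, of 1]
      have f1: "\<forall>\<^sub>F w in nhds (\<gamma> s). norm (Ln ((w - \<omega>) / (\<gamma> s - \<omega>))) < 1" by simp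
      have f2: "\<forall>\<^sub>F w in nhds (\<gamma> s). w \<noteq> \<omega>"
        using ne[OF elim(3)] t1_space_nhds[of "\<gamma> s" \<omega>] by auto
      show "\<forall>\<^sub>F w in nhds (\<gamma> s). F s w = F t w"
        using f1 f2
      proof eventually_elim
        case (elim w)
        let ?x = "(w - \<omega>) / (\<gamma> s - \<omega>)"
        have x0: "?x \<noteq> 0" using elim(2) ne[OF \<open>s \<in> {0..1}\<close>] by auto
        have b: "\<bar>Im (Ln ?x)\<bar> < 1" using elim(1) abs_Im_le_cmod[of "Ln ?x"] by linarith
        have b': "\<bar>Im (Ln p)\<bar> < 1" using e1 \<open>norm (Ln ((\<gamma> s - \<omega>) / (\<gamma> t - \<omega>))) < 1\<close> abs_Im_le_cmod[of "Ln p"]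
          unfolding p_def by linarith
        \<comment> \<open>Both imaginary parts are below 1 in modulus, so their sum stays within the
          principal strip.\<close>
        have "Ln (?x * p) = Ln ?x + Ln p"
          by (rule Ln_times_simple) (use x0 p0 b b' pi_gt3 in auto)
        moreover have "?x * p = (w - \<omega>) / (\<gamma> t - \<omega>)"
          unfolding p_def using ne[OF \<open>s \<in> {0..1}\<close>] by simp
        ultimately show ?case by (simp add: F_def eqp)
      qed
    qed
  qed
  then show ?thesis by blast
qed

text \<open>Agreement of germs propagates: close to t both families are represented by
  \<open>F t\<close> and \<open>G t\<close>, which are holomorphic on a common ball, so agreement
  near one point of the curve in this ball spreads to the whole ball by the identity theorem.
  Connectedness of the unit interval does the rest.\<close>

lemma continuation_along_unique:
  assumes F: "continuation_along f \<gamma> F" and G: "continuation_along f \<gamma> G" and "path \<gamma>"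
    and t1: "t \<in> {0..1}"
  shows "\<forall>\<^sub>F w in nhds (\<gamma> t). F t w = G t w"
proof -
  have zero: "\<forall>\<^sub>F w in nhds (\<gamma> 0). F 0 w = G 0 w"
    using F G unfolding continuation_along_def by (auto elim: eventually_elim2)
  define Q where "Q x \<longleftrightarrow> (\<forall>\<^sub>F w in nhds (\<gamma> x). F x w = G x w)" for x
  have step: "\<exists>T. openin (top_of_set {0..1}) T \<and> t \<in> T \<and> (\<forall>x\<in>T. \<forall>y\<in>T. Q x \<longrightarrow> Q y)"
    if t: "t \<in> {0..1}" for t
  proof -
    have "F t analytic_on {\<gamma> t}" "G t analytic_on {\<gamma> t}"
      using F G t unfolding continuation_along_def by auto
    then obtain e1 e2 where e: "e1 > 0" "e2 > 0" "F t holomorphic_on ball (\<gamma> t) e1" "G t holomorphic_on ball (\<gamma> t) e2"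
      unfolding analytic_on_def by auto
    define B where "B = ball (\<gamma> t) (min e1 e2)"
    have hB: "F t holomorphic_on B" "G t holomorphic_on B"
      using e by (auto intro: holomorphic_on_subset simp: B_def)
    have "(\<gamma> \<longlongrightarrow> \<gamma> t) (at t within {0..1})"
      using assms(3) t by (auto simp: path_def continuous_on_def)
    then have "\<forall>\<^sub>F s in at t within {0..1}. \<gamma> s \<in> B"
      by (rule topological_tendstoD) (use e in \<open>auto simp: B_def\<close>)
    moreover have "\<forall>\<^sub>F s in at t within {0..1}. \<forall>\<^sub>F w in nhds (\<gamma> s). F s w = F t w"
         "\<forall>\<^sub>F s in at t within {0..1}. \<forall>\<^sub>F w in nhds (\<gamma> s). G s w = G t w"
      using F G t unfolding continuation_along_def by auto
    ultimately have "\<forall>\<^sub>F s in at t within {0..1}. \<gamma> s \<in> B \<and> (\<forall>\<^sub>F w in nhds (\<gamma> s). F s w = F t w)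
        \<and> (\<forall>\<^sub>F w in nhds (\<gamma> s). G s w = G t w)"
      by eventually_elim auto
    then obtain V where V: "open V" "t \<in> V"
      "\<And>s. s \<in> V \<Longrightarrow> s \<noteq> t \<Longrightarrow> s \<in> {0..1} \<Longrightarrow> \<gamma> s \<in> B \<and> (\<forall>\<^sub>F w in nhds (\<gamma> s). F s w = F t w)
        \<and> (\<forall>\<^sub>F w in nhds (\<gamma> s). G s w = G t w)"
      unfolding eventually_at_topological by blast
    have V': "\<gamma> s \<in> B \<and> (\<forall>\<^sub>F w in nhds (\<gamma> s). F s w = F t w)
        \<and> (\<forall>\<^sub>F w in nhds (\<gamma> s). G s w = G t w)" if "s \<in> {0..1} \<inter> V" for s
      using V(3)[of s] that e by (cases "s = t") (auto simp: B_def)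
    show ?thesis
      unfolding Q_def
    proof (intro exI[of _ "{0..1} \<inter> V"] conjI ballI impI)
      show "openin (top_of_set {0..1}) ({0..1} \<inter> V)" using V(1) by auto
      show "t \<in> {0..1} \<inter> V" using t V by auto
      fix x y assume xy: "x \<in> {0..1} \<inter> V" "y \<in> {0..1} \<inter> V" and Px: "\<forall>\<^sub>F w in nhds (\<gamma> x). F x w = G x w"
      have inB: "\<forall>\<^sub>F w in nhds (\<gamma> x). w \<in> B"
        using V'[OF xy(1)] by (intro eventually_nhds_in_open) (auto simp: B_def)
      note Vx = conjunct2[OF V'[OF xy(1)]]
      from Px inB conjunct1[OF Vx] conjunct2[OF Vx]
      have "\<forall>\<^sub>F w in nhds (\<gamma> x). F t w = G t w \<and> w \<in> B"
        by eventually_elim auto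
      then have "\<exists>T. open T \<and> \<gamma> x \<in> T \<and> (\<forall>w\<in>T. F t w = G t w \<and> w \<in> B)"
        by (simp only: eventually_nhds)
      then obtain T where T: "open T" "\<gamma> x \<in> T" "\<And>w. w \<in> T \<Longrightarrow> F t w = G t w \<and> w \<in> B"
        by metis
      have FG: "F t w = G t w" if "w \<in> B" for w
        by (rule analytic_continuation_open[of T B]) (use T hB that in \<open>auto simp: B_def\<close>)
      have "\<forall>\<^sub>F w in nhds (\<gamma> y). w \<in> B"
        using V'[OF xy(2)] by (intro eventually_nhds_in_open) (auto simp: B_def)
      then show "\<forall>\<^sub>F w in nhds (\<gamma> y). F y w = G y w"
        using conjunct1[OF conjunct2[OF V'[OF xy(2)]]] conjunct2[OF conjunct2[OF V'[OF xy(2)]]]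
        by eventually_elim (use FG in auto)
    qed
  qed
  have "Q t"
    using connected_induction_simple[of "{0..1}" 0 t Q] step t1 zero by (auto simp: Q_def)
  then show ?thesis by (simp add: Q_def)
qed

text \<open>Once a segment admits a continuation, this restriction to initial pieces shows that the
  values at its interior points are values of the main branch.\<close>

lemma continuation_along_linepath_initial:
  assumes F: "continuation_along f (linepath 0 \<xi>) F" and c: "0 < c" "c \<le> 1"
  shows "continuation_along f (linepath 0 (of_real c * \<xi>)) (\<lambda>s. F (c * s))"
proof -
  have lp: "linepath 0 (of_real c * \<xi>) s = linepath 0 \<xi> (c * s)" for s
    by (simp add: linepath_def scaleR_conv_of_real mult_ac)
  have in01: "c * t \<in> {0..1}" if "t \<in> {0..1}" for t
    using that c mult_mono[of c 1 t 1] by auto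
  show ?thesis
    unfolding continuation_along_def lp
  proof (intro conjI ballI)
    show "\<forall>\<^sub>F w in nhds (linepath 0 \<xi> (c * 0)). F (c * 0) w = f w"
      using F by (simp add: continuation_along_def)
    fix t :: real assume t: "t \<in> {0..1}"
    show "F (c * t) analytic_on {linepath 0 \<xi> (c * t)}"
      using F in01[OF t] by (simp add: continuation_along_def)
    have "filterlim (\<lambda>s. c * s) (at (c * t) within {0..1}) (at t within {0..1})"
      unfolding filterlim_at
    proof
      show "\<forall>\<^sub>F x in at t within {0..1}. c * x \<in> {0..1} \<and> c * x \<noteq> c * t"
        using in01 c by (auto simp: eventually_at_filter)
      show "((\<lambda>s. c * s) \<longlongrightarrow> c * t) (at t within {0..1})" by (intro tendsto_intros)
    qed
    moreover have "\<forall>\<^sub>F s in at (c * t) within {0..1}. \<forall>\<^sub>F w in nhds (linepath 0 \<xi> s). F s w = F (c * t) w"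
      using F in01[OF t] by (simp add: continuation_along_def)
    ultimately show "\<forall>\<^sub>F s in at t within {0..1}. \<forall>\<^sub>F w in nhds (linepath 0 \<xi> (c * s)). F (c * s) w = F (c * t) w"
      by (rule eventually_compose_filterlim[rotated])
  qed
qed

text \<open>On a star-shaped open set the constant family \<open>\<Psi>\<close> is a continuation
  along every segment from 0, and uniqueness of continuation evaluates the definite description in
  \<open>main_branch\<close>.\<close>

lemma main_branch_starlike:
  assumes "open S" "\<And>x. x \<in> S \<Longrightarrow> closed_segment 0 x \<subseteq> S" "\<Psi> holomorphic_on S"
    and "\<forall>\<^sub>F w in nhds 0. f w = \<Psi> w" "\<xi> \<in> S"
  shows "continuation_along f (linepath 0 \<xi>) (\<lambda>t. \<Psi>)"
    and "\<xi> \<in> main_sheet f" and "main_branch f \<xi> = \<Psi> \<xi>"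
proof -
  have "\<Psi> analytic_on S" using assms(1,3) by (simp add: analytic_on_open)
  then have "\<Psi> analytic_on path_image (linepath 0 \<xi>)"
    by (rule analytic_on_subset) (use assms(2,5) in simp)
  then have "continuation_along \<Psi> (linepath 0 \<xi>) (\<lambda>t. \<Psi>)"
    by (rule continuation_along_analytic)
  then show c: "continuation_along f (linepath 0 \<xi>) (\<lambda>t. \<Psi>)"
    by (rule continuation_along_cong) (use assms(4) in \<open>auto elim: eventually_mono\<close>)
  then show "\<xi> \<in> main_sheet f" by (auto simp: main_sheet_def)
  show "main_branch f \<xi> = \<Psi> \<xi>"
    unfolding main_branch_def
  proof (rule the_equality)
    fix w assume "\<exists>F. continuation_along f (linepath 0 \<xi>) F \<and> w = F 1 \<xi>"
    then obtain F where F: "continuation_along f (linepath 0 \<xi>) F" "w = F 1 \<xi>" by blast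
    from continuation_along_unique[OF F(1) c, of 1] show "w = \<Psi> \<xi>"
      using F(2) by (auto dest: eventually_nhds_x_imp_x)
  qed (use c in blast)
qed

lemma continuable_add:
  assumes "\<exists>F. continuation_along f \<gamma> F" "\<exists>G. continuation_along g \<gamma> G"
  shows "\<exists>H. continuation_along (\<lambda>w. f w + g w) \<gamma> H"
proof -
  obtain F G where "continuation_along f \<gamma> F" "continuation_along g \<gamma> G" using assms by auto
  from continuation_along_add[OF this] show ?thesis
    by (rule exI[where P = "continuation_along (\<lambda>w. f w + g w) \<gamma>"])
qed

lemma continuable_mult:
  assumes "\<exists>F. continuation_along f \<gamma> F" "\<exists>G. continuation_along g \<gamma> G"
  shows "\<exists>H. continuation_along (\<lambda>w. f w * g w) \<gamma> H"
proof -
  obtain F G where "continuation_along f \<gamma> F" "continuation_along g \<gamma> G" using assms by auto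
  from continuation_along_mult[OF this] show ?thesis
    by (rule exI[where P = "continuation_along (\<lambda>w. f w * g w) \<gamma>"])
qed

lemma continuable_analytic:
  "h analytic_on path_image \<gamma> \<Longrightarrow> \<exists>H. continuation_along h \<gamma> H"
  by (rule exI[where P = "continuation_along h \<gamma>"]) (rule continuation_along_analytic)

lemma main_branch_eqI:
  assumes F: "continuation_along f (linepath 0 \<xi>) F"
  shows "main_branch f \<xi> = F 1 \<xi>"
  unfolding main_branch_def
proof (rule the_equality)
  fix w assume "\<exists>G. continuation_along f (linepath 0 \<xi>) G \<and> w = G 1 \<xi>"
  then obtain G where G: "continuation_along f (linepath 0 \<xi>) G" "w = G 1 \<xi>" by metis
  from continuation_along_unique[OF G(1) F, of 1] show "w = F 1 \<xi>"
    using G(2) by (auto dest: eventually_nhds_x_imp_x)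
qed (use F in blast)

section \<open>Germs with simple poles and logarithms\<close>

text \<open>For nonzero \<omega> the excluded \<xi> form the ray \<open>t * \<omega>\<close> with t
  at least 1, which is exactly where the principal \<open>Ln (1 - \<xi> / \<omega>)\<close> fails to
  be holomorphic.\<close>

definition star :: "complex set \<Rightarrow> complex set" where
  "star P = {\<xi>. \<forall>\<omega>\<in>P. 1 - \<xi> / \<omega> \<notin> \<real>\<^sub>\<le>\<^sub>0}"

lemma not_in_star_iff:
  assumes "0 \<notin> P"
  shows "\<xi> \<notin> star P \<longleftrightarrow> (\<exists>t. 0 < t \<and> t \<le> 1 \<and> of_real t * \<xi> \<in> P)"
proof
  assume "\<xi> \<notin> star P"
  then obtain \<omega> where \<omega>: "\<omega> \<in> P" "1 - \<xi> / \<omega> \<in> \<real>\<^sub>\<le>\<^sub>0" by (auto simp: star_def)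
  have "\<omega> \<noteq> 0" using \<omega> assms by auto
  obtain x where x: "1 - \<xi> / \<omega> = of_real x" "x \<le> 0"
    using \<omega>(2) by (auto elim: nonpos_Reals_cases)
  then have "\<xi> = of_real (1 - x) * \<omega>" using \<open>\<omega> \<noteq> 0\<close> by (simp add: field_simps)
  moreover have "1 - x \<noteq> 0" using x(2) by simp
  then have "complex_of_real (1 / (1 - x)) * complex_of_real (1 - x) = 1"
    by (metis nonzero_divide_eq_eq of_real_1 of_real_mult)
  ultimately have "of_real (1 / (1 - x)) * \<xi> = \<omega>" by (metis mult.assoc mult_1)
  moreover have "0 < 1 / (1 - x)" "1 / (1 - x) \<le> 1" using x(2) by (auto simp: divide_simps)
  ultimately show "\<exists>t. 0 < t \<and> t \<le> 1 \<and> of_real t * \<xi> \<in> P" using \<omega>(1) by blast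
next
  assume "\<exists>t. 0 < t \<and> t \<le> 1 \<and> of_real t * \<xi> \<in> P"
  then obtain t where t: "0 < t" "t \<le> 1" "of_real t * \<xi> \<in> P" by blast
  then have "\<xi> \<noteq> 0" using assms by auto
  then have "1 - \<xi> / (of_real t * \<xi>) = of_real (1 - 1 / t)" using t by (simp add: field_simps)
  moreover have "1 - 1 / t \<le> 0" using t by (auto simp: divide_simps)
  ultimately have "1 - \<xi> / (of_real t * \<xi>) \<in> \<real>\<^sub>\<le>\<^sub>0" by (metis nonpos_Reals_of_real_iff)
  then show "\<xi> \<notin> star P" using t(3) unfolding star_def by blast
qed

lemma starlike_star:
  assumes "0 \<notin> P" "x \<in> star P" 
  shows "closed_segment 0 x \<subseteq> star P"
proof
  fix y assume "y \<in> closed_segment 0 x"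
  then obtain u where u: "0 \<le> u" "u \<le> 1" "y = of_real u * x"
    by (auto simp: in_segment scaleR_conv_of_real)
  show "y \<in> star P"
  proof (rule ccontr)
    assume "y \<notin> star P"
    then obtain t where t: "0 < t" "t \<le> 1" "of_real t * y \<in> P" using not_in_star_iff[OF assms(1)] by blast
    then have "of_real (t * u) * x \<in> P" by (simp add: u mult_ac)
    moreover have "t * u \<noteq> 0" using t(3) assms(1) u(3) by auto
    then have "0 < t * u" using t u by (simp add: less_le)
    moreover have "t * u \<le> 1" using t u by (simp add: mult_le_one)
    ultimately show False using assms not_in_star_iff[OF assms(1)] by blast
  qed
qed

text \<open>An abstract germ with simple poles and logarithms. The representation is required on
  every disk, with a remainder depending on the disk, because the sum over all of \<open>P\<close>
  need not converge. The condition \<open>nz\<close> says that the residues do not vanish; it makes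
  the points of \<open>P\<close> genuine obstructions to continuation.\<close>

locale log_pole_germ =
  fixes f :: "complex \<Rightarrow> complex" and P :: "complex set" and r :: "complex \<Rightarrow> complex"
    and A :: "complex \<Rightarrow> complex" and B :: "complex \<Rightarrow> complex \<Rightarrow> complex"
  assumes fin: "\<And>R. finite (P \<inter> ball 0 R)" and P0: "0 \<notin> P"
    and A: "A holomorphic_on UNIV" and B: "\<And>\<omega>. B \<omega> holomorphic_on UNIV"
    and nz: "\<And>\<omega>. \<omega> \<in> P \<Longrightarrow> r \<omega> * A \<omega> \<noteq> 0"
    and rep: "\<And>R. 0 < R \<Longrightarrow> \<exists>g. g holomorphic_on ball 0 R \<and> (\<forall>\<^sub>F \<xi> in nhds 0. f \<xi> =
        g \<xi> + (\<Sum>\<omega>\<in>P \<inter> ball 0 R. r \<omega> * (A \<xi> / (\<xi> - \<omega>) + B \<omega> \<xi> * Ln (1 - \<xi> / \<omega>))))"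
begin

text \<open>The image of the path is compact, so it lies in one disk; there only finitely many
  singular terms occur and each is continued separately.\<close>

lemma continuation_exists:
  assumes "path \<gamma>" "\<gamma> 0 = 0" "path_image \<gamma> \<inter> P = {}"
  shows "\<exists>F. continuation_along f \<gamma> F"
proof -
  have "bounded (path_image \<gamma>)" using assms(1) by (simp add: bounded_path_image)
  then obtain R where R: "0 < R" "path_image \<gamma> \<subseteq> ball 0 R"
    using bounded_subset_ballD by blast
  obtain g where g: "g holomorphic_on ball 0 R" "\<forall>\<^sub>F \<xi> in nhds 0. f \<xi> =
        g \<xi> + (\<Sum>\<omega>\<in>P \<inter> ball 0 R. r \<omega> * (A \<xi> / (\<xi> - \<omega>) + B \<omega> \<xi> * Ln (1 - \<xi> / \<omega>)))"
    using rep[OF R(1)] by blast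
  have "\<exists>F. continuation_along (\<lambda>\<xi>. \<Sum>\<omega>\<in>P \<inter> ball 0 R. r \<omega> * (A \<xi> / (\<xi> - \<omega>)) + r \<omega> * B \<omega> \<xi> * Ln (1 - \<xi> / \<omega>)) \<gamma> F"
  proof (rule continuation_along_sum[OF fin])
    fix \<omega> assume \<omega>: "\<omega> \<in> P \<inter> ball 0 R"
    have ni: "\<omega> \<notin> path_image \<gamma>" using \<omega> assms(3) by auto
    have AA: "A analytic_on path_image \<gamma>" "B \<omega> analytic_on path_image \<gamma>"
      using A B[of \<omega>] by (auto intro: analytic_on_subset[of _ UNIV] simp: analytic_on_open)
    have c1: "(\<lambda>\<xi>. r \<omega> * B \<omega> \<xi>) analytic_on path_image \<gamma>"
      by (intro analytic_intros AA)
    have c2: "(\<lambda>\<xi>. r \<omega> * (A \<xi> / (\<xi> - \<omega>))) analytic_on path_image \<gamma>"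
      by (intro analytic_intros AA) (use ni in auto)
    show "\<exists>F. continuation_along (\<lambda>\<xi>. r \<omega> * (A \<xi> / (\<xi> - \<omega>)) + r \<omega> * B \<omega> \<xi> * Ln (1 - \<xi> / \<omega>)) \<gamma> F"
      by (rule continuable_add[OF continuable_analytic[OF c2]
          continuable_mult[OF continuable_analytic[OF c1] continuation_along_Ln[OF assms(1,2) ni]]])
  qed
  moreover have "g analytic_on ball 0 R" using g(1) by (simp add: analytic_on_open)
  then have "g analytic_on path_image \<gamma>" using R(2) by (rule analytic_on_subset)
  ultimately obtain F where F: "continuation_along (\<lambda>\<xi>. g \<xi> + (\<Sum>\<omega>\<in>P \<inter> ball 0 R. r \<omega> * (A \<xi> / (\<xi> - \<omega>)) + r \<omega> * B \<omega> \<xi> * Ln (1 - \<xi> / \<omega>))) \<gamma> F"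
    using continuable_add[OF continuable_analytic, of g \<gamma>] by auto
  have "continuation_along f \<gamma> F"
    by (rule continuation_along_cong[OF F])
       (use g(2) assms(2) in \<open>auto elim!: eventually_mono simp: algebra_simps\<close>)
  then show ?thesis by (rule exI[where P = "continuation_along f \<gamma>"])
qed

lemma star_ball:
  "open (star P \<inter> ball 0 R)"
  "x \<in> star P \<inter> ball 0 R \<Longrightarrow> closed_segment 0 x \<subseteq> star P \<inter> ball 0 R"
proof -
  \<comment> \<open>The cut of a point outside the disk does not enter the disk, so inside it the
    star is bounded by finitely many rays.\<close>
  have eq: "star P \<inter> ball 0 R = ball 0 R \<inter> (\<Inter>\<omega>\<in>P \<inter> ball 0 R. {\<xi>. 1 - \<xi> / \<omega> \<notin> \<real>\<^sub>\<le>\<^sub>0})"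
  proof (intro set_eqI iffI)
    fix \<xi> assume \<xi>: "\<xi> \<in> ball 0 R \<inter> (\<Inter>\<omega>\<in>P \<inter> ball 0 R. {\<xi>. 1 - \<xi> / \<omega> \<notin> \<real>\<^sub>\<le>\<^sub>0})"
    have "\<xi> \<in> star P"
    proof (rule ccontr)
      assume "\<xi> \<notin> star P"
      then obtain \<omega> where \<omega>: "\<omega> \<in> P" "1 - \<xi> / \<omega> \<in> \<real>\<^sub>\<le>\<^sub>0" by (auto simp: star_def)
      then have "\<omega> \<notin> ball 0 R" using \<xi> by auto
      then have "norm \<xi> < norm \<omega>" using \<xi> by auto
      then have "norm (\<xi> / \<omega>) < 1" by (simp add: norm_divide divide_simps)
      then have "Re (\<xi> / \<omega>) < 1"
        using complex_Re_le_cmod[of "\<xi> / \<omega>"] by linarith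
      then show False using \<omega>(2) by (auto simp: complex_nonpos_Reals_iff)
    qed
    then show "\<xi> \<in> star P \<inter> ball 0 R" using \<xi> by auto
  qed (auto simp: star_def)
  have op: "open {\<xi>. 1 - \<xi> / \<omega> \<notin> \<real>\<^sub>\<le>\<^sub>0}" if "\<omega> \<in> P" for \<omega>
  proof -
    have "\<omega> \<noteq> 0" using that P0 by auto
    have "open ((\<lambda>\<xi>. 1 - \<xi> / \<omega>) -` (- \<real>\<^sub>\<le>\<^sub>0))"
      by (intro open_vimage open_Compl closed_nonpos_Reals_complex continuous_intros) (use \<open>\<omega> \<noteq> 0\<close> in auto)
    then show ?thesis by (simp add: vimage_def)
  qed
  show "open (star P \<inter> ball 0 R)" unfolding eq
    by (intro open_Int open_ball open_INT fin ballI op) auto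
  show "closed_segment 0 x \<subseteq> star P \<inter> ball 0 R" if "x \<in> star P \<inter> ball 0 R"
  proof -
    have "closed_segment 0 x \<subseteq> ball 0 R"
    proof (rule closed_segment_subset)
      show "0 \<in> ball 0 R" using that by (auto intro: le_less_trans[OF norm_ge_zero])
    qed (use that in auto)
    then show ?thesis using starlike_star[OF P0, of x] that by auto
  qed
qed

lemma branch_rep:
  assumes R: "0 < R"
  obtains g where "g holomorphic_on ball 0 R"
    "\<And>\<xi>. \<xi> \<in> star P \<inter> ball 0 R \<Longrightarrow> main_branch f \<xi> = g \<xi> +
       (\<Sum>\<omega>\<in>P \<inter> ball 0 R. r \<omega> * (A \<xi> / (\<xi> - \<omega>) + B \<omega> \<xi> * Ln (1 - \<xi> / \<omega>)))"
proof -
  obtain g where g: "g holomorphic_on ball 0 R" "\<forall>\<^sub>F \<xi> in nhds 0. f \<xi> =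
        g \<xi> + (\<Sum>\<omega>\<in>P \<inter> ball 0 R. r \<omega> * (A \<xi> / (\<xi> - \<omega>) + B \<omega> \<xi> * Ln (1 - \<xi> / \<omega>)))"
    using rep[OF R] by blast
  have H: "(\<lambda>\<xi>. g \<xi> + (\<Sum>\<omega>\<in>P \<inter> ball 0 R. r \<omega> * (A \<xi> / (\<xi> - \<omega>) + B \<omega> \<xi> * Ln (1 - \<xi> / \<omega>))))
      holomorphic_on star P \<inter> ball 0 R"
  proof (intro holomorphic_intros holomorphic_on_subset[OF g(1)] holomorphic_on_subset[OF A] holomorphic_on_subset[OF B])
    fix \<omega> \<xi> assume a: "\<omega> \<in> P \<inter> ball 0 R" "\<xi> \<in> star P \<inter> ball 0 R"
    then have "1 - \<xi> / \<omega> \<notin> \<real>\<^sub>\<le>\<^sub>0" by (auto simp: star_def)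
    then show "1 - \<xi> / \<omega> \<notin> \<real>\<^sub>\<le>\<^sub>0" .
    show "\<omega> \<noteq> 0" using a P0 by auto
    then show "\<xi> - \<omega> \<noteq> 0" using \<open>1 - \<xi> / \<omega> \<notin> \<real>\<^sub>\<le>\<^sub>0\<close> by auto
  qed auto
  show ?thesis
    by (rule that[OF g(1)]) (rule main_branch_starlike(3)[OF star_ball H g(2)])
qed

lemma star_subset_main_sheet: "star P \<subseteq> main_sheet f"
proof
  fix \<xi> assume \<xi>: "\<xi> \<in> star P"
  have "path_image (linepath 0 \<xi>) \<inter> P = {}"
  proof -
    have "x \<notin> P" if "x \<in> star P" for x
    proof
      assume "x \<in> P"
      moreover have "1 - x / x \<in> \<real>\<^sub>\<le>\<^sub>0" using \<open>x \<in> P\<close> P0 by (cases "x = 0") auto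
      ultimately show False using that by (auto simp: star_def)
    qed
    then show ?thesis using starlike_star[OF P0 \<xi>] by auto
  qed
  then have "\<exists>F. continuation_along f (linepath 0 \<xi>) F"
    by (intro continuation_exists) (simp_all del: path_image_linepath add: linepath_0')
  then show "\<xi> \<in> main_sheet f" by (simp add: main_sheet_def)
qed

text \<open>A continuation along a segment that leaves the star would pass over a point of
  \<open>P\<close>. At the first such point \<omega>, multiply by \<open>\<xi> - \<omega>\<close>:
  the continuation is analytic there, so the product tends to 0, whereas the representation gives
  the nonzero residue \<open>r \<omega> * A \<omega>\<close>.\<close>

lemma main_sheet_eq: "main_sheet f = star P"
proof (rule ccontr)
  assume "main_sheet f \<noteq> star P"
  then obtain \<xi> where \<xi>: "\<xi> \<in> main_sheet f" "\<xi> \<notin> star P" using star_subset_main_sheet by blast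
  obtain F where F: "continuation_along f (linepath 0 \<xi>) F" using \<xi>(1) by (auto simp: main_sheet_def)
  \<comment> \<open>The parameters of the obstructions. They are mapped injectively into the finite
    part of \<open>P\<close> in a disk, so there is a first one.\<close>
  define T where "T = {t. 0 < t \<and> t \<le> 1 \<and> of_real t * \<xi> \<in> P}"
  have Tne: "T \<noteq> {}" using \<xi>(2) not_in_star_iff[OF P0] by (auto simp: T_def)
  have \<xi>0: "\<xi> \<noteq> 0" using Tne P0 by (auto simp: T_def)
  define R where "R = norm \<xi> + 1"
  have R: "0 < R" by (simp add: R_def add_nonneg_pos)
  have inR: "of_real t * \<xi> \<in> ball 0 R" if "0 \<le> t" "t \<le> 1" for t
  proof -
    have "\<bar>t\<bar> * norm \<xi> \<le> 1 * norm \<xi>" using that by (intro mult_right_mono) auto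
    then show ?thesis by (simp add: R_def norm_mult)
  qed
  have "finite T"
  proof (rule inj_on_finite)
    show "inj_on (\<lambda>t. of_real t * \<xi>) T" using \<xi>0 by (auto simp: inj_on_def)
    show "(\<lambda>t. of_real t * \<xi>) ` T \<subseteq> P \<inter> ball 0 R" using inR by (auto simp: T_def)
  qed (rule fin)
  define t' where "t' = Min T"
  have t': "t' \<in> T" and tmin: "\<And>t. t \<in> T \<Longrightarrow> t' \<le> t"
    using \<open>finite T\<close> Tne by (auto simp: t'_def)
  define \<omega> where "\<omega> = of_real t' * \<xi>"
  have \<omega>: "\<omega> \<in> P" "\<omega> \<in> ball 0 R" "0 < t'" "t' \<le> 1" using t' inR[of t'] by (auto simp: T_def \<omega>_def)
  have \<omega>0: "\<omega> \<noteq> 0" using \<omega>(1) P0 by auto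
  have instar: "of_real s * \<xi> \<in> star P \<inter> ball 0 R" if s: "0 < s" "s < t'" for s
  proof -
    have "of_real s * \<xi> \<in> star P"
    proof (rule ccontr)
      assume "of_real s * \<xi> \<notin> star P"
      then obtain t where t: "0 < t" "t \<le> 1" "of_real t * (of_real s * \<xi>) \<in> P"
        using not_in_star_iff[OF P0] by blast
      have le: "t * s \<le> s" using t s mult_right_mono[of t 1 s] by simp
      then have "t * s \<le> 1" using s \<omega>(4) by linarith
      then have "t * s \<in> T" using t s unfolding T_def by (simp add: mult.assoc)
      then show False using tmin[of "t * s"] le s by linarith
    qed
    then show ?thesis using inR[of s] s \<omega>(4) by simp
  qed
  obtain g where g: "g holomorphic_on ball 0 R"
    "\<And>\<xi>. \<xi> \<in> star P \<inter> ball 0 R \<Longrightarrow> main_branch f \<xi> = g \<xi> +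
       (\<Sum>\<omega>\<in>P \<inter> ball 0 R. r \<omega> * (A \<xi> / (\<xi> - \<omega>) + B \<omega> \<xi> * Ln (1 - \<xi> / \<omega>)))"
    using branch_rep[OF R] by blast
  define X where "X s = complex_of_real s * \<xi>" for s
  define \<Omega> where "\<Omega> x = g x + (\<Sum>w\<in>P \<inter> ball 0 R - {\<omega>}. r w * (A x / (x - w) + B w x * Ln (1 - x / w)))" for x
  have Acont: "isCont A x" "isCont (B w) x" for x w
    using A B[of w] by (meson UNIV_I continuous_on_eq_continuous_at holomorphic_on_imp_continuous_on open_UNIV)+
  have "isCont \<Omega> \<omega>"
    unfolding \<Omega>_def
  proof (intro continuous_intros Acont)
    show "isCont g \<omega>" using g(1) \<omega>(2)
      by (meson continuous_on_eq_continuous_at holomorphic_on_imp_continuous_on open_ball)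
    fix w assume w: "w \<in> P \<inter> ball 0 R - {\<omega>}"
    show "w \<noteq> 0" using w P0 by auto
    show "\<omega> - w \<noteq> 0" using w by auto
    \<comment> \<open>If \<omega> lay on the cut of another point w, then w would lie on the segment
      before \<omega>, against the minimality of \<open>t'\<close>.\<close>
    show "1 - \<omega> / w \<notin> \<real>\<^sub>\<le>\<^sub>0"
    proof
      assume "1 - \<omega> / w \<in> \<real>\<^sub>\<le>\<^sub>0"
      then have "\<omega> \<notin> star {w}" by (auto simp: star_def)
      then obtain t where t: "0 < t" "t \<le> 1" "of_real t * \<omega> = w"
        using not_in_star_iff[of "{w}" \<omega>] \<open>w \<noteq> 0\<close> by auto
      have "t \<noteq> 1" using t w by auto
      have lt: "t * t' < t'" using t \<open>t \<noteq> 1\<close> \<omega>(3) by simp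
      have "t * t' \<le> 1" using lt \<omega>(4) by linarith
      moreover have "0 < t * t'" using t(1) \<omega>(3) by simp
      moreover have "of_real (t * t') * \<xi> \<in> P" using t(3) w by (simp add: \<omega>_def mult.assoc)
      ultimately have "t * t' \<in> T" unfolding T_def by blast
      then show False using tmin[of "t * t'"] lt by linarith
    qed
  qed
  have Xlim: "(X \<longlongrightarrow> \<omega>) (at_left t')"
    unfolding X_def \<omega>_def by (intro tendsto_intros)
  have "((\<lambda>s. (X s - \<omega>) * \<Omega> (X s)) \<longlongrightarrow> (\<omega> - \<omega>) * \<Omega> \<omega>) (at_left t')"
    by (intro tendsto_intros Xlim isCont_tendsto_compose[OF \<open>isCont \<Omega> \<omega>\<close>])
  \<comment> \<open>On the segment \<open>1 - X s / \<omega> = 1 - s / t'\<close> is a positive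
    real, so this is the real limit of \<open>y * ln y\<close> at 0.\<close>
  moreover have "((\<lambda>s. (X s - \<omega>) * Ln (1 - X s / \<omega>)) \<longlongrightarrow> 0) (at_left t')"
  proof -
    have y: "filterlim (\<lambda>s. 1 - s / t') (at_right 0) (at_left t')"
      unfolding filterlim_at
    proof
      have "((\<lambda>s. 1 - s / t') \<longlongrightarrow> 1 - t' / t') (at_left t')"
        by (intro tendsto_intros) (use \<omega>(3) in auto)
      then show "((\<lambda>s. 1 - s / t') \<longlongrightarrow> 0) (at_left t')" using \<omega>(3) by simp
      show "\<forall>\<^sub>F s in at_left t'. 1 - s / t' \<in> {0<..} \<and> 1 - s / t' \<noteq> 0"
        using \<omega>(3) by (auto simp: eventually_at_filter divide_simps)
    qed
    have "((\<lambda>y::real. y * ln y) \<longlongrightarrow> 0) (at_right 0)" by real_asymp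
    from filterlim_compose[OF this y]
    have "((\<lambda>s. - \<omega> * complex_of_real ((1 - s / t') * ln (1 - s / t'))) \<longlongrightarrow> - \<omega> * complex_of_real 0) (at_left t')"
      by (intro tendsto_intros)
    moreover have "\<forall>\<^sub>F s in at_left t'. - \<omega> * complex_of_real ((1 - s / t') * ln (1 - s / t')) = (X s - \<omega>) * Ln (1 - X s / \<omega>)"
      unfolding eventually_at_filter
    proof (intro always_eventually allI impI)
      fix s assume "s \<in> {..<t'}"
      then have pos: "0 < 1 - s / t'" using \<omega>(3) by (simp add: divide_simps)
      have e: "X s / \<omega> = of_real (s / t')" using \<xi>0 \<omega>(3) by (simp add: X_def \<omega>_def)
      then have "Ln (1 - X s / \<omega>) = of_real (ln (1 - s / t'))"
        using Ln_of_real[OF pos] by simp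
      moreover have "X s - \<omega> = - \<omega> * of_real (1 - s / t')"
        using e \<omega>0 by (simp add: field_simps)
      ultimately show "- \<omega> * complex_of_real ((1 - s / t') * ln (1 - s / t')) = (X s - \<omega>) * Ln (1 - X s / \<omega>)"
        by simp
    qed
    ultimately show ?thesis by (auto intro: Lim_transform_eventually)
  qed
  moreover have "((\<lambda>s. A (X s)) \<longlongrightarrow> A \<omega>) (at_left t')" "((\<lambda>s. B \<omega> (X s)) \<longlongrightarrow> B \<omega> \<omega>) (at_left t')"
    by (intro isCont_tendsto_compose[OF Acont(1)] isCont_tendsto_compose[OF Acont(2)] Xlim)+
  ultimately have L0: "((\<lambda>s. (X s - \<omega>) * \<Omega> (X s) + r \<omega> * (A (X s) + B \<omega> (X s) * ((X s - \<omega>) * Ln (1 - X s / \<omega>))))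
      \<longlongrightarrow> (\<omega> - \<omega>) * \<Omega> \<omega> + r \<omega> * (A \<omega> + B \<omega> \<omega> * 0)) (at_left t')"
    by (intro tendsto_add[of "\<lambda>s. (X s - \<omega>) * \<Omega> (X s)"] tendsto_mult[of "\<lambda>s. B \<omega> (X s)"]
        tendsto_mult[of "\<lambda>s. r \<omega>"] tendsto_add[of "\<lambda>s. A (X s)"] tendsto_const)
  then have L1: "((\<lambda>s. (X s - \<omega>) * \<Omega> (X s) + r \<omega> * (A (X s) + B \<omega> (X s) * ((X s - \<omega>) * Ln (1 - X s / \<omega>))))
      \<longlongrightarrow> r \<omega> * A \<omega>) (at_left t')" by simp
  have t'in: "t' \<in> {0..1}" using \<omega> by auto
  have lpX: "linepath 0 \<xi> s = X s" for s by (simp add: linepath_def X_def scaleR_conv_of_real)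
  have "F t' analytic_on {\<omega>}"
    using F t'in unfolding continuation_along_def lpX by (simp add: X_def \<omega>_def)
  then have "isCont (F t') \<omega>" by (rule analytic_at_imp_isCont)
  then have "((\<lambda>s. (X s - \<omega>) * F t' (X s)) \<longlongrightarrow> (\<omega> - \<omega>) * F t' \<omega>) (at_left t')"
    by (intro tendsto_intros Xlim isCont_tendsto_compose[where g = "F t'"])
  then have L2: "((\<lambda>s. (X s - \<omega>) * F t' (X s)) \<longlongrightarrow> 0) (at_left t')" by simp
  have "\<forall>\<^sub>F s in at t' within {0..1}. \<forall>\<^sub>F w in nhds (X s). F s w = F t' w"
    using F t'in unfolding continuation_along_def lpX by simp
  then obtain d where d: "0 < d" "\<And>s. s \<in> {0..1} \<Longrightarrow> s \<noteq> t' \<Longrightarrow> dist s t' < d \<Longrightarrow> \<forall>\<^sub>F w in nhds (X s). F s w = F t' w"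
    unfolding eventually_at by blast
  have "\<forall>\<^sub>F s in at_left t'. s \<in> {max 0 (t' - d)<..<t'}"
    by (rule eventually_at_left_real) (use d \<omega> in auto)
  then have "\<forall>\<^sub>F s in at_left t'. (X s - \<omega>) * F t' (X s) =
      (X s - \<omega>) * \<Omega> (X s) + r \<omega> * (A (X s) + B \<omega> (X s) * ((X s - \<omega>) * Ln (1 - X s / \<omega>)))"
  proof eventually_elim
    case (elim s)
    then have s: "0 < s" "s < t'" "dist s t' < d" by (auto simp: dist_real_def)
    then have "F s (X s) = F t' (X s)"
      using d(2)[of s] \<omega>(4) by (auto dest: eventually_nhds_x_imp_x)
    \<comment> \<open>Rescaling the continuation identifies \<open>F s (X s)\<close> with the main
      branch, to which the representation applies.\<close>
    moreover have "continuation_along f (linepath 0 (X s)) (\<lambda>u. F (s * u))"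
      unfolding X_def by (rule continuation_along_linepath_initial[OF F]) (use s \<omega> in auto)
    from main_branch_eqI[OF this] have "main_branch f (X s) = F s (X s)" by simp
    ultimately have "F t' (X s) = g (X s) +
       (\<Sum>\<omega>\<in>P \<inter> ball 0 R. r \<omega> * (A (X s) / (X s - \<omega>) + B \<omega> (X s) * Ln (1 - X s / \<omega>)))"
      using g(2)[of "X s"] instar[OF s(1,2)] by (simp add: X_def)
    also have "\<dots> = \<Omega> (X s) + r \<omega> * (A (X s) / (X s - \<omega>) + B \<omega> (X s) * Ln (1 - X s / \<omega>))"
      unfolding \<Omega>_def using \<omega> by (simp add: sum.remove[OF fin[of R], of \<omega>])
    finally have eq: "F t' (X s) = \<dots>" .
    have "X s - \<omega> \<noteq> 0" using s \<xi>0 by (simp add: X_def \<omega>_def)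
    then show ?case unfolding eq by (simp add: field_simps)
  qed
  from tendsto_unique[OF _ L1 Lim_transform_eventually[OF L2 this]]
  have "r \<omega> * A \<omega> = 0" by simp
  then show False using nz[OF \<omega>(1)] by simp
qed

text \<open>The cuts may split a disk around \<omega> into several pieces: a point of
  \<open>P\<close> on the segment from 0 to \<omega> has a cut running through \<omega>. The other
  logarithms extend across these cuts up to constants depending on the piece, hence one branch
  \<open>l\<close> and one regular part for each component.\<close>

lemma local_form:
  assumes \<omega>: "\<omega> \<in> P"
  shows "\<exists>\<epsilon>>0. \<forall>U\<in>components (main_sheet f \<inter> ball \<omega> \<epsilon>). \<exists>l Q. l holomorphic_on U \<and>
    (\<forall>\<xi>\<in>U. exp (l \<xi>) = \<xi> - \<omega>) \<and> Q holomorphic_on ball \<omega> \<epsilon> \<and>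
    (\<forall>\<xi>\<in>U. main_branch f \<xi> = r \<omega> * (A \<omega> / (\<xi> - \<omega>) + B \<omega> \<xi> * l \<xi>) + Q \<xi>)"
proof -
  define R where "R = norm \<omega> + 1"
  have R: "0 < R" by (simp add: R_def add_nonneg_pos)
  have \<omega>0: "\<omega> \<noteq> 0" and \<omega>R: "\<omega> \<in> ball 0 R" using \<omega> P0 by (auto simp: R_def)
  obtain d where d: "0 < d" "\<And>w. w \<in> P \<inter> ball 0 R \<Longrightarrow> w \<noteq> \<omega> \<Longrightarrow> d \<le> dist \<omega> w"
    using finite_set_avoid[OF fin[of R], of \<omega>] by blast
  define \<epsilon> where "\<epsilon> = min 1 d"
  have \<epsilon>: "0 < \<epsilon>" "\<epsilon> \<le> 1" "\<epsilon> \<le> d" using d by (auto simp: \<epsilon>_def)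
  have sub: "ball \<omega> \<epsilon> \<subseteq> ball 0 R"
  proof
    fix x assume "x \<in> ball \<omega> \<epsilon>"
    then have "norm (x - \<omega>) < 1" using \<epsilon> by (simp add: dist_norm norm_minus_commute)
    then show "x \<in> ball 0 R" using norm_triangle_ineq2[of x \<omega>] by (simp add: R_def)
  qed
  obtain g where g: "g holomorphic_on ball 0 R"
    "\<And>\<xi>. \<xi> \<in> star P \<inter> ball 0 R \<Longrightarrow> main_branch f \<xi> = g \<xi> +
       (\<Sum>\<omega>\<in>P \<inter> ball 0 R. r \<omega> * (A \<xi> / (\<xi> - \<omega>) + B \<omega> \<xi> * Ln (1 - \<xi> / \<omega>)))"
    using branch_rep[OF R] by blast
  \<comment> \<open>The difference quotient of \<open>A\<close> at \<omega>; it turns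
    \<open>A \<xi> / (\<xi> - \<omega>)\<close> into \<open>A \<omega> / (\<xi> - \<omega>)\<close>
    plus an entire function.\<close>
  define a1 where "a1 z = (if z = \<omega> then deriv A \<omega> else (A z - A \<omega>) / (z - \<omega>))" for z
  have a1: "a1 holomorphic_on UNIV"
    unfolding a1_def by (rule pole_lemma[OF A]) simp
  show ?thesis
  proof (intro exI[of _ \<epsilon>] conjI ballI \<epsilon>(1))
    fix U assume U: "U \<in> components (main_sheet f \<inter> ball \<omega> \<epsilon>)"
    have Usub: "U \<subseteq> star P" "U \<subseteq> ball \<omega> \<epsilon>" "connected U" "U \<noteq> {}"
      using in_components_subset[OF U] in_components_connected[OF U] in_components_nonempty[OF U] main_sheet_eq by auto
    have "star P \<inter> ball \<omega> \<epsilon> = (star P \<inter> ball 0 R) \<inter> ball \<omega> \<epsilon>" using sub by auto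
    then have "open (star P \<inter> ball \<omega> \<epsilon>)" using star_ball(1)[of R] by auto
    then have Uo: "open U" using U main_sheet_eq open_components by simp
    \<comment> \<open>The point w is outside the disk, so the logarithm of
      \<open>(\<xi> - w) / (\<omega> - w)\<close> is holomorphic on the whole disk. On the connected
      set U it differs from \<open>Ln (1 - \<xi> / w)\<close> by a constant, both having derivative
      \<open>1 / (\<xi> - w)\<close>.\<close>
    have "\<exists>\<kappa>. \<kappa> holomorphic_on ball \<omega> \<epsilon> \<and> (\<forall>\<xi>\<in>U. Ln (1 - \<xi> / w) = \<kappa> \<xi>)" if w: "w \<in> P \<inter> ball 0 R - {\<omega>}" for w
    proof -
      have w0: "w \<noteq> 0" and w\<omega>: "\<omega> - w \<noteq> 0" using w P0 by auto
      have slit: "(\<xi> - w) / (\<omega> - w) \<notin> \<real>\<^sub>\<le>\<^sub>0" if "\<xi> \<in> ball \<omega> \<epsilon>" for \<xi>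
      proof -
        have "norm (\<xi> - \<omega>) < norm (\<omega> - w)"
          using that d(2)[of w] w \<epsilon> by (auto simp: dist_norm norm_minus_commute)
        then have "norm ((\<xi> - \<omega>) / (\<omega> - w)) < 1" using w\<omega> by (simp add: norm_divide divide_simps)
        then have "Re ((\<xi> - \<omega>) / (\<omega> - w)) > -1" using abs_Re_le_cmod[of "(\<xi> - \<omega>) / (\<omega> - w)"] by linarith
        moreover have "(\<xi> - w) / (\<omega> - w) = 1 + (\<xi> - \<omega>) / (\<omega> - w)" using w\<omega> by (simp add: field_simps)
        ultimately show ?thesis by (simp add: complex_nonpos_Reals_iff)
      qed
      have k0: "(\<lambda>\<xi>. Ln ((\<xi> - w) / (\<omega> - w))) holomorphic_on ball \<omega> \<epsilon>"
        by (intro holomorphic_intros) (use slit w\<omega> in auto)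
      have "(\<lambda>\<xi>. Ln (1 - \<xi> / w) - Ln ((\<xi> - w) / (\<omega> - w))) constant_on U"
      proof (rule has_field_derivative_0_imp_constant_on[OF _ Usub(3) Uo])
        have sl: "1 - \<xi> / w \<notin> \<real>\<^sub>\<le>\<^sub>0" if "\<xi> \<in> U" for \<xi> using that Usub w by (auto simp: star_def)
        show "((\<lambda>\<xi>. Ln (1 - \<xi> / w) - Ln ((\<xi> - w) / (\<omega> - w))) has_field_derivative 0) (at \<xi>)" if "\<xi> \<in> U" for \<xi>
        proof -
          have n: "1 - \<xi> / w \<noteq> 0" using sl[OF that] by auto
          then have "\<xi> - w \<noteq> 0" using w0 by auto
          have s2: "(\<xi> - w) / (\<omega> - w) \<notin> \<real>\<^sub>\<le>\<^sub>0" using slit that Usub by auto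
          have "((\<lambda>\<xi>. Ln (1 - \<xi> / w) - Ln ((\<xi> - w) / (\<omega> - w))) has_field_derivative
             inverse (1 - \<xi> / w) * (- (1 / w)) - inverse ((\<xi> - w) / (\<omega> - w)) * (1 / (\<omega> - w))) (at \<xi>)"
            using sl[OF that] s2 w0 w\<omega> by (auto intro!: derivative_eq_intros simp: divide_inverse)
          moreover have "inverse (1 - \<xi> / w) * (- (1 / w)) = inverse (\<xi> - w)"
            using n w0 \<open>\<xi> - w \<noteq> 0\<close> by (simp add: field_simps)
          moreover have "inverse ((\<xi> - w) / (\<omega> - w)) * (1 / (\<omega> - w)) = inverse (\<xi> - w)"
            using w\<omega> by (simp add: inverse_eq_divide)
          ultimately show ?thesis by simp
        qed
      qed
      then obtain c where c: "\<And>\<xi>. \<xi> \<in> U \<Longrightarrow> Ln (1 - \<xi> / w) - Ln ((\<xi> - w) / (\<omega> - w)) = c"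
        by (auto simp: constant_on_def)
      have "(\<lambda>\<xi>. Ln ((\<xi> - w) / (\<omega> - w)) + c) holomorphic_on ball \<omega> \<epsilon>"
        by (intro holomorphic_intros k0)
      moreover have "Ln (1 - \<xi> / w) = Ln ((\<xi> - w) / (\<omega> - w)) + c" if "\<xi> \<in> U" for \<xi>
        using c[OF that] by (simp add: algebra_simps)
      ultimately show ?thesis by (intro exI[of _ "\<lambda>\<xi>. Ln ((\<xi> - w) / (\<omega> - w)) + c"]) auto
    qed
    then obtain \<kappa> where \<kappa>: "\<And>w. w \<in> P \<inter> ball 0 R - {\<omega>} \<Longrightarrow> \<kappa> w holomorphic_on ball \<omega> \<epsilon>"
      "\<And>w \<xi>. w \<in> P \<inter> ball 0 R - {\<omega>} \<Longrightarrow> \<xi> \<in> U \<Longrightarrow> Ln (1 - \<xi> / w) = \<kappa> w \<xi>" by metis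
    define l where "l \<xi> = Ln (1 - \<xi> / \<omega>) + Ln (- \<omega>)" for \<xi>
    define Q where "Q \<xi> = g \<xi> + r \<omega> * (a1 \<xi> - B \<omega> \<xi> * Ln (- \<omega>)) +
       (\<Sum>w\<in>P \<inter> ball 0 R - {\<omega>}. r w * (A \<xi> / (\<xi> - w) + B w \<xi> * \<kappa> w \<xi>))" for \<xi>
    have sl: "1 - \<xi> / \<omega> \<notin> \<real>\<^sub>\<le>\<^sub>0" if "\<xi> \<in> U" for \<xi> using that Usub \<omega> by (auto simp: star_def)
    show "\<exists>l Q. l holomorphic_on U \<and> (\<forall>\<xi>\<in>U. exp (l \<xi>) = \<xi> - \<omega>) \<and> Q holomorphic_on ball \<omega> \<epsilon> \<and>
       (\<forall>\<xi>\<in>U. main_branch f \<xi> = r \<omega> * (A \<omega> / (\<xi> - \<omega>) + B \<omega> \<xi> * l \<xi>) + Q \<xi>)"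
    proof (rule exI[of _ l], rule exI[of _ Q], intro conjI ballI)
      show "l holomorphic_on U" unfolding l_def by (intro holomorphic_intros) (use sl \<omega>0 in auto)
      show "Q holomorphic_on ball \<omega> \<epsilon>" unfolding Q_def
      proof (intro holomorphic_intros holomorphic_on_subset[OF g(1) sub] holomorphic_on_subset[OF A]
          holomorphic_on_subset[OF B] holomorphic_on_subset[OF a1] \<kappa>(1))
        fix w \<xi> assume "w \<in> P \<inter> ball 0 R - {\<omega>}" "\<xi> \<in> ball \<omega> \<epsilon>"
        then show "\<xi> - w \<noteq> 0" using d(2)[of w] \<epsilon> by auto
      qed auto
      fix \<xi> assume \<xi>: "\<xi> \<in> U"
      have n: "1 - \<xi> / \<omega> \<noteq> 0" using sl[OF \<xi>] by auto
      then have n': "\<xi> - \<omega> \<noteq> 0" using \<omega>0 by auto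
      show "exp (l \<xi>) = \<xi> - \<omega>" using n \<omega>0 by (simp add: l_def exp_add field_simps)
      have "main_branch f \<xi> = g \<xi> +
         (\<Sum>\<omega>\<in>P \<inter> ball 0 R. r \<omega> * (A \<xi> / (\<xi> - \<omega>) + B \<omega> \<xi> * Ln (1 - \<xi> / \<omega>)))"
        using g(2)[of \<xi>] subsetD[OF Usub(1) \<xi>] subsetD[OF sub subsetD[OF Usub(2) \<xi>]] by blast
      also have "\<dots> = g \<xi> + (r \<omega> * (A \<xi> / (\<xi> - \<omega>) + B \<omega> \<xi> * Ln (1 - \<xi> / \<omega>)) +
         (\<Sum>w\<in>P \<inter> ball 0 R - {\<omega>}. r w * (A \<xi> / (\<xi> - w) + B w \<xi> * Ln (1 - \<xi> / w))))"
        using \<omega> \<omega>R by (simp add: sum.remove[OF fin[of R], of \<omega>])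
      also have "(\<Sum>w\<in>P \<inter> ball 0 R - {\<omega>}. r w * (A \<xi> / (\<xi> - w) + B w \<xi> * Ln (1 - \<xi> / w))) =
         (\<Sum>w\<in>P \<inter> ball 0 R - {\<omega>}. r w * (A \<xi> / (\<xi> - w) + B w \<xi> * \<kappa> w \<xi>))"
        by (intro sum.cong refl) (simp add: \<kappa>(2)[OF _ \<xi>])
      also have "A \<xi> / (\<xi> - \<omega>) = A \<omega> / (\<xi> - \<omega>) + a1 \<xi>"
        using n' by (auto simp: a1_def diff_divide_distrib)
      also have "Ln (1 - \<xi> / \<omega>) = l \<xi> - Ln (- \<omega>)" by (simp add: l_def)
      finally show "main_branch f \<xi> = r \<omega> * (A \<omega> / (\<xi> - \<omega>) + B \<omega> \<xi> * l \<xi>) + Q \<xi>"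
        by (simp add: Q_def algebra_simps)
    qed
  qed
qed

end

section \<open>The Gevrey expansion at a root of unity\<close>

lemma power_le_fact_exp:
  assumes "0 \<le> (x::real)" "0 < s"
  shows "x ^ j \<le> fact j / s ^ j * exp (s * x)"
proof -
  have "inverse (fact j) * (s * x) ^ j \<le> (\<Sum>n. inverse (fact n) * (s * x) ^ n)"
    using sum_le_suminf[OF summable_exp[of "s * x"], of "{j}"] assms by simp
  also have "\<dots> = exp (s * x)" by (simp add: exp_def scaleR_conv_of_real inverse_eq_divide)
  finally show ?thesis using assms by (simp add: field_simps power_mult_distrib)
qed

text \<open>Moments of a geometric series: bounding \<open>x ^ j\<close> by
  \<open>fact j / s ^ j * exp (s * x)\<close> costs a slightly larger ratio. This is where the
  factorial of the Gevrey estimates comes from.\<close>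

lemma summable_power_mult_geometric:
  assumes "0 \<le> r" "r < (1::real)" "0 \<le> c"
  shows "summable (\<lambda>n. (real n * c) ^ j * r ^ n)"
    and "\<exists>K D. 0 < K \<and> 0 < D \<and> (\<forall>j. (\<Sum>n. (real n * c) ^ j * r ^ n) \<le> K * D ^ j * fact j)"
proof -
  obtain s where s: "0 < s" "exp s * r < 1"
  proof (cases "r = 0")
    case False
    then have "0 < r" using assms by simp
    \<comment> \<open>This s makes the new ratio \<open>sqrt r\<close>.\<close>
    then have "exp (- ln r / 2) * r = exp (- ln r / 2) * exp (ln r)" by simp
    also have "\<dots> = exp (ln r / 2)" by (simp flip: exp_add)
    also have "\<dots> < 1" using assms \<open>0 < r\<close> by simp
    finally show ?thesis using that[of "- ln r / 2"] assms \<open>0 < r\<close> by simp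
  qed (use that[of 1] in auto)
  have le: "(real n * c) ^ j * r ^ n \<le> fact j * (c / s) ^ j * (exp s * r) ^ n" for n j
  proof -
    have "(real n) ^ j \<le> fact j / s ^ j * exp (s * real n)"
      by (rule power_le_fact_exp) (use s in auto)
    then have "(real n) ^ j * (c ^ j * r ^ n) \<le> fact j / s ^ j * exp (s * real n) * (c ^ j * r ^ n)"
      by (rule mult_right_mono) (use assms in auto)
    also have "exp (s * real n) = exp s ^ n" by (metis exp_of_nat_mult mult.commute)
    finally show ?thesis by (simp add: power_mult_distrib power_divide mult_ac)
  qed
  have g: "summable (\<lambda>n. (exp s * r) ^ n)" using s assms by (intro summable_geometric) auto
  have sm: "summable (\<lambda>n. (real n * c) ^ j * r ^ n)" for j
  proof (rule summable_comparison_test'[OF summable_mult[OF g], of 0 _ "fact j * (c / s) ^ j"])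
    fix n show "norm ((real n * c) ^ j * r ^ n) \<le> fact j * (c / s) ^ j * (exp s * r) ^ n"
      using le[of n j] assms by simp
  qed
  then show "summable (\<lambda>n. (real n * c) ^ j * r ^ n)" .
  define G where "G = (\<Sum>n. (exp s * r) ^ n)"
  have G0: "0 < G" unfolding G_def using suminf_geometric[of "exp s * r"] s assms by simp
  show "\<exists>K D. 0 < K \<and> 0 < D \<and> (\<forall>j. (\<Sum>n. (real n * c) ^ j * r ^ n) \<le> K * D ^ j * fact j)"
  proof (rule exI[of _ G], rule exI[of _ "c / s + 1"], intro conjI allI)
    show "0 < c / s + 1" using s assms by (simp add: add_nonneg_pos)
    fix j :: nat
    have "(\<Sum>n. (real n * c) ^ j * r ^ n) \<le> (\<Sum>n. fact j * (c / s) ^ j * (exp s * r) ^ n)"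
      by (intro suminf_le le sm summable_mult g)
    also have "\<dots> = fact j * (c / s) ^ j * G" unfolding G_def by (rule suminf_mult[OF g])
    also have "\<dots> \<le> fact j * (c / s + 1) ^ j * G"
      using G0 s assms by (intro mult_right_mono mult_left_mono power_mono) auto
    finally show "(\<Sum>n. (real n * c) ^ j * r ^ n) \<le> G * (c / s + 1) ^ j * fact j" by (simp add: mult_ac)
  qed (rule G0)
qed

section \<open>Roots of unity and partial fractions\<close>

lemma norm_root_unity:
  assumes "(x::complex) ^ n = 1" "0 < n"
  shows "norm x = 1"
proof -
  have "norm x ^ n = 1" using assms(1) by (metis norm_one norm_power)
  then show ?thesis using power_eq_imp_eq_base[of "norm x" n 1] assms(2) by auto
qed

text \<open>The powers of x sum to 0, hence n is the sum of the \<open>1 - x ^ j\<close>, each of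
  modulus at most \<open>n * norm (x - 1)\<close>.\<close>

lemma root_unity_dist_1:
  assumes "(x::complex) ^ n = 1" "x \<noteq> 1" "0 < n"
  shows "1 / real n \<le> norm (x - 1)"
proof -
  have "(x - 1) * (\<Sum>j<n. x ^ j) = 0" using power_diff_1_eq[of x n] assms by simp
  then have z: "(\<Sum>j<n. x ^ j) = 0" using assms(2) by simp
  have nx: "norm x = 1" using norm_root_unity assms by blast
  have "of_nat n = (\<Sum>j<n. 1 - x ^ j)" using z by (simp add: sum_subtractf)
  then have "real n = norm (\<Sum>j<n. 1 - x ^ j)" by (metis norm_of_nat)
  also have "\<dots> \<le> (\<Sum>j<n. norm (1 - x ^ j))" by (rule norm_sum)
  also have "\<dots> \<le> (\<Sum>j<n. real n * norm (x - 1))"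
  proof (rule sum_mono)
    fix j assume j: "j \<in> {..<n}"
    have "norm (1 ^ j - x ^ j) \<le> real j * norm (1 - x)" by (rule norm_power_diff) (use nx in auto)
    also have "\<dots> \<le> real n * norm (x - 1)" using j by (simp add: norm_minus_commute mult_right_mono)
    finally show "norm (1 - x ^ j) \<le> real n * norm (x - 1)" by simp
  qed
  finally have "real n * 1 \<le> real n * (real n * norm (x - 1))" by simp
  then show ?thesis using assms(3) by (simp add: field_simps)
qed

text \<open>Multiplication by a primitive root \<mu> permutes the roots of unity and multiplies the
  sum by \<open>\<mu> ^ m\<close>, which is not 1.\<close>

lemma sum_powers_roots_unity:
  assumes "0 < m" "m < n"
  shows "(\<Sum>L\<in>{L::complex. L ^ n = 1}. L ^ m) = 0"
proof -
  let ?R = "{L::complex. L ^ n = 1}"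
  define \<mu> where "\<mu> = cis (2 * pi / real n)"
  have \<mu>n: "\<mu> ^ n = 1" unfolding \<mu>_def Complex.DeMoivre using assms by simp
  have \<mu>0: "\<mu> \<noteq> 0" by (simp add: \<mu>_def)
  have \<mu>m: "\<mu> ^ m \<noteq> 1"
  proof
    assume "\<mu> ^ m = 1"
    then have e: "cis (2 * pi * real m / real n) = cis (2 * pi * real 0 / real n)"
      by (simp add: \<mu>_def Complex.DeMoivre mult_ac)
    have inj: "inj_on (\<lambda>k. cis (2 * pi * real k / real n)) {..<n}"
      by (rule bij_betw_imp_inj_on[OF Complex.bij_betw_roots_unity]) (use assms in simp)
    have "m = 0" by (rule inj_onD[OF inj e]) (use assms in auto)
    then show False using assms by simp
  qed
  have "(\<Sum>L\<in>?R. L ^ m) = (\<Sum>L\<in>?R. (\<mu> * L) ^ m)"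
  proof (rule sum.reindex_bij_witness[of _ "\<lambda>L. \<mu> * L" "\<lambda>L. L / \<mu>"])
    show "a / \<mu> \<in> ?R" if "a \<in> ?R" for a using that \<mu>n by (simp add: power_divide)
    show "\<mu> * b \<in> ?R" if "b \<in> ?R" for b using that \<mu>n by (simp add: power_mult_distrib)
  qed (use \<mu>0 in auto)
  also have "\<dots> = \<mu> ^ m * (\<Sum>L\<in>?R. L ^ m)" by (simp add: power_mult_distrib sum_distrib_left)
  finally have "(1 - \<mu> ^ m) * (\<Sum>L\<in>?R. L ^ m) = 0" by (simp add: algebra_simps)
  then show ?thesis using \<mu>m by simp
qed

text \<open>Multiplied by \<open>q ^ n - 1 = q ^ n - L ^ n\<close>, each fraction becomes a
  polynomial in q; summed over L, all coefficients but the constant one vanish.\<close>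

lemma partial_fractions_roots_unity:
  assumes "0 < n" "(q::complex) ^ n \<noteq> 1"
  shows "(\<Sum>L\<in>{L. L ^ n = 1}. L / (q - L)) = of_nat n / (q ^ n - 1)"
proof -
  let ?R = "{L::complex. L ^ n = 1}"
  have "(\<Sum>L\<in>?R. L / (q - L)) * (q ^ n - 1) = (\<Sum>L\<in>?R. \<Sum>j<n. q ^ j * L ^ (n - j))"
    unfolding sum_distrib_right
  proof (rule sum.cong[OF refl])
    fix L assume L: "L \<in> ?R"
    then have ne: "q - L \<noteq> 0" using assms(2) by auto
    have "q ^ n - 1 = q ^ n - L ^ n" using L by simp
    also have "\<dots> = (q - L) * (\<Sum>j<n. q ^ j * L ^ (n - Suc j))"
      using diff_power_eq_sum[of q "n - 1" L] assms(1) by (simp add: mult.commute)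
    finally have "L / (q - L) * (q ^ n - 1) = L * (\<Sum>j<n. q ^ j * L ^ (n - Suc j))" using ne by simp
    also have "\<dots> = (\<Sum>j<n. q ^ j * L ^ (n - j))"
      unfolding sum_distrib_left
      by (intro sum.cong refl) (auto simp: power_Suc[symmetric] Suc_diff_Suc mult_ac simp del: power_Suc)
    finally show "L / (q - L) * (q ^ n - 1) = (\<Sum>j<n. q ^ j * L ^ (n - j))" .
  qed
  also have "\<dots> = (\<Sum>j<n. q ^ j * (\<Sum>L\<in>?R. L ^ (n - j)))"
    by (subst sum.swap) (simp add: sum_distrib_left)
  also have "\<dots> = (\<Sum>j<n. if j = 0 then of_nat n else 0)"
  proof (rule sum.cong[OF refl])
    fix j assume "j \<in> {..<n}"
    moreover have "(\<Sum>L\<in>?R. L ^ n) = (\<Sum>L\<in>?R. 1)" by (intro sum.cong) auto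
    ultimately show "q ^ j * (\<Sum>L\<in>?R. L ^ (n - j)) = (if j = 0 then of_nat n else 0)"
      using sum_powers_roots_unity[of "n - j" n] card_roots_unity_eq[OF assms(1)] by auto
  qed
  also have "\<dots> = of_nat n" using assms(1) by (simp add: sum.delta)
  finally show ?thesis using assms(2) by (simp add: field_simps)
qed

text \<open>The coefficient of \<open>z ^ n\<close> in the j-th term of the expansion. It arises
  from \<open>(q - \<Lambda>) * L / (q - L)\<close> expanded at \<Lambda>: the root
  \<open>L = \<Lambda>\<close> contributes only to j = 0, every other root only to positive j. For n
  = 0 the division by zero gives 0, in accordance with the vanishing at z = 0 in
  \<open>B_space\<close>.\<close>

definition expl_coeff :: "complex \<Rightarrow> nat \<Rightarrow> nat \<Rightarrow> complex" where
  "expl_coeff \<Lambda> j n = (case j of 0 \<Rightarrow> (if \<Lambda> ^ n = 1 then \<Lambda> else 0)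
      | Suc i \<Rightarrow> - (\<Sum>L\<in>{L. L ^ n = 1} - {\<Lambda>}. L / (L - \<Lambda>) ^ j)) / of_nat n"

definition expl_expansion :: "complex \<Rightarrow> nat \<Rightarrow> complex \<Rightarrow> complex" where
  "expl_expansion \<Lambda> j z = (\<Sum>n. expl_coeff \<Lambda> j n * z ^ n)"

text \<open>The added term at n = 0 is a division by zero and hence 0.\<close>

lemma f_delta_series: "f_delta q z = (\<Sum>n. z ^ n / (q ^ n - 1))"
proof (cases "summable (\<lambda>n. z ^ n / (q ^ n - 1))")
  case True
  from suminf_split_head[OF this] show ?thesis by (simp add: f_delta_def)
next
  \<comment> \<open>No number is a sum of either series, so the two definite descriptions
    coincide.\<close>
  case False
  then have "\<not> summable (\<lambda>n. z ^ Suc n / (q ^ Suc n - 1))" by (subst summable_Suc_iff)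
  then show ?thesis using False by (simp add: f_delta_def suminf_def summable_def)
qed

lemma norm_power_minus_1_ge:
  assumes "norm (q::complex) \<noteq> 1" "0 < n"
  shows "\<bar>norm q - 1\<bar> \<le> norm (q ^ n - 1)"
proof (cases "norm q < 1")
  case True
  have "norm q ^ n \<le> norm q ^ 1" using True assms(2) by (intro power_decreasing) auto
  then show ?thesis using norm_triangle_ineq3[of "q ^ n" 1] True by (simp add: norm_power)
next
  case False
  have "norm q ^ 1 \<le> norm q ^ n" using False assms(2) by (intro power_increasing) auto
  then show ?thesis using norm_triangle_ineq3[of "q ^ n" 1] False by (simp add: norm_power)
qed

lemma f_delta_bound:
  assumes "norm (q::complex) \<noteq> 1" "norm z \<le> r" "r < 1"
  shows "summable (\<lambda>n. z ^ n / (q ^ n - 1))"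
    and "norm (f_delta q z) \<le> (\<Sum>n. r ^ n / \<bar>norm q - 1\<bar>)"
proof -
  have r0: "0 \<le> r" using assms(2) norm_ge_zero[of z] by linarith
  have le: "norm (z ^ n / (q ^ n - 1)) \<le> r ^ n / \<bar>norm q - 1\<bar>" for n
  proof (cases "n = 0")
    case True then show ?thesis by simp
  next
    case False
    then show ?thesis using norm_power_minus_1_ge[OF assms(1), of n] assms
      by (auto simp: norm_divide norm_power intro!: frac_le power_mono zero_le_power[OF r0])
  qed
  have s: "summable (\<lambda>n. r ^ n / \<bar>norm q - 1\<bar>)"
    by (intro summable_divide summable_geometric) (use r0 assms in auto)
  have "summable (\<lambda>n. norm (z ^ n / (q ^ n - 1)))"
    by (rule summable_comparison_test'[OF s, of 0]) (use le in auto)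
  then show "summable (\<lambda>n. z ^ n / (q ^ n - 1))" by (rule summable_norm_cancel)
  show "norm (f_delta q z) \<le> (\<Sum>n. r ^ n / \<bar>norm q - 1\<bar>)"
    unfolding f_delta_series by (rule norm_suminf_le[OF le s])
qed

text \<open>The law of cosines. For y on the unit circle, \<open>t * y\<close> is the centre of a
  disk of radius \<open>\<bar>1 - t\<bar>\<close> tangent to the circle at y.\<close>

lemma norm_diff_scaled_unit:
  assumes "norm (x::complex) = 1" "norm y = 1"
  shows "norm (x - of_real t * y) ^ 2 = (1 - t) ^ 2 + t * norm (x - y) ^ 2"
proof -
  have x: "Re x ^ 2 + Im x ^ 2 = 1" and y: "Re y ^ 2 + Im y ^ 2 = 1"
    using assms by (simp_all flip: cmod_power2)
  define w where "w = Re x * Re y + Im x * Im y"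
  have "norm (x - of_real t * y) ^ 2 = (Re x ^ 2 + Im x ^ 2) - 2 * t * w + t ^ 2 * (Re y ^ 2 + Im y ^ 2)"
    unfolding cmod_power2 by (simp add: power2_eq_square algebra_simps w_def)
  then have 1: "norm (x - of_real t * y) ^ 2 = 1 - 2 * t * w + t ^ 2" unfolding x y by simp
  have "norm (x - y) ^ 2 = (Re x ^ 2 + Im x ^ 2) - 2 * w + (Re y ^ 2 + Im y ^ 2)"
    unfolding cmod_power2 by (simp add: power2_eq_square algebra_simps w_def)
  then have 2: "norm (x - y) ^ 2 = 2 - 2 * w" unfolding x y by simp
  show ?thesis unfolding 1 2 by (simp add: power2_eq_square algebra_simps)
qed

text \<open>Tannery's theorem for the partial sums over j, which \<open>S\<close> dominates in
  n.\<close>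

lemma suminf_swap_dominated:
  fixes b :: "nat \<Rightarrow> nat \<Rightarrow> 'a::{real_normed_algebra, banach}"
  assumes le: "\<And>j n. norm (b j n) \<le> B j n" and S: "\<And>n. (\<lambda>j. B j n) sums S n" and "summable S"
  shows "(\<Sum>j. \<Sum>n. b j n) = (\<Sum>n. \<Sum>j. b j n)"
proof -
  have B0: "0 \<le> B j n" for j n using le[of j n] norm_ge_zero order.trans by blast
  have S0: "0 \<le> S n" for n using sums_le[OF B0 sums_zero S] .
  have BS: "B j n \<le> S n" for j n
    using sum_le_suminf[OF sums_summable[OF S[of n]], of "{j}"] B0 sums_unique[OF S[of n]] by simp
  have s1: "summable (\<lambda>j. b j n)" for n
    by (rule summable_comparison_test'[OF sums_summable[OF S[of n]], of 0]) (use le in auto)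
  have s2: "summable (\<lambda>n. b j n)" for j
    by (rule summable_comparison_test'[OF assms(3), of 0]) (use le[of j] BS[of j] order.trans in blast)
  have bd: "norm (\<Sum>j<J. b j n) \<le> S n" for J n
  proof -
    have "norm (\<Sum>j<J. b j n) \<le> (\<Sum>j<J. B j n)" by (rule sum_norm_le) (rule le)
    also have "\<dots> \<le> S n"
      using sum_le_suminf[OF sums_summable[OF S[of n]], of "{..<J}"] B0 sums_unique[OF S[of n]] by simp
    finally show ?thesis .
  qed
  have "((\<lambda>J. \<Sum>n. \<Sum>j<J. b j n) \<longlongrightarrow> (\<Sum>n. \<Sum>j. b j n)) sequentially"
    using tannerys_theorem[where a = "\<lambda>n J. \<Sum>j<J. b j n" and b = "\<lambda>n. \<Sum>j. b j n" and M = S and F = sequentially]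
      summable_LIMSEQ[OF s1] assms(3) bd by (auto intro: always_eventually)
  moreover have "(\<Sum>n. \<Sum>j<J. b j n) = (\<Sum>j<J. \<Sum>n. b j n)" for J by (rule suminf_sum) (rule s2)
  ultimately have "(\<lambda>j. \<Sum>n. b j n) sums (\<Sum>n. \<Sum>j. b j n)" by (simp add: sums_def)
  then show ?thesis by (rule sums_unique[symmetric])
qed

section \<open>Explicit coefficients and remainder estimates\<close>

locale root_of_unity =
  fixes \<Lambda> :: complex and m0 :: nat
  assumes m0: "0 < m0" and \<Lambda>: "\<Lambda> ^ m0 = 1"
begin

lemma norm_\<Lambda>: "norm \<Lambda> = 1" using norm_root_unity[OF \<Lambda> m0] .

lemma \<Lambda>_ne_0: "\<Lambda> \<noteq> 0" using norm_\<Lambda> by auto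

text \<open>The quotient \<open>L / \<Lambda>\<close> is a root of unity of order dividing
  \<open>n * m0\<close>, different from 1.\<close>

lemma root_dist:
  assumes "L ^ n = 1" "L \<noteq> \<Lambda>" "0 < n"
  shows "1 / norm (L - \<Lambda>) \<le> real n * real m0"
proof -
  have "(L / \<Lambda>) ^ (n * m0) = 1"
    using assms(1) \<Lambda> by (metis div_by_1 power_divide power_mult power_one mult.commute)
  moreover have "L / \<Lambda> \<noteq> 1" using assms(2) \<Lambda>_ne_0 by auto
  ultimately have "1 / real (n * m0) \<le> norm (L / \<Lambda> - 1)"
    by (rule root_unity_dist_1) (use m0 assms in auto)
  also have "L / \<Lambda> - 1 = (L - \<Lambda>) / \<Lambda>" using \<Lambda>_ne_0 by (simp add: field_simps)
  finally have "1 / real (n * m0) \<le> norm (L - \<Lambda>)" by (simp add: norm_divide norm_\<Lambda>)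
  then show ?thesis using m0 assms(2,3) by (simp add: field_simps)
qed

lemma norm_sum_roots_le:
  fixes h :: "complex \<Rightarrow> complex"
  assumes "0 < n" "\<And>L. L ^ n = 1 \<Longrightarrow> L \<noteq> \<Lambda> \<Longrightarrow> norm (h L) \<le> B" "0 \<le> B"
  shows "norm ((\<Sum>L\<in>{L. L ^ n = 1} - {\<Lambda>}. h L) / of_nat n) \<le> B"
proof -
  have f: "finite {L::complex. L ^ n = 1}" using assms(1) by (simp add: finite_roots_unity)
  have "norm (\<Sum>L\<in>{L. L ^ n = 1} - {\<Lambda>}. h L) \<le> of_nat (card ({L. L ^ n = 1} - {\<Lambda>})) * B"
    by (rule sum_norm_bound) (use assms in auto)
  also have "card ({L. L ^ n = 1} - {\<Lambda>}) \<le> n"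
    using card_mono[OF f, of "{L. L ^ n = 1} - {\<Lambda>}"] card_roots_unity_eq[OF assms(1)] by auto
  finally have "norm (\<Sum>L\<in>{L. L ^ n = 1} - {\<Lambda>}. h L) \<le> real n * B"
    using assms(3) by (simp add: mult_right_mono)
  then show ?thesis using assms(1) by (simp add: norm_divide field_simps)
qed

lemma norm_expl_coeff: "norm (expl_coeff \<Lambda> j n) \<le> (real n * real m0) ^ j"
proof (cases "n = 0")
  case True
  then show ?thesis by (simp add: expl_coeff_def)
next
  case False
  show ?thesis
  proof (cases j)
    case 0
    then show ?thesis using False norm_\<Lambda> by (auto simp: expl_coeff_def norm_divide)
  next
    case (Suc i)
    have "norm ((\<Sum>L\<in>{L. L ^ n = 1} - {\<Lambda>}. L / (L - \<Lambda>) ^ j) / of_nat n) \<le> (real n * real m0) ^ j"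
    proof (rule norm_sum_roots_le)
      fix L assume L: "L ^ n = 1" "L \<noteq> \<Lambda>"
      have "norm (L / (L - \<Lambda>) ^ j) = (1 / norm (L - \<Lambda>)) ^ j"
        using norm_root_unity[OF L(1)] False by (simp add: norm_divide norm_power power_divide)
      also have "\<dots> \<le> (real n * real m0) ^ j"
        by (rule power_mono[OF root_dist[OF L]]) (use False in auto)
      finally show "norm (L / (L - \<Lambda>) ^ j) \<le> (real n * real m0) ^ j" .
    qed (use False in auto)
    then show ?thesis by (simp add: expl_coeff_def Suc)
  qed
qed

lemma expl_series_bound:
  assumes "norm z \<le> r" "r < 1"
  shows "summable (\<lambda>n. expl_coeff \<Lambda> j n * z ^ n)"
    and "norm (expl_expansion \<Lambda> j z) \<le> (\<Sum>n. (real n * real m0) ^ j * r ^ n)"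
proof -
  have r0: "0 \<le> r" using assms(1) norm_ge_zero[of z] by linarith
  have s: "summable (\<lambda>n. (real n * real m0) ^ j * r ^ n)"
    by (rule summable_power_mult_geometric) (use r0 assms in auto)
  have le: "norm (expl_coeff \<Lambda> j n * z ^ n) \<le> (real n * real m0) ^ j * r ^ n" for n
    using norm_expl_coeff assms r0 by (auto simp: norm_mult norm_power intro!: mult_mono power_mono)
  have "summable (\<lambda>n. norm (expl_coeff \<Lambda> j n * z ^ n))"
    by (rule summable_comparison_test'[OF s, of 0]) (use le in auto)
  then show "summable (\<lambda>n. expl_coeff \<Lambda> j n * z ^ n)" by (rule summable_norm_cancel)
  show "norm (expl_expansion \<Lambda> j z) \<le> (\<Sum>n. (real n * real m0) ^ j * r ^ n)"
    unfolding expl_expansion_def by (rule norm_suminf_le[OF le s])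
qed

lemma expl_expansion_in_B_space:
  assumes "0 < r" "r < 1"
  shows "expl_expansion \<Lambda> j \<in> B_space r"
  unfolding B_space_def
proof (intro CollectI conjI)
  show "expl_expansion \<Lambda> j holomorphic_on ball 0 r"
  proof (rule power_series_holomorphic)
    fix w :: complex assume "w \<in> ball 0 r"
    then show "(\<lambda>n. expl_coeff \<Lambda> j n * (w - 0) ^ n) sums expl_expansion \<Lambda> j w"
      using expl_series_bound(1)[of w r j] assms by (auto simp: expl_expansion_def summable_sums)
  qed
  show "bounded (expl_expansion \<Lambda> j ` ball 0 r)"
    unfolding bounded_iff using expl_series_bound(2)[of _ r j] assms
    by (intro exI[of _ "\<Sum>n. (real n * real m0) ^ j * r ^ n"]) auto
  show "expl_expansion \<Lambda> j 0 = 0"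
    unfolding expl_expansion_def by (subst powser_zero) (simp add: expl_coeff_def)
qed

text \<open>Coefficientwise in z: partial fractions turn \<open>1 / (q ^ n - 1)\<close> into a sum
  over roots L, and the geometric expansion of \<open>1 / (q - L)\<close> in powers of
  \<open>(q - \<Lambda>) / (L - \<Lambda>)\<close> is truncated with its exact remainder.\<close>

lemma remainder_sums:
  assumes "norm q \<noteq> 1" "norm z < 1"
  shows "(\<lambda>n. (\<Sum>L\<in>{L. L ^ n = 1} - {\<Lambda>}. L * (q - \<Lambda>) ^ Suc N / ((q - L) * (L - \<Lambda>) ^ N)) / of_nat n * z ^ n)
     sums ((q - \<Lambda>) * f_delta q z - (\<Sum>j<Suc N. expl_expansion \<Lambda> j z * (q - \<Lambda>) ^ j))"
proof -
  define Q where "Q = q - \<Lambda>"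
  have s1: "(\<lambda>n. Q * (z ^ n / (q ^ n - 1))) sums (Q * f_delta q z)"
    unfolding f_delta_series by (intro sums_mult summable_sums f_delta_bound(1)[OF assms(1) order.refl assms(2)])
  have s2: "(\<lambda>n. \<Sum>j<Suc N. expl_coeff \<Lambda> j n * z ^ n * Q ^ j) sums (\<Sum>j<Suc N. expl_expansion \<Lambda> j z * Q ^ j)"
    unfolding expl_expansion_def
    by (intro sums_sum sums_mult2 summable_sums expl_series_bound(1)[OF order.refl assms(2)])
  have "Q * (z ^ n / (q ^ n - 1)) - (\<Sum>j<Suc N. expl_coeff \<Lambda> j n * z ^ n * Q ^ j) =
     (\<Sum>L\<in>{L. L ^ n = 1} - {\<Lambda>}. L * Q ^ Suc N / ((q - L) * (L - \<Lambda>) ^ N)) / of_nat n * z ^ n" for n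
  proof (cases "n = 0")
    case True
    then show ?thesis by (simp add: expl_coeff_def)
  next
    case False
    let ?R = "{L::complex. L ^ n = 1}"
    have fin: "finite ?R" using False by (simp add: finite_roots_unity)
    have qL: "q - L \<noteq> 0" if "L \<in> ?R" for L using that norm_root_unity[of L n] False assms(1) by auto
    have q0: "Q \<noteq> 0" using assms(1) norm_\<Lambda> by (auto simp: Q_def)
    have qn: "q ^ n \<noteq> 1" using norm_root_unity[of q n] False assms(1) by auto
    have "of_nat n * (Q / (q ^ n - 1)) = Q * (\<Sum>L\<in>?R. L / (q - L))"
      using partial_fractions_roots_unity[OF _ qn] False by simp
    also have "(\<Sum>L\<in>?R. L / (q - L)) = (if \<Lambda> ^ n = 1 then \<Lambda> / Q else 0) + (\<Sum>L\<in>?R - {\<Lambda>}. L / (q - L))"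
      by (auto simp: sum.remove[OF fin] Q_def)
    also have "Q * \<dots> = (if \<Lambda> ^ n = 1 then \<Lambda> else 0) + (\<Sum>L\<in>?R - {\<Lambda>}. L * Q / (q - L))"
      using q0 by (simp add: ring_distribs sum_distrib_left mult_ac)
    also have "(\<Sum>L\<in>?R - {\<Lambda>}. L * Q / (q - L)) = (\<Sum>L\<in>?R - {\<Lambda>}. L * Q ^ Suc N / ((q - L) * (L - \<Lambda>) ^ N)
        - (\<Sum>j<N. L / (L - \<Lambda>) ^ Suc j * Q ^ Suc j))"
    proof (rule sum.cong[OF refl])
      fix L assume L: "L \<in> ?R - {\<Lambda>}"
      have ne: "q - L \<noteq> 0" "L - \<Lambda> \<noteq> 0" using qL[of L] L by auto
      have qe: "q - L = Q - (L - \<Lambda>)" by (simp add: Q_def)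
      show "L * Q / (q - L) = L * Q ^ Suc N / ((q - L) * (L - \<Lambda>) ^ N) - (\<Sum>j<N. L / (L - \<Lambda>) ^ Suc j * Q ^ Suc j)"
      proof (induction N)
        case 0
        then show ?case by simp
      next
        case (Suc N)
        have e: "Q ^ Suc (Suc N) / ((q - L) * (L - \<Lambda>) ^ Suc N) - Q ^ Suc N / (L - \<Lambda>) ^ Suc N
            = Q ^ Suc N / ((q - L) * (L - \<Lambda>) ^ N)"
        proof -
          have *: "X * (a + d) / (a * (d * Y)) - X / (d * Y) = X / (a * Y)"
            if "a \<noteq> 0" "d \<noteq> 0" "Y \<noteq> 0" for a d X Y :: complex
            using that by (simp add: divide_simps) (simp add: algebra_simps)
          have "Q = (q - L) + (L - \<Lambda>)" by (simp add: Q_def)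
          then show ?thesis using *[of "q - L" "L - \<Lambda>" "(L - \<Lambda>) ^ N" "Q ^ Suc N"] ne
            by (simp add: mult_ac)
        qed
        have "L * Q ^ Suc (Suc N) / ((q - L) * (L - \<Lambda>) ^ Suc N) - (\<Sum>j<Suc N. L / (L - \<Lambda>) ^ Suc j * Q ^ Suc j)
          = L * (Q ^ Suc (Suc N) / ((q - L) * (L - \<Lambda>) ^ Suc N) - Q ^ Suc N / (L - \<Lambda>) ^ Suc N)
             - (\<Sum>j<N. L / (L - \<Lambda>) ^ Suc j * Q ^ Suc j)"
          by (simp add: algebra_simps)
        also have "\<dots> = L * Q / (q - L)" unfolding e Suc.IH by simp
        finally show ?case by simp
      qed
    qed
    also have "\<dots> = (\<Sum>L\<in>?R - {\<Lambda>}. L * Q ^ Suc N / ((q - L) * (L - \<Lambda>) ^ N))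
        - (\<Sum>j<N. (\<Sum>L\<in>?R - {\<Lambda>}. L / (L - \<Lambda>) ^ Suc j) * Q ^ Suc j)"
      by (simp add: sum_subtractf sum.swap[of _ "{..<N}"] sum_distrib_right)
    finally have key: "of_nat n * (Q / (q ^ n - 1)) = (if \<Lambda> ^ n = 1 then \<Lambda> else 0)
       + ((\<Sum>L\<in>?R - {\<Lambda>}. L * Q ^ Suc N / ((q - L) * (L - \<Lambda>) ^ N))
        - (\<Sum>j<N. (\<Sum>L\<in>?R - {\<Lambda>}. L / (L - \<Lambda>) ^ Suc j) * Q ^ Suc j))" .
    have "(\<Sum>j<Suc N. expl_coeff \<Lambda> j n * Q ^ j) =
       expl_coeff \<Lambda> 0 n + (\<Sum>j<N. expl_coeff \<Lambda> (Suc j) n * Q ^ Suc j)"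
      by (subst sum.lessThan_Suc_shift) simp
    also have "\<dots> = ((if \<Lambda> ^ n = 1 then \<Lambda> else 0) - (\<Sum>j<N. (\<Sum>L\<in>?R - {\<Lambda>}. L / (L - \<Lambda>) ^ Suc j) * Q ^ Suc j)) / of_nat n"
    proof -
      have "expl_coeff \<Lambda> (Suc j) n * Q ^ Suc j = - ((\<Sum>L\<in>?R - {\<Lambda>}. L / (L - \<Lambda>) ^ Suc j) * Q ^ Suc j / of_nat n)" for j
        by (simp add: expl_coeff_def)
      then show ?thesis
        by (simp only: sum_negf sum_divide_distrib[symmetric]) (simp add: expl_coeff_def diff_divide_distrib)
    qed
    finally have e2: "(\<Sum>j<Suc N. expl_coeff \<Lambda> j n * Q ^ j) = \<dots>" .
    have "Q / (q ^ n - 1) - (\<Sum>j<Suc N. expl_coeff \<Lambda> j n * Q ^ j)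
        = (\<Sum>L\<in>?R - {\<Lambda>}. L * Q ^ Suc N / ((q - L) * (L - \<Lambda>) ^ N)) / of_nat n"
      unfolding e2 using key False
      by (simp add: field_simps del: power_Suc)
    then have "z ^ n * (Q / (q ^ n - 1) - (\<Sum>j<Suc N. expl_coeff \<Lambda> j n * Q ^ j))
        = z ^ n * ((\<Sum>L\<in>?R - {\<Lambda>}. L * Q ^ Suc N / ((q - L) * (L - \<Lambda>) ^ N)) / of_nat n)" by simp
    then show ?thesis
      by (simp add: right_diff_distrib sum_distrib_left mult_ac del: power_Suc sum.lessThan_Suc)
  qed
  with sums_diff[OF s1 s2] show ?thesis unfolding Q_def by simp
qed

text \<open>The exponent k measures how closely q may approach the roots of unity relative to their
  distance from \<Lambda>; each unit of k costs one more factor n and so one more step in the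
  factorial. It is 2 in the tangent disks and 0 on a segment reaching \<Lambda> transversally, where
  \<mu> is proportional to \<open>norm (q - \<Lambda>)\<close>.\<close>

lemma remainder_bound:
  assumes q: "norm q \<noteq> 1" and z: "norm z \<le> r" "r < 1" and \<mu>: "0 < \<mu>"
    and dist: "\<And>L n. L ^ n = 1 \<Longrightarrow> 0 < n \<Longrightarrow> L \<noteq> \<Lambda> \<Longrightarrow> \<mu> * norm (L - \<Lambda>) ^ k \<le> norm (q - L)"
  shows "norm ((q - \<Lambda>) * f_delta q z - (\<Sum>j<Suc N. expl_expansion \<Lambda> j z * (q - \<Lambda>) ^ j))
     \<le> norm (q - \<Lambda>) ^ Suc N / \<mu> * (\<Sum>n. (real n * real m0) ^ (N + k) * r ^ n)"
proof -
  have r0: "0 \<le> r" using z(1) norm_ge_zero[of z] by linarith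
  let ?a = "\<lambda>n. (\<Sum>L\<in>{L. L ^ n = 1} - {\<Lambda>}. L * (q - \<Lambda>) ^ Suc N / ((q - L) * (L - \<Lambda>) ^ N)) / of_nat n"
  let ?C = "norm (q - \<Lambda>) ^ Suc N / \<mu>"
  have s: "summable (\<lambda>n. (real n * real m0) ^ (N + k) * r ^ n)"
    by (rule summable_power_mult_geometric) (use r0 z in auto)
  have a: "norm (?a n) \<le> ?C * (real n * real m0) ^ (N + k)" for n
  proof (cases "n = 0")
    case False
    show ?thesis
    proof (rule norm_sum_roots_le)
      fix L assume L: "L ^ n = 1" "L \<noteq> \<Lambda>"
      have d: "0 < norm (L - \<Lambda>)" using L(2) by simp
      have "norm (L * (q - \<Lambda>) ^ Suc N / ((q - L) * (L - \<Lambda>) ^ N)) = norm (q - \<Lambda>) ^ Suc N / (norm (q - L) * norm (L - \<Lambda>) ^ N)"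
        using norm_root_unity[OF L(1)] False by (simp add: norm_divide norm_mult norm_power)
      also have "\<dots> \<le> norm (q - \<Lambda>) ^ Suc N / (\<mu> * norm (L - \<Lambda>) ^ k * norm (L - \<Lambda>) ^ N)"
        using dist[OF L(1) _ L(2)] False d \<mu> by (intro frac_le mult_right_mono) auto
      also have "\<dots> = ?C * (1 / norm (L - \<Lambda>)) ^ (N + k)" by (simp add: power_add power_divide field_simps)
      also have "\<dots> \<le> ?C * (real n * real m0) ^ (N + k)"
        using \<mu> root_dist[OF L] False by (intro mult_left_mono power_mono) auto
      finally show "norm (L * (q - \<Lambda>) ^ Suc N / ((q - L) * (L - \<Lambda>) ^ N)) \<le> ?C * (real n * real m0) ^ (N + k)" .
    qed (use \<mu> False in auto)
  qed (use \<mu> in simp)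
  have "norm (?a n * z ^ n) \<le> ?C * ((real n * real m0) ^ (N + k) * r ^ n)" for n
  proof -
    have "norm (?a n * z ^ n) \<le> (?C * (real n * real m0) ^ (N + k)) * r ^ n"
      unfolding norm_mult norm_power
      by (intro mult_mono a power_mono z) (use \<mu> in auto)
    then show ?thesis by (simp add: mult_ac)
  qed
  from norm_suminf_le[OF this summable_mult[OF s]]
  show ?thesis
    using sums_unique[OF remainder_sums[OF q, of z N]] z suminf_mult[OF s, of ?C] by simp
qed

text \<open>With D the distance from L to the centre of the tangent disk, \<open>D ^ 2\<close>
  exceeds the squared radius by \<open>t * norm (L - \<Lambda>) ^ 2\<close>. Factoring the
  difference of squares gives a gap between L and the disk that is quadratic in
  \<open>norm (L - \<Lambda>)\<close>.\<close>

lemma disk_dist: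
  assumes t: "0 < t" "norm L = 1" and q: "norm (q - of_real t * \<Lambda>) < \<bar>1 - t\<bar>" and t1: "t = 1/2 \<or> t = 2"
  shows "norm (L - \<Lambda>) ^ 2 / 4 \<le> norm (q - L)"
proof -
  define D where "D = norm (L - of_real t * \<Lambda>)"
  have D2: "D ^ 2 = (1 - t) ^ 2 + t * norm (L - \<Lambda>) ^ 2"
    unfolding D_def using t(2) norm_\<Lambda> by (rule norm_diff_scaled_unit)
  have Dle: "D \<le> 1 + t" unfolding D_def using norm_triangle_ineq4[of L "of_real t * \<Lambda>"] t norm_\<Lambda>
    by (simp add: norm_mult)
  have Dge: "0 \<le> D" by (simp add: D_def)
  have "(D - \<bar>1 - t\<bar>) * (D + \<bar>1 - t\<bar>) = t * norm (L - \<Lambda>) ^ 2"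
    using D2 by (simp add: algebra_simps power2_eq_square abs_mult_self_eq)
  moreover have nn: "0 \<le> D - \<bar>1 - t\<bar>"
  proof -
    have "\<bar>1 - t\<bar> ^ 2 \<le> D ^ 2" using D2 t by simp
    then show "0 \<le> D - \<bar>1 - t\<bar>" using Dge power2_le_imp_le[of "\<bar>1 - t\<bar>" D] by simp
  qed
  then have "(D - \<bar>1 - t\<bar>) * (D + \<bar>1 - t\<bar>) \<le> (D - \<bar>1 - t\<bar>) * (1 + t + \<bar>1 - t\<bar>)"
    by (rule mult_left_mono[rotated]) (use Dle in simp)
  ultimately have "t * norm (L - \<Lambda>) ^ 2 \<le> (D - \<bar>1 - t\<bar>) * (1 + t + \<bar>1 - t\<bar>)" by simp
  then have *: "t * norm (L - \<Lambda>) ^ 2 \<le> (D - \<bar>1 - t\<bar>) * (1 + t + \<bar>1 - t\<bar>)" .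
  \<comment> \<open>The factor 1/4 is the worse of the two cases; t = 2 alone would give
    1/2.\<close>
  have "norm (L - \<Lambda>) ^ 2 / 4 \<le> D - \<bar>1 - t\<bar>"
    using t1
  proof
    assume t: "t = 1/2"
    have "1/2 * norm (L - \<Lambda>) ^ 2 \<le> (D - 1/2) * 2"
      using * unfolding t by simp
    then show ?thesis unfolding t by simp
  next
    assume t: "t = 2"
    have "2 * norm (L - \<Lambda>) ^ 2 \<le> (D - 1) * 4" "0 \<le> D - 1"
      using * nn unfolding t by simp_all
    then show ?thesis unfolding t by simp
  qed
  moreover have "D \<le> norm (q - L) + norm (q - of_real t * \<Lambda>)"
    unfolding D_def using norm_triangle_ineq4[of "q - of_real t * \<Lambda>" "q - L"] by (simp add: algebra_simps)
  ultimately show ?thesis using q by linarith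
qed

lemma tangent_disk_scaled:
  assumes t1: "t = 1/2 \<or> t = 2"
  shows "tangent_disk \<Lambda> (ball (of_real t * \<Lambda>) \<bar>1 - t\<bar>)"
  unfolding tangent_disk_def
proof (intro exI conjI)
  show "0 < \<bar>1 - t\<bar>" using t1 by auto
  show "sphere (of_real t * \<Lambda>) \<bar>1 - t\<bar> \<inter> sphere 0 1 = {\<Lambda>}"
  proof (intro equalityI subsetI)
    fix x assume "x \<in> {\<Lambda>}"
    moreover have "of_real t * \<Lambda> - \<Lambda> = of_real (t - 1) * \<Lambda>" by (simp add: algebra_simps)
    ultimately show "x \<in> sphere (of_real t * \<Lambda>) \<bar>1 - t\<bar> \<inter> sphere 0 1"
      using norm_\<Lambda> by (simp add: dist_norm norm_mult del: of_real_diff) 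
  next
    fix x assume "x \<in> sphere (of_real t * \<Lambda>) \<bar>1 - t\<bar> \<inter> sphere 0 1"
    then have x: "norm (x - of_real t * \<Lambda>) ^ 2 = (1 - t) ^ 2" "norm x = 1"
      by (auto simp: dist_norm norm_minus_commute)
    have "norm (x - of_real t * \<Lambda>) ^ 2 = (1 - t) ^ 2 + t * norm (x - \<Lambda>) ^ 2"
      using x(2) norm_\<Lambda> by (rule norm_diff_scaled_unit)
    then have "x = \<Lambda>" using x(1) t1 by auto
    then show "x \<in> {\<Lambda>}" by simp
  qed
qed simp

text \<open>The disks with centres \<open>\<Lambda> / 2\<close> and \<open>2 * \<Lambda>\<close>
  serve for all r; only the constants depend on r.\<close>

lemma gevrey1_expl_expansion:
  "gevrey1_expansion \<Lambda> (\<lambda>q z. (q - \<Lambda>) * f_delta q z) (expl_expansion \<Lambda>)"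
  unfolding gevrey1_expansion_def
proof (intro allI impI conjI)
  fix r :: real assume r: "0 < r \<and> r < 1"
  then show "expl_expansion \<Lambda> n \<in> B_space r" for n by (simp add: expl_expansion_in_B_space)
  obtain K D where KD: "0 < K" "0 < D" "\<And>j. (\<Sum>n. (real n * real m0) ^ j * r ^ n) \<le> K * D ^ j * fact j"
    using summable_power_mult_geometric(2)[of r "real m0"] r by auto
  let ?Dm = "ball (of_real (1/2) * \<Lambda>) \<bar>1 - 1/2\<bar>" and ?Dp = "ball (of_real 2 * \<Lambda>) \<bar>1 - 2\<bar>"
  have Dm: "?Dm \<subseteq> ball 0 1"
  proof
    fix q assume "q \<in> ?Dm"
    then have "norm (q - of_real (1/2) * \<Lambda>) < 1/2" by (simp add: dist_norm norm_minus_commute)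
    moreover have "norm q \<le> norm (q - of_real (1/2) * \<Lambda>) + norm (of_real (1/2) * \<Lambda>)"
      using norm_triangle_ineq[of "q - of_real (1/2) * \<Lambda>" "of_real (1/2) * \<Lambda>"] by simp
    ultimately show "q \<in> ball 0 1" using norm_\<Lambda> by (simp add: norm_divide)
  qed
  have Dp: "?Dp \<subseteq> - cball 0 1"
  proof
    fix q assume "q \<in> ?Dp"
    then have "norm (of_real 2 * \<Lambda> - q) < 1" by (simp add: dist_norm)
    moreover have "norm (of_real 2 * \<Lambda>) \<le> norm (of_real 2 * \<Lambda> - q) + norm q"
      using norm_triangle_ineq[of "of_real 2 * \<Lambda> - q" q] by simp
    ultimately show "q \<in> - cball 0 1" using norm_\<Lambda> by (simp add: norm_mult)
  qed
  \<comment> \<open>The number c collects the factor 4 from \<open>disk_dist\<close> and one power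
    of D; doubling D absorbs the factor \<open>M + 2\<close> contained in
    \<open>fact (M + 2)\<close>; the additional summands of \<open>c0\<close> pay for N = 0.\<close>
  define c where "c = 4 * K * D"
  define c1 where "c1 = 2 * D"
  define c0 where "c0 = c + K + 4 * c * c1"
  have pos: "0 < c" "0 < c1" "0 < c0" using KD by (auto simp: c_def c1_def c0_def intro!: add_pos_pos)
  have main: "norm ((q - \<Lambda>) * f_delta q z - (\<Sum>n<N. expl_expansion \<Lambda> n z * (q - \<Lambda>) ^ n))
      \<le> c0 * c1 ^ N * fact N * norm (q - \<Lambda>) ^ N"
    if q: "q \<in> ?Dm \<union> ?Dp" and z: "norm z < r" for q z N
  proof -
    have q1: "norm q \<noteq> 1" using q Dm Dp by auto
    have dist: "1/4 * norm (L - \<Lambda>) ^ 2 \<le> norm (q - L)" if "L ^ n = 1" "0 < n" for L n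
      using q disk_dist[of "1/2" L q] disk_dist[of 2 L q] norm_root_unity[OF that]
      by (auto simp: dist_norm norm_minus_commute)
    have S: "norm ((q - \<Lambda>) * f_delta q z - (\<Sum>n<Suc M. expl_expansion \<Lambda> n z * (q - \<Lambda>) ^ n))
      \<le> c * c1 ^ Suc M * fact (Suc M) * norm (q - \<Lambda>) ^ Suc M" for M
    proof -
      have "norm ((q - \<Lambda>) * f_delta q z - (\<Sum>n<Suc M. expl_expansion \<Lambda> n z * (q - \<Lambda>) ^ n))
        \<le> norm (q - \<Lambda>) ^ Suc M / (1/4) * (\<Sum>n. (real n * real m0) ^ (M + 2) * r ^ n)"
        by (rule remainder_bound[OF q1]) (use z r dist in auto)
      also have "\<dots> \<le> norm (q - \<Lambda>) ^ Suc M / (1/4) * (K * D ^ (M + 2) * fact (M + 2))"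
        by (intro mult_left_mono KD) auto
      also have "\<dots> = c * (D ^ Suc M * fact (Suc M) * norm (q - \<Lambda>) ^ Suc M) * real (M + 2)"
        by (simp add: c_def mult_ac)
      also have "\<dots> \<le> c * (D ^ Suc M * fact (Suc M) * norm (q - \<Lambda>) ^ Suc M) * 2 ^ Suc M"
      proof (rule mult_left_mono)
        have "M + 2 \<le> 2 ^ Suc M" by (induction M) auto
        then have "real (M + 2) \<le> real (2 ^ Suc M)" by (rule of_nat_mono)
        then show "real (M + 2) \<le> 2 ^ Suc M" by simp
      qed (use pos KD in auto)
      also have "\<dots> = c * c1 ^ Suc M * fact (Suc M) * norm (q - \<Lambda>) ^ Suc M"
        by (simp add: c1_def power_mult_distrib mult_ac)
      finally show ?thesis .
    qed
    show ?thesis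
    proof (cases N)
      \<comment> \<open>The remainder formula starts with one subtracted term, so N = 0 is reduced
        to N = 1 by the boundedness of the zeroth coefficient.\<close>
      case 0
      have "norm (q - \<Lambda>) \<le> 4"
        using q norm_triangle_ineq[of "q - of_real 2 * \<Lambda>" \<Lambda>] norm_triangle_ineq4[of "q - of_real (1/2) * \<Lambda>" "of_real (1/2) * \<Lambda>"] norm_\<Lambda>
        by (auto simp: dist_norm norm_minus_commute norm_divide algebra_simps)
      then have "c * c1 * norm (q - \<Lambda>) \<le> c * c1 * 4" using pos by (intro mult_left_mono) auto
      moreover have "norm ((q - \<Lambda>) * f_delta q z - expl_expansion \<Lambda> 0 z) \<le> c * c1 * norm (q - \<Lambda>)"
        using S[of 0] by simp
      moreover have "norm (expl_expansion \<Lambda> 0 z) \<le> K"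
        using expl_series_bound(2)[of z r 0] KD(3)[of 0] z r by simp
      moreover have "norm ((q - \<Lambda>) * f_delta q z) \<le> norm ((q - \<Lambda>) * f_delta q z - expl_expansion \<Lambda> 0 z) + norm (expl_expansion \<Lambda> 0 z)"
        using norm_triangle_ineq[of "(q - \<Lambda>) * f_delta q z - expl_expansion \<Lambda> 0 z" "expl_expansion \<Lambda> 0 z"] by simp
      ultimately have "norm ((q - \<Lambda>) * f_delta q z) \<le> c * c1 * 4 + K" by linarith
      then show ?thesis using 0 pos by (simp add: c0_def mult_ac)
    next
      case (Suc M)
      have "c \<le> c0" using pos KD by (simp add: c0_def)
      then have "c * (c1 ^ N * fact N * norm (q - \<Lambda>) ^ N) \<le> c0 * (c1 ^ N * fact N * norm (q - \<Lambda>) ^ N)"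
        using pos by (intro mult_right_mono) auto
      then show ?thesis using S[of M] unfolding Suc by (simp add: mult.assoc)
    qed
  qed
  show "\<exists>\<Delta>m \<Delta>p c0 c1. tangent_disk \<Lambda> \<Delta>m \<and> \<Delta>m \<subseteq> ball 0 1 \<and> tangent_disk \<Lambda> \<Delta>p \<and> \<Delta>p \<subseteq> - cball 0 1 \<and>
      0 < c0 \<and> 0 < c1 \<and> (\<forall>N. \<forall>q\<in>\<Delta>m \<union> \<Delta>p. B_norm r (\<lambda>z. (q - \<Lambda>) * f_delta q z - (\<Sum>n<N. expl_expansion \<Lambda> n z * (q - \<Lambda>) ^ n))
         \<le> c0 * c1 ^ N * fact N * norm (q - \<Lambda>) ^ N)"
  proof (rule exI[of _ ?Dm], rule exI[of _ ?Dp], rule exI[of _ c0], rule exI[of _ c1], intro conjI allI ballI)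
    fix N q assume q: "q \<in> ?Dm \<union> ?Dp"
    show "B_norm r (\<lambda>z. (q - \<Lambda>) * f_delta q z - (\<Sum>n<N. expl_expansion \<Lambda> n z * (q - \<Lambda>) ^ n))
         \<le> c0 * c1 ^ N * fact N * norm (q - \<Lambda>) ^ N"
      unfolding B_norm_def
    proof (rule cSUP_least)
      show "ball (0::complex) r \<noteq> {}" using r by simp
    qed (use main[OF q] in auto)
  qed (use Dm Dp pos tangent_disk_scaled[of "1/2"] tangent_disk_scaled[of 2] in auto)
qed

section \<open>Uniqueness of the expansion and the resulting Borel transform\<close>

text \<open>A rival expansion comes with a tangent disk of its own, so the explicit one is estimated
  again on the segment from \<Lambda> to the centre of that disk. Comparing both expansions there
  and letting q tend to \<Lambda> determines the coefficients one after the other.\<close>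

lemma gevrey1_expansion_unique:
  assumes a: "gevrey1_expansion \<Lambda> (\<lambda>q z. (q - \<Lambda>) * f_delta q z) a" and z: "norm z < 1"
  shows "a n z = expl_expansion \<Lambda> n z"
proof -
  obtain r where r: "norm z < r" "r < 1" using z dense by blast
  then have r0: "0 < r" using norm_ge_zero[of z] by linarith
  have aB: "a n \<in> B_space r" for n using a r r0 unfolding gevrey1_expansion_def by blast
  obtain \<Delta> c0 c1 where \<Delta>: "tangent_disk \<Lambda> \<Delta>" "\<Delta> \<subseteq> ball 0 1" "0 < c0" "0 < c1"
    and est: "\<And>N q. q \<in> \<Delta> \<Longrightarrow> B_norm r (\<lambda>z. (q - \<Lambda>) * f_delta q z - (\<Sum>n<N. a n z * (q - \<Lambda>) ^ n))
         \<le> c0 * c1 ^ N * fact N * norm (q - \<Lambda>) ^ N"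
    using a r r0 unfolding gevrey1_expansion_def by blast
  obtain c \<rho> where c: "0 < \<rho>" "\<Delta> = ball c \<rho>" "sphere c \<rho> \<inter> sphere 0 1 = {\<Lambda>}"
    using \<Delta>(1) unfolding tangent_disk_def by blast
  have c\<Lambda>: "norm (c - \<Lambda>) = \<rho>" using c(3) by (auto simp: dist_norm)
  have c1': "norm c < 1" using \<Delta>(2) c(1,2) by (metis centre_in_ball mem_ball_0 subsetD)
  have pt: "norm ((q - \<Lambda>) * f_delta q z - (\<Sum>n<N. a n z * (q - \<Lambda>) ^ n)) \<le> c0 * c1 ^ N * fact N * norm (q - \<Lambda>) ^ N"
    if q: "q \<in> \<Delta>" for q N
  proof -
    let ?g = "\<lambda>z. (q - \<Lambda>) * f_delta q z - (\<Sum>n<N. a n z * (q - \<Lambda>) ^ n)"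
    have q1: "norm q \<noteq> 1" using q \<Delta>(2) by auto
    have "\<forall>n. \<exists>M. \<forall>w\<in>ball 0 r. norm (a n w) \<le> M"
      using aB unfolding B_space_def bounded_iff by auto
    then obtain M where M: "\<And>n w. w \<in> ball 0 r \<Longrightarrow> norm (a n w) \<le> M n" by metis
    have "bdd_above ((\<lambda>z. norm (?g z)) ` ball 0 r)"
    proof (rule bdd_aboveI2)
      fix w :: complex assume w: "w \<in> ball 0 r"
      have "norm (?g w) \<le> norm ((q - \<Lambda>) * f_delta q w) + norm (\<Sum>n<N. a n w * (q - \<Lambda>) ^ n)"
        by (rule norm_triangle_ineq4)
      also have "\<dots> \<le> norm (q - \<Lambda>) * (\<Sum>n. r ^ n / \<bar>norm q - 1\<bar>) + (\<Sum>n<N. M n * norm (q - \<Lambda>) ^ n)"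
        unfolding norm_mult
        by (intro add_mono mult_left_mono f_delta_bound(2)[OF q1] sum_norm_le)
           (use w r M in \<open>auto simp: norm_mult norm_power intro!: mult_right_mono\<close>)
      finally show "norm (?g w) \<le> norm (q - \<Lambda>) * (\<Sum>n. r ^ n / \<bar>norm q - 1\<bar>) + (\<Sum>n<N. M n * norm (q - \<Lambda>) ^ n)" .
    qed
    then have "norm (?g z) \<le> B_norm r ?g"
      unfolding B_norm_def by (intro cSUP_upper) (use r in auto)
    then show ?thesis using est[OF q, of N] by linarith
  qed
  \<comment> \<open>On the segment \<open>1 - norm q\<close> is at least
    \<open>\<kappa> * norm (q - \<Lambda>)\<close>, which bounds the distance to all roots of unity
    at once.\<close>
  define \<kappa> where "\<kappa> = (1 - norm c) / \<rho>"
  have \<kappa>: "0 < \<kappa>" using c1' c(1) by (simp add: \<kappa>_def)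
  show "a n z = expl_expansion \<Lambda> n z"
  proof (induction n rule: less_induct)
    case (less m)
    define b where "b n = a n z - expl_expansion \<Lambda> n z" for n
    define A where "A = c0 * c1 ^ Suc (Suc m) * fact (Suc (Suc m)) * \<rho>"
    define A' where "A' = 1 / \<kappa> * (\<Sum>n. (real n * real m0) ^ (Suc m + 0) * r ^ n)"
    have bound: "norm (b m) \<le> t * (\<rho> * (A + A' + norm (b (Suc m))))" if t: "0 < t" "t \<le> 1" for t
    proof -
      define q where "q = \<Lambda> + of_real t * (c - \<Lambda>)"
      have Q: "q - \<Lambda> = of_real t * (c - \<Lambda>)" by (simp add: q_def)
      have nQ: "norm (q - \<Lambda>) = t * \<rho>" using t c\<Lambda> by (simp add: Q norm_mult)
      have nQ0: "0 < norm (q - \<Lambda>)" using nQ t c by simp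
      have "c - q = of_real (1 - t) * (c - \<Lambda>)" by (simp add: q_def algebra_simps)
      then have "norm (c - q) = (1 - t) * \<rho>" using t c\<Lambda> by (simp add: norm_mult del: of_real_diff)
      also have "\<dots> < \<rho>" using t c(1) by simp
      finally have q\<Delta>: "q \<in> \<Delta>" by (simp add: c(2) dist_norm)
      then have q1: "norm q \<noteq> 1" using \<Delta>(2) by auto
      have "q = of_real (1 - t) * \<Lambda> + of_real t * c" by (simp add: q_def algebra_simps)
      then have "norm q \<le> norm (of_real (1 - t) * \<Lambda>) + norm (of_real t * c)" by (metis norm_triangle_ineq)
      also have "\<dots> = (1 - t) + t * norm c" using t norm_\<Lambda> by (simp add: norm_mult del: of_real_diff)
      finally have nq: "norm q \<le> (1 - t) + t * norm c" .
      have dist: "\<kappa> * norm (q - \<Lambda>) * norm (L - \<Lambda>) ^ 0 \<le> norm (q - L)" if "L ^ n = 1" "0 < n" for L n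
      proof -
        have "norm L = 1" using norm_root_unity that by blast
        then have "1 - norm q \<le> norm (q - L)" using norm_triangle_ineq2[of L q] by (simp add: norm_minus_commute)
        moreover have "\<kappa> * norm (q - \<Lambda>) = t * (1 - norm c)" using c(1) by (simp add: nQ \<kappa>_def)
        ultimately show ?thesis using nq by (simp add: algebra_simps)
      qed
      \<comment> \<open>The comparison runs to order m + 1, because the estimate with \<mu>
        proportional to \<open>norm (q - \<Lambda>)\<close> loses one power.\<close>
      let ?S = "\<lambda>a. (\<Sum>n<Suc (Suc m). a n z * (q - \<Lambda>) ^ n)"
      have e1: "norm ((q - \<Lambda>) * f_delta q z - ?S a) \<le> A * (t * norm (q - \<Lambda>) ^ Suc m)"
        using pt[OF q\<Delta>, of "Suc (Suc m)"] by (simp add: A_def nQ mult_ac)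
      have "norm ((q - \<Lambda>) * f_delta q z - ?S (expl_expansion \<Lambda>)) \<le>
          norm (q - \<Lambda>) ^ Suc (Suc m) / (\<kappa> * norm (q - \<Lambda>)) * (\<Sum>n. (real n * real m0) ^ (Suc m + 0) * r ^ n)"
        by (rule remainder_bound[OF q1]) (use r \<kappa> nQ0 dist in auto)
      also have "\<dots> = A' * norm (q - \<Lambda>) ^ Suc m" using nQ0 by (simp add: A'_def)
      finally have e2: "norm ((q - \<Lambda>) * f_delta q z - ?S (expl_expansion \<Lambda>)) \<le> A' * norm (q - \<Lambda>) ^ Suc m" .
      have "?S a - ?S (expl_expansion \<Lambda>) = (\<Sum>n<Suc (Suc m). b n * (q - \<Lambda>) ^ n)"
        by (simp add: b_def sum_subtractf[symmetric] left_diff_distrib)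
      also have "\<dots> = b m * (q - \<Lambda>) ^ m + b (Suc m) * (q - \<Lambda>) ^ Suc m"
        using less.IH by (simp add: b_def)
      finally have "norm (b m * (q - \<Lambda>) ^ m) = norm (((q - \<Lambda>) * f_delta q z - ?S (expl_expansion \<Lambda>))
          - ((q - \<Lambda>) * f_delta q z - ?S a) - b (Suc m) * (q - \<Lambda>) ^ Suc m)" by (simp add: algebra_simps)
      also have "\<dots> \<le> norm ((q - \<Lambda>) * f_delta q z - ?S (expl_expansion \<Lambda>)) + norm ((q - \<Lambda>) * f_delta q z - ?S a)
          + norm (b (Suc m) * (q - \<Lambda>) ^ Suc m)"
        using norm_triangle_ineq4 by (meson add_right_mono order.trans)
      also have "\<dots> \<le> A' * norm (q - \<Lambda>) ^ Suc m + A * (1 * norm (q - \<Lambda>) ^ Suc m) + norm (b (Suc m)) * norm (q - \<Lambda>) ^ Suc m"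
      proof -
        have "A * (t * norm (q - \<Lambda>) ^ Suc m) \<le> A * (1 * norm (q - \<Lambda>) ^ Suc m)"
          by (intro mult_left_mono mult_right_mono) (use t \<Delta> c in \<open>auto simp: A_def\<close>)
        then show ?thesis using e1 e2 by (simp add: norm_mult norm_power)
      qed
      also have "\<dots> = norm (q - \<Lambda>) ^ m * (t * (\<rho> * (A + A' + norm (b (Suc m)))))"
        by (simp add: nQ algebra_simps)
      finally have "norm (q - \<Lambda>) ^ m * norm (b m) \<le> norm (q - \<Lambda>) ^ m * (t * (\<rho> * (A + A' + norm (b (Suc m)))))"
        by (simp add: norm_mult norm_power mult.commute)
      then show ?thesis using nQ0 by (simp add: mult_le_cancel_left_pos)
    qed
    have "norm (b m) \<le> 0"
    proof (rule field_le_epsilon)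
      fix e :: real assume e: "0 < e"
      define W where "W = \<bar>\<rho> * (A + A' + norm (b (Suc m)))\<bar> + 1"
      have W: "0 < W" "\<rho> * (A + A' + norm (b (Suc m))) \<le> W" by (auto simp: W_def)
      define t where "t = min 1 (e / W)"
      have t: "0 < t" "t \<le> 1" "t \<le> e / W" using e W by (auto simp: t_def)
      have "norm (b m) \<le> t * W" using bound[OF t(1,2)] mult_left_mono[OF W(2), of t] t by linarith
      also have "\<dots> \<le> e / W * W" using t W by (intro mult_right_mono) auto
      finally show "norm (b m) \<le> 0 + e" using W by simp
    qed
    then show ?case by (simp add: b_def)
  qed
qed

lemma exp_coeff_eq:
  assumes "norm z < 1"
  shows "exp_coeff \<Lambda> n z = expl_expansion \<Lambda> n z"
  unfolding exp_coeff_def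
  by (rule gevrey1_expansion_unique[OF someI[of "gevrey1_expansion \<Lambda> (\<lambda>q z. (q - \<Lambda>) * f_delta q z)", OF gevrey1_expl_expansion] assms])

text \<open>The coefficients are bounded by \<open>(n * m0) ^ (j + 1)\<close>, so the double series
  over j and n converges absolutely as soon as \<open>norm z * exp (m0 * norm \<xi>) < 1\<close>.
  Summing over j first yields exponentials.\<close>

lemma Phi_delta_series:
  assumes z: "norm z < 1" and \<xi>: "norm z * exp (real m0 * norm \<xi>) < 1"
  shows "Phi_delta \<Lambda> z \<xi> =
    (\<Sum>n. (\<Sum>L\<in>{L. L ^ n = 1} - {\<Lambda>}. - L * (\<Lambda> / (L - \<Lambda>)) * exp (\<Lambda> / (L - \<Lambda>) * \<xi>)) / of_nat n * z ^ n)"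
proof -
  let ?R = "\<lambda>n. {L. L ^ n = 1} - {\<Lambda>}"
  define b where "b j n = \<Lambda> ^ (j + 1) * expl_coeff \<Lambda> (j + 1) n * z ^ n * \<xi> ^ j / fact j" for j n
  define B where "B j n = (real n * real m0) ^ (j + 1) * norm z ^ n * norm \<xi> ^ j / fact j" for j n
  define S where "S n = real n * real m0 * (norm z * exp (real m0 * norm \<xi>)) ^ n" for n
  have bB: "norm (b j n) \<le> B j n" for j n
    unfolding b_def B_def norm_mult norm_divide norm_power norm_\<Lambda>
    using norm_expl_coeff[of "j + 1" n] by (auto intro!: divide_right_mono mult_right_mono)
  have BS: "(\<lambda>j. B j n) sums S n" for n
  proof -
    have "(\<lambda>j. real n * real m0 * norm z ^ n * ((real n * (real m0 * norm \<xi>)) ^ j / fact j)) sums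
        (real n * real m0 * norm z ^ n * exp (real n * (real m0 * norm \<xi>)))"
      using exp_converges[of "real n * (real m0 * norm \<xi>)"]
      by (intro sums_mult) (simp add: scaleR_conv_of_real divide_inverse mult.commute)
    moreover have "real n * real m0 * norm z ^ n * ((real n * (real m0 * norm \<xi>)) ^ j / fact j) = B j n" for j
      by (simp add: B_def power_mult_distrib mult_ac)
    moreover have "real n * real m0 * norm z ^ n * exp (real n * (real m0 * norm \<xi>)) = S n"
      unfolding exp_of_nat_mult S_def by (simp add: power_mult_distrib mult_ac)
    ultimately show ?thesis by simp
  qed
  have "summable S"
    using summable_power_mult_geometric(1)[of "norm z * exp (real m0 * norm \<xi>)" "real m0" 1] \<xi>
    unfolding S_def by simp
  from suminf_swap_dominated[OF bB BS this]
  have swap: "(\<Sum>j. \<Sum>n. b j n) = (\<Sum>n. \<Sum>j. b j n)" .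
  have "Phi_delta \<Lambda> z \<xi> = (\<Sum>j. \<Sum>n. b j n)"
    unfolding Phi_delta_def
  proof (rule suminf_cong)
    fix j
    have "(\<Sum>n. b j n) = (\<Sum>n. \<Lambda> ^ (j + 1) * \<xi> ^ j / fact j * (expl_coeff \<Lambda> (j + 1) n * z ^ n))"
      by (simp add: b_def mult_ac)
    also have "\<dots> = \<Lambda> ^ (j + 1) * \<xi> ^ j / fact j * expl_expansion \<Lambda> (j + 1) z"
      unfolding expl_expansion_def by (rule suminf_mult[OF expl_series_bound(1)[OF order.refl z]])
    finally show "\<Lambda> ^ (j + 1) * exp_coeff \<Lambda> (j + 1) z * \<xi> ^ j / fact j = (\<Sum>n. b j n)"
      unfolding exp_coeff_eq[OF z] by (simp add: mult_ac)
  qed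
  also have "\<dots> = (\<Sum>n. \<Sum>j. b j n)" by (rule swap)
  also have "\<dots> = (\<Sum>n. (\<Sum>L\<in>?R n. - L * (\<Lambda> / (L - \<Lambda>)) * exp (\<Lambda> / (L - \<Lambda>) * \<xi>)) / of_nat n * z ^ n)"
  proof (rule suminf_cong)
    fix n
    have "(\<lambda>j. (\<Sum>L\<in>?R n. - L * (\<Lambda> / (L - \<Lambda>)) * ((\<Lambda> / (L - \<Lambda>) * \<xi>) ^ j / fact j)) / of_nat n * z ^ n) sums
       ((\<Sum>L\<in>?R n. - L * (\<Lambda> / (L - \<Lambda>)) * exp (\<Lambda> / (L - \<Lambda>) * \<xi>)) / of_nat n * z ^ n)"
    proof (intro sums_mult2 sums_divide sums_sum sums_mult)
      fix L
      show "(\<lambda>j. (\<Lambda> / (L - \<Lambda>) * \<xi>) ^ j / fact j) sums exp (\<Lambda> / (L - \<Lambda>) * \<xi>)"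
        using exp_converges[of "\<Lambda> / (L - \<Lambda>) * \<xi>"] by (simp add: scaleR_conv_of_real divide_inverse mult.commute)
    qed
    moreover have "(\<Sum>L\<in>?R n. - L * (\<Lambda> / (L - \<Lambda>)) * ((\<Lambda> / (L - \<Lambda>) * \<xi>) ^ j / fact j)) / of_nat n * z ^ n = b j n" for j
    proof -
      have "(\<Sum>L\<in>?R n. - L * (\<Lambda> / (L - \<Lambda>)) * ((\<Lambda> / (L - \<Lambda>) * \<xi>) ^ j / fact j))
         = (\<Sum>L\<in>?R n. (\<Lambda> ^ (j + 1) * \<xi> ^ j / fact j) * - (L / (L - \<Lambda>) ^ (j + 1)))"
        by (intro sum.cong refl) (simp add: power_divide power_mult_distrib mult_ac)
      also have "\<dots> = (\<Lambda> ^ (j + 1) * \<xi> ^ j / fact j) * - (\<Sum>L\<in>?R n. L / (L - \<Lambda>) ^ (j + 1))"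
        by (simp only: sum_distrib_left[symmetric] sum_negf)
      finally show ?thesis by (simp add: b_def expl_coeff_def mult_ac)
    qed
    ultimately show "(\<Sum>j. b j n) = (\<Sum>L\<in>?R n. - L * (\<Lambda> / (L - \<Lambda>)) * exp (\<Lambda> / (L - \<Lambda>) * \<xi>)) / of_nat n * z ^ n"
      by (simp add: sums_iff)
  qed
  finally show ?thesis .
qed

end

section \<open>The kernel and its Taylor coefficients\<close>

definition exp_quot :: "complex \<Rightarrow> complex" where
  "exp_quot \<theta> = (if \<theta> = 0 then \<i> else (exp (\<i> * \<theta>) - 1) / \<theta>)"

text \<open>Up to the factor \<open>- \<i>\<close>, the generating function of the Bernoulli numbers
  at \<open>\<i> * \<theta>\<close>.\<close>

definition inv_exp_quot :: "complex \<Rightarrow> complex" where "inv_exp_quot \<theta> = 1 / exp_quot \<theta>"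

text \<open>For small nonzero \<theta> this is
  \<open>- 1 / 2 - \<i> / 2 * cot (\<theta> / 2) + \<i> / \<theta>\<close>: the regular part of
  \<open>1 / (exp (\<i> * \<theta>) - 1)\<close> at 0.\<close>

definition cot_rem :: "complex \<Rightarrow> complex" where
  "cot_rem \<theta> = (if \<theta> = 0 then deriv inv_exp_quot 0 else (inv_exp_quot \<theta> - inv_exp_quot 0) / \<theta>)"

lemma exp_quot_holomorphic: "exp_quot holomorphic_on UNIV"
proof -
  have "deriv (\<lambda>\<theta>. exp (\<i> * \<theta>)) 0 = \<i>"
    by (intro DERIV_imp_deriv) (auto intro!: derivative_eq_intros)
  then have "exp_quot = (\<lambda>\<theta>. if \<theta> = 0 then deriv (\<lambda>\<theta>. exp (\<i> * \<theta>)) 0 else (exp (\<i> * \<theta>) - exp (\<i> * 0)) / (\<theta> - 0))"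
    by (auto simp: exp_quot_def)
  moreover have "(\<lambda>\<theta>. if \<theta> = 0 then deriv (\<lambda>\<theta>. exp (\<i> * \<theta>)) 0 else (exp (\<i> * \<theta>) - exp (\<i> * 0)) / (\<theta> - 0)) holomorphic_on UNIV"
    by (rule pole_lemma) (auto intro!: holomorphic_intros)
  ultimately show ?thesis by simp
qed

lemma exp_quot_nonzero:
  assumes "norm \<theta> < 2 * pi"
  shows "exp_quot \<theta> \<noteq> 0"
proof (cases "\<theta> = 0")
  case False
  have "exp (\<i> * \<theta>) \<noteq> 1"
  proof
    assume "exp (\<i> * \<theta>) = 1"
    then obtain n :: int where n: "Re (\<i> * \<theta>) = 0" "Im (\<i> * \<theta>) = of_int (2 * n) * pi" unfolding exp_eq_1 by blast
    then have \<theta>: "\<theta> = of_real (of_int (2 * n) * pi)" by (auto simp: complex_eq_iff)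
    then have "norm \<theta> = 2 * \<bar>of_int n\<bar> * pi" by (simp add: norm_mult)
    then have "\<bar>real_of_int n\<bar> * pi < 1 * pi" using assms by simp
    then have "\<bar>real_of_int n\<bar> < 1" by (simp only: mult_less_cancel_right_pos[OF pi_gt_zero])
    then have "n = 0" by linarith
    then show False using \<theta> False by simp
  qed
  then show ?thesis using False by (simp add: exp_quot_def)
qed (simp add: exp_quot_def)

lemma inv_exp_quot_holomorphic: "inv_exp_quot holomorphic_on ball 0 (2 * pi)"
  unfolding inv_exp_quot_def
  by (intro holomorphic_intros holomorphic_on_subset[OF exp_quot_holomorphic]) (auto simp: exp_quot_nonzero)

lemma inv_exp_quot_0: "inv_exp_quot 0 = - \<i>" by (simp add: inv_exp_quot_def exp_quot_def divide_simps)

lemma inv_exp_quot_eq: "\<theta> \<noteq> 0 \<Longrightarrow> inv_exp_quot \<theta> = \<theta> / (exp (\<i> * \<theta>) - 1)"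
  by (simp add: inv_exp_quot_def exp_quot_def)

lemma cot_rem_holomorphic: "cot_rem holomorphic_on ball 0 (2 * pi)"
proof -
  have "(\<lambda>\<theta>. if \<theta> = 0 then deriv inv_exp_quot 0 else (inv_exp_quot \<theta> - inv_exp_quot 0) / (\<theta> - 0)) holomorphic_on ball 0 (2 * pi)"
    by (rule pole_lemma[OF inv_exp_quot_holomorphic]) simp
  then show ?thesis unfolding cot_rem_def[abs_def] diff_0_right .
qed

lemma inverse_exp_minus_1:
  assumes "\<theta> \<noteq> 0"
  shows "1 / (exp (\<i> * \<theta>) - 1) = - \<i> / \<theta> + cot_rem \<theta>"
  using assms by (simp add: cot_rem_def inv_exp_quot_0 inv_exp_quot_eq add_divide_distrib)

text \<open>The value at \<open>0\<close> comes from \<open>1 / (exp x - 1) + 1 / (exp (- x) - 1) = -1\<close>.\<close>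

lemma cot_rem_0: "cot_rem 0 = - 1 / 2"
proof -
  have "isCont cot_rem 0"
    using cot_rem_holomorphic
    by (meson centre_in_ball continuous_on_eq_continuous_at holomorphic_on_imp_continuous_on open_ball pi_gt_zero mult_pos_pos zero_less_numeral)
  then have l: "(cot_rem \<longlongrightarrow> cot_rem 0) (at 0)" by (simp add: isCont_def)
  have "((\<lambda>\<theta>. cot_rem (- \<theta>)) \<longlongrightarrow> cot_rem 0) (at 0)"
    by (rule isCont_tendsto_compose[OF \<open>isCont cot_rem 0\<close>]) (auto intro!: tendsto_eq_intros)
  from tendsto_add[OF l this] have "((\<lambda>\<theta>. cot_rem \<theta> + cot_rem (- \<theta>)) \<longlongrightarrow> cot_rem 0 + cot_rem 0) (at 0)" .
  moreover have "\<forall>\<^sub>F \<theta> in at 0. cot_rem \<theta> + cot_rem (- \<theta>) = - 1"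
    unfolding eventually_at
  proof (intro exI[of _ "2 * pi"] conjI ballI impI)
    fix \<theta> :: complex assume \<theta>: "\<theta> \<noteq> 0 \<and> dist \<theta> 0 < 2 * pi"
    have "exp (\<i> * \<theta>) - 1 \<noteq> 0" using exp_quot_nonzero[of \<theta>] \<theta> by (auto simp: exp_quot_def)
    have *: "1 / (x - 1) + 1 / (inverse x - 1) = - 1" if "x - 1 \<noteq> 0" "x \<noteq> 0" for x :: complex
    proof -
      have "inverse x - 1 = - (x - 1) / x" using that by (simp add: field_simps)
      then have "1 / (inverse x - 1) = - (x / (x - 1))" by (metis divide_divide_eq_right divide_minus_left minus_divide_right mult_1)
      then have "1 / (x - 1) + 1 / (inverse x - 1) = 1 / (x - 1) - x / (x - 1)" by simp
      also have "\<dots> = (1 - x) / (x - 1)" by (simp add: diff_divide_distrib)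
      also have "\<dots> = - 1" using that by (simp add: divide_eq_eq)
      finally show ?thesis .
    qed
    have "1 / (exp (\<i> * \<theta>) - 1) + 1 / (exp (\<i> * (- \<theta>)) - 1) = - 1"
      using *[of "exp (\<i> * \<theta>)"] \<open>exp (\<i> * \<theta>) - 1 \<noteq> 0\<close> by (simp add: exp_minus)
    then show "cot_rem \<theta> + cot_rem (- \<theta>) = - 1"
      using inverse_exp_minus_1[of \<theta>] inverse_exp_minus_1[of "- \<theta>"] \<theta> by simp
  qed simp
  ultimately have "((\<lambda>\<theta>::complex. - 1) \<longlongrightarrow> cot_rem 0 + cot_rem 0) (at 0)"
    by (rule Lim_transform_eventually)
  then have "cot_rem 0 + cot_rem 0 = - 1" by (simp add: tendsto_const_iff)
  then show ?thesis by (simp add: field_simps)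
qed

text \<open>The function G of the overview: \<open>\<theta> * v * exp (\<i> * \<theta>) * exp ((v +
  \<i> / \<theta>) * \<xi>)\<close> with \<open>v = 1 / (exp (\<i> * \<theta>) - 1)\<close>.\<close>

definition gker :: "complex \<Rightarrow> complex \<Rightarrow> complex" where
  "gker \<xi> \<theta> = inv_exp_quot \<theta> * exp (\<i> * \<theta>) * exp (cot_rem \<theta> * \<xi>)"

text \<open>Taylor coefficients in \<theta>, written as Cauchy integrals so that holomorphy in \<xi>
  and the bounds can be read off. In the parametrisation of the circle, d\<theta> divided by
  \<open>2 * pi * \<i> * \<theta>\<close> is dt; hence the exponent m instead of m + 1.\<close>

definition gker_coeff :: "nat \<Rightarrow> complex \<Rightarrow> complex" where
  "gker_coeff m \<xi> = integral {0..1} (\<lambda>t. gker \<xi> (circlepath 0 4 t) / circlepath 0 4 t ^ m)"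

lemma circle4: "norm (circlepath 0 4 t) = 4"
  by (simp add: circlepath norm_mult)

lemma ball4: "norm \<theta> \<le> 4 \<Longrightarrow> \<theta> \<in> ball 0 (2 * pi)"
  using pi_gt3 by simp

lemma gker_holomorphic: "gker \<xi> holomorphic_on ball 0 (2 * pi)"
  unfolding gker_def by (intro holomorphic_intros inv_exp_quot_holomorphic cot_rem_holomorphic)

lemma continuous_circle_comp:
  assumes "h holomorphic_on ball 0 (2 * pi)"
  shows "continuous_on A (\<lambda>t. h (circlepath 0 4 t))"
proof (rule continuous_on_compose2[OF holomorphic_on_imp_continuous_on[OF assms]])
  show "continuous_on A (circlepath 0 4)" unfolding circlepath by (intro continuous_intros)
  show "circlepath 0 4 ` A \<subseteq> ball 0 (2 * pi)" using ball4[OF eq_refl[OF circle4]] by auto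
qed

lemma gker_coeff_eq: "gker_coeff m \<xi> = (deriv ^^ m) (gker \<xi>) 0 / fact m"
proof -
  have "((\<lambda>u. gker \<xi> u / (u - 0) ^ Suc m) has_contour_integral ((2 * pi * \<i>) / (fact m) * (deriv ^^ m) (gker \<xi>) 0)) (circlepath 0 4)"
  proof (rule Cauchy_has_contour_integral_higher_derivative_circlepath)
    show "continuous_on (cball 0 4) (gker \<xi>)"
      by (intro holomorphic_on_imp_continuous_on holomorphic_on_subset[OF gker_holomorphic] subsetI ball4) simp
    show "gker \<xi> holomorphic_on ball 0 4"
      by (intro holomorphic_on_subset[OF gker_holomorphic] subsetI ball4) simp
  qed simp
  then have "((\<lambda>t. gker \<xi> (circlepath 0 4 t) / circlepath 0 4 t ^ Suc m * vector_derivative (circlepath 0 4) (at t within {0..1}))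
     has_integral ((2 * pi * \<i>) / (fact m) * (deriv ^^ m) (gker \<xi>) 0)) {0..1}"
    by (simp add: has_contour_integral_def)
  then have "((\<lambda>t. (2 * pi * \<i>) * (gker \<xi> (circlepath 0 4 t) / circlepath 0 4 t ^ m))
     has_integral ((2 * pi * \<i>) / (fact m) * (deriv ^^ m) (gker \<xi>) 0)) {0..1}"
  proof (rule has_integral_eq[rotated])
    fix t :: real assume "t \<in> {0..1}"
    then have "vector_derivative (circlepath 0 4) (at t within {0..1}) = 2 * pi * \<i> * circlepath 0 4 t"
      using vector_derivative_circlepath01[of t 0 4] by (simp add: circlepath mult_ac)
    moreover have "circlepath 0 4 t \<noteq> 0" using circle4[of t] by auto
    ultimately show "gker \<xi> (circlepath 0 4 t) / circlepath 0 4 t ^ Suc m * vector_derivative (circlepath 0 4) (at t within {0..1})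
      = (2 * pi * \<i>) * (gker \<xi> (circlepath 0 4 t) / circlepath 0 4 t ^ m)" by (simp add: field_simps)
  qed
  then have "integral {0..1} (\<lambda>t. (2 * pi * \<i>) * (gker \<xi> (circlepath 0 4 t) / circlepath 0 4 t ^ m)) =
     (2 * pi * \<i>) / (fact m) * (deriv ^^ m) (gker \<xi>) 0" by (rule integral_unique)
  then have "(2 * pi * \<i>) * gker_coeff m \<xi> = (2 * pi * \<i>) * ((deriv ^^ m) (gker \<xi>) 0 / fact m)"
    unfolding gker_coeff_def integral_mult_right by simp
  moreover have "complex_of_real (2 * pi) * \<i> \<noteq> 0" by simp
  ultimately show ?thesis using mult_left_cancel by blast
qed

lemma gker_sums:
  assumes "norm \<theta> < 4"
  shows "(\<lambda>m. gker_coeff m \<xi> * \<theta> ^ m) sums gker \<xi> \<theta>"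
  using holomorphic_power_series[OF gker_holomorphic, of \<theta> \<xi>] ball4[of \<theta>] assms by (simp add: gker_coeff_eq)

text \<open>This value is the origin of the factor \<open>exp (- \<omega> / 2)\<close> at the
  poles.\<close>

lemma gker_coeff_0: "gker_coeff 0 \<xi> = - \<i> * exp (- \<xi> / 2)"
  by (simp add: gker_coeff_eq gker_def inv_exp_quot_0 cot_rem_0)

lemma gker_coeff_holomorphic: "gker_coeff m holomorphic_on UNIV"
proof -
  let ?c = "circlepath 0 4"
  have cont: "continuous_on UNIV ?c" unfolding circlepath by (intro continuous_intros)
  have c0: "?c t \<noteq> 0" for t using circle4[of t] by auto
  have ch: "continuous_on (UNIV \<times> cbox 0 1) (\<lambda>p::complex \<times> real. h (?c (snd p)))"
    if "h holomorphic_on ball 0 (2 * pi)" for h :: "complex \<Rightarrow> complex"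
    by (rule continuous_on_compose2[OF continuous_circle_comp[OF that, of UNIV] continuous_on_snd[OF continuous_on_id]]) auto
  have "(\<lambda>\<xi>. integral (cbox 0 1) (\<lambda>t. gker \<xi> (?c t) / ?c t ^ m)) holomorphic_on UNIV"
  proof (rule leibniz_rule_holomorphic[where fx = "\<lambda>\<xi> t. gker \<xi> (?c t) / ?c t ^ m * cot_rem (?c t)"])
    fix \<xi> t
    show "((\<lambda>\<xi>. gker \<xi> (?c t) / ?c t ^ m) has_field_derivative gker \<xi> (?c t) / ?c t ^ m * cot_rem (?c t)) (at \<xi> within UNIV)"
      unfolding gker_def using c0 by (auto intro!: derivative_eq_intros)
    show "(\<lambda>t. gker \<xi> (?c t) / ?c t ^ m) integrable_on cbox 0 1"
      by (intro integrable_continuous continuous_intros continuous_circle_comp[OF gker_holomorphic]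
          continuous_on_subset[OF cont]) (use c0 in auto)
  next
    have "continuous_on (UNIV \<times> cbox 0 1) (\<lambda>p. inv_exp_quot (?c (snd p)) * exp (\<i> * ?c (snd p)) * exp (cot_rem (?c (snd p)) * fst p) / ?c (snd p) ^ m * cot_rem (?c (snd p)))"
      by (intro continuous_intros ch[OF inv_exp_quot_holomorphic] ch[OF cot_rem_holomorphic] ch[where h = "\<lambda>x. x"]) (use c0 in auto)
    then show "continuous_on (UNIV \<times> cbox 0 1) (\<lambda>(\<xi>, t). gker \<xi> (?c t) / ?c t ^ m * cot_rem (?c t))"
      by (simp add: case_prod_unfold gker_def)
  qed auto
  then show ?thesis by (simp add: gker_coeff_def[abs_def] cbox_interval)
qed

text \<open>Cauchy's estimate; the exponential type b is a bound of \<open>cot_rem\<close> on the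
  closed disk of radius 4.\<close>

lemma gker_coeff_bound:
  "\<exists>A b. 0 < A \<and> 0 < b \<and> (\<forall>m \<xi>. norm (gker_coeff m \<xi>) \<le> A * exp (b * norm \<xi>) / 4 ^ m)"
proof -
  have bd: "\<exists>B>0. \<forall>\<theta>. norm \<theta> \<le> 4 \<longrightarrow> norm (h \<theta>) \<le> B" if "h holomorphic_on ball 0 (2 * pi)" for h :: "complex \<Rightarrow> complex"
  proof -
    have "continuous_on (cball 0 4) h"
      by (intro holomorphic_on_imp_continuous_on holomorphic_on_subset[OF that] subsetI ball4) simp
    then have "bounded (h ` cball 0 4)" by (intro compact_imp_bounded compact_continuous_image compact_cball)
    then obtain B where "B > 0" "\<forall>x\<in>h ` cball 0 4. norm x \<le> B" unfolding bounded_pos by blast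
    then show ?thesis by auto
  qed
  have "(\<lambda>\<theta>. inv_exp_quot \<theta> * exp (\<i> * \<theta>)) holomorphic_on ball 0 (2 * pi)" by (intro holomorphic_intros inv_exp_quot_holomorphic)
  from bd[OF this] obtain A where A: "A > 0" "\<And>\<theta>. norm \<theta> \<le> 4 \<Longrightarrow> norm (inv_exp_quot \<theta> * exp (\<i> * \<theta>)) \<le> A" by blast
  from bd[OF cot_rem_holomorphic] obtain b where b: "b > 0" "\<And>\<theta>. norm \<theta> \<le> 4 \<Longrightarrow> norm (cot_rem \<theta>) \<le> b" by blast
  have G: "norm (gker \<xi> \<theta>) \<le> A * exp (b * norm \<xi>)" if "norm \<theta> \<le> 4" for \<xi> \<theta>
  proof -
    have "norm (exp (cot_rem \<theta> * \<xi>)) \<le> exp (norm (cot_rem \<theta> * \<xi>))" by (rule norm_exp)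
    also have "\<dots> \<le> exp (b * norm \<xi>)" using b(2)[OF that] by (simp add: norm_mult mult_right_mono)
    finally show ?thesis unfolding gker_def norm_mult[of "_ * _"] using A(2)[OF that] A(1) by (intro mult_mono) auto
  qed
  have "norm (gker_coeff m \<xi>) \<le> A * exp (b * norm \<xi>) / 4 ^ m * (1 - 0)" for m \<xi>
    unfolding gker_coeff_def
  proof (rule integral_bound)
    show "continuous_on {0..1} (\<lambda>t. gker \<xi> (circlepath 0 4 t) / circlepath 0 4 t ^ m)"
    proof (intro continuous_intros continuous_circle_comp[OF gker_holomorphic] continuous_circle_comp[where h = "\<lambda>x. x"] ballI)
      show "circlepath 0 4 t ^ m \<noteq> 0" for t using circle4[of t] by auto
    qed auto
    fix t :: real
    show "norm (gker \<xi> (circlepath 0 4 t) / circlepath 0 4 t ^ m) \<le> A * exp (b * norm \<xi>) / 4 ^ m"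
      using G[of "circlepath 0 4 t" \<xi>] by (simp add: norm_divide norm_power circle4 divide_right_mono)
  qed simp
  then show ?thesis using A(1) b(1) by auto
qed

section \<open>The convolution operator\<close>

lemma holomorphic_suminf:
  fixes f :: "nat \<Rightarrow> complex \<Rightarrow> complex"
  assumes "open S" "\<And>n. f n holomorphic_on S"
    and "\<And>x. x \<in> S \<Longrightarrow> \<exists>d>0. cball x d \<subseteq> S \<and> (\<exists>B. summable B \<and> (\<forall>n. \<forall>y\<in>cball x d. norm (f n y) \<le> B n))"
  shows "(\<lambda>x. \<Sum>n. f n x) holomorphic_on S"
proof (rule holomorphic_uniform_sequence[OF assms(1), of "\<lambda>n x. \<Sum>i<n. f i x"])
  show "(\<lambda>x. \<Sum>i<n. f i x) holomorphic_on S" for n by (intro holomorphic_intros assms)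
  fix x assume "x \<in> S"
  from assms(3)[OF this] obtain d B where d: "d > 0" "cball x d \<subseteq> S" "summable B" "\<And>n y. y \<in> cball x d \<Longrightarrow> norm (f n y) \<le> B n"
    by blast
  have "uniform_limit (cball x d) (\<lambda>n x. \<Sum>i<n. f i x) (\<lambda>x. \<Sum>n. f n x) sequentially"
    by (rule Weierstrass_m_test) (use d in auto)
  then show "\<exists>d>0. cball x d \<subseteq> S \<and> uniform_limit (cball x d) (\<lambda>n x. \<Sum>i<n. f i x) (\<lambda>x. \<Sum>n. f n x) sequentially"
    using d by blast
qed

text \<open>Replacing \<open>\<theta> ^ Suc m\<close> in the Taylor series of the kernel by \<open>(- \<i>) ^ Suc m * a m\<close>;
  the factor \<open>- \<i>\<close> accounts for \<open>exp (- \<i> * \<eta> / \<theta>)\<close> having primitive \<open>\<i> * \<theta> * exp (- \<i> * \<eta> / \<theta>)\<close>.\<close>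

definition gser :: "(nat \<Rightarrow> complex) \<Rightarrow> complex \<Rightarrow> complex" where
  "gser a \<xi> = (\<Sum>m. gker_coeff (Suc m) \<xi> * (- \<i>) ^ Suc m * a m)"

text \<open>The constants precede the quantifiers over a, \<xi>, D and C, so that one estimate
  serves local uniformity in \<xi> as well as growth.\<close>

lemma gser_term_bound:
  "\<exists>A b. 0 < A \<and> 0 < b \<and> (\<forall>a \<xi> D C m. norm (a m) \<le> D * C ^ m / fact m \<longrightarrow> 0 \<le> D \<longrightarrow> 0 \<le> C \<longrightarrow>
       norm (gker_coeff (Suc m) \<xi> * (- \<i>) ^ Suc m * a m) \<le> A * exp (b * norm \<xi>) * D * (C ^ m / fact m))"
proof -
  obtain A b where A: "0 < A" "0 < b" "\<And>m \<xi>. norm (gker_coeff m \<xi>) \<le> A * exp (b * norm \<xi>) / 4 ^ m"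
    using gker_coeff_bound by auto
  have t: "norm (gker_coeff (Suc m) \<xi> * (- \<i>) ^ Suc m * a m) \<le> A * exp (b * norm \<xi>) * D * (C ^ m / fact m)"
    if "norm (a m) \<le> D * C ^ m / fact m" "0 \<le> D" "0 \<le> C" for a :: "nat \<Rightarrow> complex" and \<xi> D C m
  proof -
    have "norm (gker_coeff (Suc m) \<xi>) \<le> A * exp (b * norm \<xi>)"
    proof (rule order.trans[OF A(3)])
      have "A * exp (b * norm \<xi>) / 4 ^ Suc m \<le> A * exp (b * norm \<xi>) / 1"
        using A(1) by (intro divide_left_mono one_le_power) auto
      then show "A * exp (b * norm \<xi>) / 4 ^ Suc m \<le> A * exp (b * norm \<xi>)" by simp
    qed
    then have "norm (gker_coeff (Suc m) \<xi>) * norm (a m) \<le> (A * exp (b * norm \<xi>)) * (D * C ^ m / fact m)"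
      using that A by (intro mult_mono) auto
    then show ?thesis by (simp add: norm_mult norm_power mult_ac)
  qed
  show ?thesis by (rule exI[of _ A], rule exI[of _ b]) (use t A in blast)
qed

lemma summable_gser_bound: "summable (\<lambda>m. B * (C ^ m / fact m))" for B C :: real
  using summable_exp[of C] by (intro summable_mult) (simp add: divide_inverse mult.commute)

lemma gser_bound:
  "\<exists>A b. 0 < A \<and> 0 < b \<and> (\<forall>a \<xi> D C. (\<forall>m. norm (a m) \<le> D * C ^ m / fact m) \<longrightarrow> 0 \<le> D \<longrightarrow> 0 \<le> C \<longrightarrow>
       summable (\<lambda>m. gker_coeff (Suc m) \<xi> * (- \<i>) ^ Suc m * a m) \<and> norm (gser a \<xi>) \<le> A * exp (b * norm \<xi>) * D * exp C)"
proof -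
  obtain A b where A: "0 < A" "0 < b" and
    t: "\<forall>a \<xi> D C m. norm (a m) \<le> D * C ^ m / fact m \<longrightarrow> 0 \<le> D \<longrightarrow> 0 \<le> C \<longrightarrow>
       norm (gker_coeff (Suc m) \<xi> * (- \<i>) ^ Suc m * a m) \<le> A * exp (b * norm \<xi>) * D * (C ^ m / fact m)"
    using gser_term_bound by auto
  have "summable (\<lambda>m. gker_coeff (Suc m) \<xi> * (- \<i>) ^ Suc m * a m) \<and> norm (gser a \<xi>) \<le> A * exp (b * norm \<xi>) * D * exp C"
    if a: "\<And>m. norm (a m) \<le> D * C ^ m / fact m" "0 \<le> D" "0 \<le> C" for a \<xi> D C
  proof -
    have e: "(\<lambda>m. A * exp (b * norm \<xi>) * D * (C ^ m / fact m)) sums (A * exp (b * norm \<xi>) * D * exp C)"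
      using exp_converges[of C] by (intro sums_mult) (simp add: scaleR_conv_of_real divide_inverse mult.commute)
    have t': "norm (gker_coeff (Suc m) \<xi> * (- \<i>) ^ Suc m * a m) \<le> A * exp (b * norm \<xi>) * D * (C ^ m / fact m)" for m
      using t a by blast
    have s: "summable (\<lambda>m. norm (gker_coeff (Suc m) \<xi> * (- \<i>) ^ Suc m * a m))"
      by (rule summable_comparison_test'[OF sums_summable[OF e], of 0]) (use t' in simp)
    have "norm (gser a \<xi>) \<le> A * exp (b * norm \<xi>) * D * exp C"
      unfolding gser_def using norm_suminf_le[OF t' sums_summable[OF e]] unfolding sums_unique[OF e, symmetric] .
    then show ?thesis using summable_norm_cancel[OF s] by blast
  qed
  note r = this
  show ?thesis by (rule exI[of _ A], rule exI[of _ b]) (use r A in blast)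
qed

lemma gser_summable:
  assumes "\<And>m. norm (a m) \<le> D * C ^ m / fact m" "0 \<le> D" "0 \<le> C"
  shows "summable (\<lambda>m. gker_coeff (Suc m) \<xi> * (- \<i>) ^ Suc m * a m)"
  using gser_bound assms by blast

lemma gser_holomorphic:
  assumes "open S" "\<And>m. (\<lambda>\<xi>. d m \<xi>) holomorphic_on S"
    and "\<And>x. x \<in> S \<Longrightarrow> \<exists>\<delta>>0. cball x \<delta> \<subseteq> S \<and> (\<exists>D C. 0 \<le> D \<and> 0 \<le> C \<and> (\<forall>m. \<forall>y\<in>cball x \<delta>. norm (d m y) \<le> D * C ^ m / fact m))"
  shows "(\<lambda>\<xi>. gser (\<lambda>m. d m \<xi>) \<xi>) holomorphic_on S"
  unfolding gser_def
proof (rule holomorphic_suminf[OF assms(1)])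
  show "(\<lambda>\<xi>. gker_coeff (Suc m) \<xi> * (- \<i>) ^ Suc m * d m \<xi>) holomorphic_on S" for m
    by (intro holomorphic_intros assms holomorphic_on_subset[OF gker_coeff_holomorphic]) auto
  fix x assume "x \<in> S"
  then obtain \<delta> D C where \<delta>: "\<delta> > 0" "cball x \<delta> \<subseteq> S" "0 \<le> D" "0 \<le> C" "\<And>m y. y \<in> cball x \<delta> \<Longrightarrow> norm (d m y) \<le> D * C ^ m / fact m"
    using assms(3) by blast
  obtain A b where A: "0 < A" "0 < b" and
    t: "\<forall>a \<xi> D C m. norm (a m) \<le> D * C ^ m / fact m \<longrightarrow> 0 \<le> D \<longrightarrow> 0 \<le> C \<longrightarrow>
       norm (gker_coeff (Suc m) \<xi> * (- \<i>) ^ Suc m * a m) \<le> A * exp (b * norm \<xi>) * D * (C ^ m / fact m)"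
    using gser_term_bound by auto
  show "\<exists>\<delta>>0. cball x \<delta> \<subseteq> S \<and> (\<exists>B. summable B \<and> (\<forall>m. \<forall>y\<in>cball x \<delta>. norm (gker_coeff (Suc m) y * (- \<i>) ^ Suc m * d m y) \<le> B m))"
  proof (intro exI[of _ \<delta>] conjI exI[of _ "\<lambda>m. A * exp (b * (norm x + \<delta>)) * D * (C ^ m / fact m)"] allI ballI \<delta>)
    show "summable (\<lambda>m. A * exp (b * (norm x + \<delta>)) * D * (C ^ m / fact m))"
      by (rule summable_gser_bound)
    fix m y assume y: "y \<in> cball x \<delta>"
    have "norm y \<le> norm x + \<delta>" using y norm_triangle_ineq2[of y x] by (simp add: dist_norm norm_minus_commute)
    then have e: "exp (b * norm y) \<le> exp (b * (norm x + \<delta>))" using A by simp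
    have "norm (gker_coeff (Suc m) y * (- \<i>) ^ Suc m * d m y) \<le> A * exp (b * norm y) * D * (C ^ m / fact m)"
      using t[rule_format, of "\<lambda>m. d m y" m D C y] \<delta>(5)[OF y, of m] \<delta>(3,4) by blast
    also have "\<dots> \<le> A * exp (b * (norm x + \<delta>)) * D * (C ^ m / fact m)"
      using A e \<delta> by (intro mult_right_mono mult_left_mono) auto
    finally show "norm (gker_coeff (Suc m) y * (- \<i>) ^ Suc m * d m y) \<le> A * exp (b * (norm x + \<delta>)) * D * (C ^ m / fact m)" .
  qed
qed

lemma gser_add:
  assumes "summable (\<lambda>m. gker_coeff (Suc m) \<xi> * (- \<i>) ^ Suc m * a m)" "summable (\<lambda>m. gker_coeff (Suc m) \<xi> * (- \<i>) ^ Suc m * c m)"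
  shows "gser (\<lambda>m. a m + c m) \<xi> = gser a \<xi> + gser c \<xi>"
  unfolding gser_def using suminf_add[OF assms] by (simp add: ring_distribs)

lemma gser_cmult:
  assumes "summable (\<lambda>m. gker_coeff (Suc m) \<xi> * (- \<i>) ^ Suc m * a m)"
  shows "gser (\<lambda>m. c * a m) \<xi> = c * gser a \<xi>"
  unfolding gser_def using suminf_mult[OF assms, of c] by (simp add: mult_ac)

text \<open>Cauchy's formula for the \<open>m + 1\<close>-fold primitive vanishing at \<open>0\<close>, i.e. the integral of
  \<open>(\<xi> - \<eta>) ^ m / fact m * M \<eta>\<close> along the segment from \<open>0\<close> to \<open>\<xi>\<close>.\<close>

definition iter_prim :: "nat \<Rightarrow> (complex \<Rightarrow> complex) \<Rightarrow> complex \<Rightarrow> complex" where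
  "iter_prim m M \<xi> = \<xi> ^ Suc m / fact m * integral {0..1} (\<lambda>s. of_real ((1 - s) ^ m) * M (of_real s * \<xi>))"

text \<open>Written out, the integral of \<open>conv_ker \<xi> (\<xi> - \<eta>) * M \<eta>\<close>
  over \<eta> from 0 to \<xi>, with the kernel expanded in powers of
  \<open>\<xi> - \<eta>\<close>.\<close>

definition conv_op :: "(complex \<Rightarrow> complex) \<Rightarrow> complex \<Rightarrow> complex" where
  "conv_op M \<xi> = gser (\<lambda>m. iter_prim m M \<xi>) \<xi>"

lemma segment_param: "s \<in> {0..1} \<Longrightarrow> of_real s * \<xi> \<in> closed_segment 0 (\<xi>::complex)"
  by (auto simp: in_segment scaleR_conv_of_real)

lemma iter_prim_integrand_continuous:
  fixes \<xi> :: complex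
  assumes "continuous_on (closed_segment 0 \<xi>) M"
  shows "continuous_on {0..1} (\<lambda>s. complex_of_real ((1 - s) ^ m) * M (of_real s * \<xi>))"
proof -
  have "continuous_on {0..1} (\<lambda>s. M (of_real s * \<xi>))"
  proof (rule continuous_on_compose2[OF assms])
    show "continuous_on {0..1} (\<lambda>s. complex_of_real s * \<xi>)" by (intro continuous_intros)
    show "(\<lambda>s. complex_of_real s * \<xi>) ` {0..1} \<subseteq> closed_segment 0 \<xi>" using segment_param by blast
  qed
  then show ?thesis by (intro continuous_intros)
qed

lemma iter_prim_bound:
  assumes "continuous_on (closed_segment 0 \<xi>) M" "\<And>x. x \<in> closed_segment 0 \<xi> \<Longrightarrow> norm (M x) \<le> B"
  shows "norm (iter_prim m M \<xi>) \<le> (norm \<xi> * B) * norm \<xi> ^ m / fact m"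
proof -
  have "norm (integral {0..1} (\<lambda>s. of_real ((1 - s) ^ m) * M (of_real s * \<xi>))) \<le> B * (1 - 0)"
  proof (rule integral_bound[OF _ iter_prim_integrand_continuous[OF assms(1)]])
    fix s :: real assume s: "s \<in> {0..1}"
    have "\<bar>1 - s\<bar> ^ m * norm (M (of_real s * \<xi>)) \<le> 1 * B"
      using s assms(2)[OF segment_param[OF s]] by (intro mult_mono power_le_one) auto
    then show "norm (complex_of_real ((1 - s) ^ m) * M (of_real s * \<xi>)) \<le> B"
      by (simp add: norm_mult norm_power power_abs flip: of_real_power of_real_diff)
  qed simp
  then have "norm \<xi> ^ Suc m / fact m * norm (integral {0..1} (\<lambda>s. of_real ((1 - s) ^ m) * M (of_real s * \<xi>))) \<le> norm \<xi> ^ Suc m / fact m * B"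
    by (intro mult_left_mono) auto
  then show ?thesis unfolding iter_prim_def norm_mult norm_divide norm_power by (simp add: mult_ac)
qed

lemma segment_bounded:
  assumes "continuous_on (closed_segment 0 (\<xi>::complex)) (M :: complex \<Rightarrow> complex)"
  shows "\<exists>B\<ge>0. \<forall>x\<in>closed_segment 0 \<xi>. norm (M x) \<le> B"
proof -
  have "bounded (M ` closed_segment 0 \<xi>)"
    by (intro compact_imp_bounded compact_continuous_image assms compact_segment)
  then obtain B where "B > 0" "\<forall>x\<in>M ` closed_segment 0 \<xi>. norm x \<le> B" unfolding bounded_pos by auto
  then show ?thesis by (intro exI[of _ B]) auto
qed

lemma conv_op_summable:
  assumes "continuous_on (closed_segment 0 \<xi>) M"
  shows "summable (\<lambda>m. gker_coeff (Suc m) \<xi> * (- \<i>) ^ Suc m * iter_prim m M \<xi>)"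
proof -
  obtain B where B: "B \<ge> 0" "\<And>x. x \<in> closed_segment 0 \<xi> \<Longrightarrow> norm (M x) \<le> B" using segment_bounded[OF assms] by auto
  show ?thesis by (rule gser_summable[OF iter_prim_bound[OF assms B(2)]]) (use B in auto)
qed

text \<open>Only the supremum of M on the segment enters. One multiple of \<open>norm \<xi>\<close>
  in the exponent comes from the series over m, another from the length of the segment.\<close>

lemma conv_op_bound:
  "\<exists>A b. 0 < A \<and> 0 < b \<and> (\<forall>M \<xi> B. continuous_on (closed_segment 0 \<xi>) M \<longrightarrow> 0 \<le> B \<longrightarrow>
     (\<forall>x\<in>closed_segment 0 \<xi>. norm (M x) \<le> B) \<longrightarrow> norm (conv_op M \<xi>) \<le> A * exp (b * norm \<xi>) * B)"
proof -
  obtain A b where A: "0 < A" "0 < b" and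
    t: "\<forall>a \<xi> D C. (\<forall>m. norm (a m) \<le> D * C ^ m / fact m) \<longrightarrow> 0 \<le> D \<longrightarrow> 0 \<le> C \<longrightarrow>
       summable (\<lambda>m. gker_coeff (Suc m) \<xi> * (- \<i>) ^ Suc m * a m) \<and> norm (gser a \<xi>) \<le> A * exp (b * norm \<xi>) * D * exp C"
    using gser_bound by auto
  have r: "norm (conv_op M \<xi>) \<le> A * exp ((b + 2) * norm \<xi>) * B"
    if c: "continuous_on (closed_segment 0 \<xi>) M" and B: "0 \<le> B" "\<forall>x\<in>closed_segment 0 \<xi>. norm (M x) \<le> B" for M \<xi> B
  proof -
    have "norm (iter_prim m M \<xi>) \<le> (norm \<xi> * B) * norm \<xi> ^ m / fact m" for m
      by (rule iter_prim_bound[OF c]) (use B in auto)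
    then have "norm (conv_op M \<xi>) \<le> A * exp (b * norm \<xi>) * (norm \<xi> * B) * exp (norm \<xi>)"
      unfolding conv_op_def using t[rule_format, of "\<lambda>m. iter_prim m M \<xi>" "norm \<xi> * B" "norm \<xi>" \<xi>] B by auto
    also have "\<dots> \<le> A * exp (b * norm \<xi>) * (exp (norm \<xi>) * B) * exp (norm \<xi>)"
    proof -
      have "norm \<xi> \<le> exp (norm \<xi>)" using exp_ge_add_one_self[of "norm \<xi>"] by linarith
      then show ?thesis using A B by (intro mult_right_mono mult_left_mono) auto
    qed
    also have "\<dots> = A * exp ((b + 2) * norm \<xi>) * B"
      by (simp add: ring_distribs exp_add exp_double power2_eq_square)
    finally show ?thesis .
  qed
  have "0 < b + 2" using A by simp
  show ?thesis by (rule exI[of _ A], rule exI[of _ "b + 2"]) (use r A \<open>0 < b + 2\<close> in blast)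
qed

lemma iter_prim_add:
  assumes "continuous_on (closed_segment 0 \<xi>) M" "continuous_on (closed_segment 0 \<xi>) N"
  shows "iter_prim m (\<lambda>x. M x + N x) \<xi> = iter_prim m M \<xi> + iter_prim m N \<xi>"
  unfolding iter_prim_def
  using integral_add[OF integrable_continuous_interval[OF iter_prim_integrand_continuous[OF assms(1)]]
      integrable_continuous_interval[OF iter_prim_integrand_continuous[OF assms(2)]], of m m]
  by (simp add: ring_distribs)

lemma iter_prim_cmult: "iter_prim m (\<lambda>x. c * M x) \<xi> = c * iter_prim m M \<xi>"
proof -
  have "(\<lambda>s. of_real ((1 - s) ^ m) * (c * M (of_real s * \<xi>))) = (\<lambda>s. c * (of_real ((1 - s) ^ m) * M (of_real s * \<xi>)))"
    by (simp add: mult_ac)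
  then show ?thesis unfolding iter_prim_def by (simp only: integral_mult_right) simp
qed

lemma conv_op_add:
  assumes "continuous_on (closed_segment 0 \<xi>) M" "continuous_on (closed_segment 0 \<xi>) N"
  shows "conv_op (\<lambda>x. M x + N x) \<xi> = conv_op M \<xi> + conv_op N \<xi>"
  unfolding conv_op_def iter_prim_add[OF assms] by (rule gser_add[OF conv_op_summable[OF assms(1)] conv_op_summable[OF assms(2)]])

lemma conv_op_cmult:
  assumes "continuous_on (closed_segment 0 \<xi>) M"
  shows "conv_op (\<lambda>x. c * M x) \<xi> = c * conv_op M \<xi>"
  unfolding conv_op_def iter_prim_cmult by (rule gser_cmult[OF conv_op_summable[OF assms]])

lemma conv_op_sum:
  assumes "finite I" "\<And>i. i \<in> I \<Longrightarrow> continuous_on (closed_segment 0 \<xi>) (M i)"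
  shows "conv_op (\<lambda>x. \<Sum>i\<in>I. M i x) \<xi> = (\<Sum>i\<in>I. conv_op (M i) \<xi>)"
  using assms
proof (induction I)
  case empty
  have "conv_op (\<lambda>x. 0 * 0) \<xi> = 0 * conv_op (\<lambda>x. 0) \<xi>" by (rule conv_op_cmult) (rule continuous_on_const)
  then show ?case by simp
next
  case (insert i I)
  then have "conv_op (\<lambda>x. M i x + (\<Sum>i\<in>I. M i x)) \<xi> = conv_op (M i) \<xi> + conv_op (\<lambda>x. \<Sum>i\<in>I. M i x) \<xi>"
    by (intro conv_op_add continuous_intros) auto
  then show ?case using insert by simp
qed

lemma conv_op_cong:
  assumes "\<And>x. x \<in> closed_segment 0 \<xi> \<Longrightarrow> M x = N x"
  shows "conv_op M \<xi> = conv_op N \<xi>"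
proof -
  have "iter_prim m M \<xi> = iter_prim m N \<xi>" for m
    unfolding iter_prim_def
    by (intro arg_cong2[where f = times] refl integral_cong) (use assms[OF segment_param] in auto)
  then show ?thesis by (simp add: conv_op_def)
qed

text \<open>On the segment the partial sums converge uniformly, and \<open>conv_op_bound\<close>
  makes the operator continuous for the supremum norm.\<close>

lemma conv_op_sums:
  assumes c: "\<And>n. continuous_on (closed_segment 0 \<xi>) (g n)" and "summable B"
    and le: "\<And>n x. x \<in> closed_segment 0 \<xi> \<Longrightarrow> norm (g n x) \<le> B n"
  shows "(\<lambda>n. conv_op (g n) \<xi>) sums conv_op (\<lambda>x. \<Sum>n. g n x) \<xi>"
proof -
  let ?S = "closed_segment 0 \<xi>"
  have ul: "uniform_limit ?S (\<lambda>n x. \<Sum>i<n. g i x) (\<lambda>x. \<Sum>n. g n x) sequentially"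
    by (rule Weierstrass_m_test[OF le \<open>summable B\<close>])
  have cs: "continuous_on ?S (\<lambda>x. \<Sum>i<n. g i x)" for n by (intro continuous_intros c)
  have cl: "continuous_on ?S (\<lambda>x. \<Sum>n. g n x)"
    by (rule uniform_limit_theorem[OF _ ul]) (use cs in auto)
  obtain A b where A: "0 < A" "0 < b" and
    T: "\<forall>M \<xi> B. continuous_on (closed_segment 0 \<xi>) M \<longrightarrow> 0 \<le> B \<longrightarrow>
     (\<forall>x\<in>closed_segment 0 \<xi>. norm (M x) \<le> B) \<longrightarrow> norm (conv_op M \<xi>) \<le> A * exp (b * norm \<xi>) * B"
    using conv_op_bound by auto
  have "(\<lambda>n. conv_op (\<lambda>x. \<Sum>i<n. g i x) \<xi>) \<longlonglongrightarrow> conv_op (\<lambda>x. \<Sum>n. g n x) \<xi>"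
  proof (rule LIMSEQ_I)
    fix e :: real assume e: "0 < e"
    define E where "E = A * exp (b * norm \<xi>)"
    have E: "0 < E" using A by (simp add: E_def)
    have "\<forall>\<^sub>F n in sequentially. \<forall>x\<in>?S. dist (\<Sum>i<n. g i x) (\<Sum>n. g n x) < e / (2 * E)"
      by (rule uniform_limitD[OF ul]) (use e E in simp)
    then obtain N where N: "\<And>n x. n \<ge> N \<Longrightarrow> x \<in> ?S \<Longrightarrow> dist (\<Sum>i<n. g i x) (\<Sum>n. g n x) < e / (2 * E)"
      unfolding eventually_sequentially by blast
    show "\<exists>N. \<forall>n\<ge>N. norm (conv_op (\<lambda>x. \<Sum>i<n. g i x) \<xi> - conv_op (\<lambda>x. \<Sum>n. g n x) \<xi>) < e"
    proof (intro exI[of _ N] allI impI)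
      fix n assume n: "n \<ge> N"
      have "conv_op (\<lambda>x. (\<Sum>i<n. g i x) + (- 1) * (\<Sum>n. g n x)) \<xi> = conv_op (\<lambda>x. \<Sum>i<n. g i x) \<xi> + (- 1) * conv_op (\<lambda>x. \<Sum>n. g n x) \<xi>"
        using conv_op_add[OF cs[of n] continuous_on_mult_left[OF cl, of "- 1"]] conv_op_cmult[OF cl, of "- 1"] by simp
      then have eq: "conv_op (\<lambda>x. \<Sum>i<n. g i x) \<xi> - conv_op (\<lambda>x. \<Sum>n. g n x) \<xi> = conv_op (\<lambda>x. (\<Sum>i<n. g i x) + (- 1) * (\<Sum>n. g n x)) \<xi>"
        by simp
      have "norm (conv_op (\<lambda>x. (\<Sum>i<n. g i x) + (- 1) * (\<Sum>n. g n x)) \<xi>) \<le> A * exp (b * norm \<xi>) * (e / (2 * E))"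
        using T[rule_format, of \<xi> "\<lambda>x. (\<Sum>i<n. g i x) + (- 1) * (\<Sum>n. g n x)" "e / (2 * E)"]
          continuous_on_add[OF cs[of n] continuous_on_mult_left[OF cl, of "- 1"]] e E N[OF n]
        by (auto simp: dist_norm less_imp_le)
      also have "\<dots> = e / 2" using E by (simp flip: E_def)
      finally show "norm (conv_op (\<lambda>x. \<Sum>i<n. g i x) \<xi> - conv_op (\<lambda>x. \<Sum>n. g n x) \<xi>) < e"
        unfolding eq using e by linarith
    qed
  qed
  moreover have "conv_op (\<lambda>x. \<Sum>i<n. g i x) \<xi> = (\<Sum>i<n. conv_op (g i) \<xi>)" for n by (rule conv_op_sum) (use c in auto)
  ultimately show ?thesis by (simp add: sums_def)
qed

text \<open>The integral over \<open>{0..1}\<close> has a fixed domain, so it can be differentiated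
  in \<xi>; the star shape of S keeps \<open>s * \<xi>\<close> inside the domain of M.\<close>

lemma iter_prim_holomorphic:
  assumes S: "open S" "\<And>x. x \<in> S \<Longrightarrow> closed_segment 0 x \<subseteq> S" and M: "M holomorphic_on S"
  shows "iter_prim m M holomorphic_on S"
proof -
  have "(\<lambda>\<xi>. integral {0..1} (\<lambda>s. of_real ((1 - s) ^ m) * M (of_real s * \<xi>))) holomorphic_on ball x e"
    if e: "ball x e \<subseteq> S" for x e
  proof -
    have inS: "of_real s * \<xi> \<in> S" if "\<xi> \<in> ball x e" "s \<in> {0..1}" for \<xi> s
      using S(2)[of \<xi>] e that segment_param[of s \<xi>] by blast
    have dM: "deriv M holomorphic_on S" by (rule holomorphic_deriv[OF M S(1)])
    have "(\<lambda>\<xi>. integral (cbox 0 1) (\<lambda>s. of_real ((1 - s) ^ m) * M (of_real s * \<xi>))) holomorphic_on ball x e"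
    proof (rule leibniz_rule_holomorphic[where fx = "\<lambda>\<xi> s. of_real ((1 - s) ^ m) * (deriv M (of_real s * \<xi>) * of_real s)"])
      fix \<xi> and s :: real assume a: "\<xi> \<in> ball x e" "s \<in> cbox 0 1"
      have "(M has_field_derivative deriv M (of_real s * \<xi>)) (at (of_real s * \<xi>))"
        using holomorphic_derivI[OF M S(1) inS] a by auto
      moreover have "((\<lambda>\<xi>. of_real s * \<xi>) has_field_derivative of_real s) (at \<xi> within ball x e)"
        by (auto intro!: derivative_eq_intros)
      ultimately have "((\<lambda>\<xi>. M (of_real s * \<xi>)) has_field_derivative deriv M (of_real s * \<xi>) * of_real s) (at \<xi> within ball x e)"
        using DERIV_chain2[of M _ "\<lambda>\<xi>. of_real s * \<xi>"] by blast
      then show "((\<lambda>\<xi>. of_real ((1 - s) ^ m) * M (of_real s * \<xi>)) has_field_derivative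
          of_real ((1 - s) ^ m) * (deriv M (of_real s * \<xi>) * of_real s)) (at \<xi> within ball x e)"
        by (rule DERIV_cmult)
    next
      fix \<xi> assume a: "\<xi> \<in> ball x e"
      have "continuous_on (closed_segment 0 \<xi>) M"
        by (rule continuous_on_subset[OF holomorphic_on_imp_continuous_on[OF M]]) (use a e S(2) in blast)
      then show "(\<lambda>s. of_real ((1 - s) ^ m) * M (of_real s * \<xi>)) integrable_on cbox 0 1"
        unfolding cbox_interval by (intro integrable_continuous_interval iter_prim_integrand_continuous)
    next
      have "continuous_on (ball x e \<times> cbox 0 1) (\<lambda>p. deriv M (of_real (snd p) * fst p))"
        by (rule continuous_on_compose2[OF holomorphic_on_imp_continuous_on[OF dM]])
           (use inS in \<open>auto intro!: continuous_intros\<close>)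
      then have "continuous_on (ball x e \<times> cbox 0 1) (\<lambda>p. of_real ((1 - snd p) ^ m) * (deriv M (of_real (snd p) * fst p) * of_real (snd p)))"
        by (intro continuous_intros)
      then show "continuous_on (ball x e \<times> cbox 0 1) (\<lambda>(\<xi>, s). of_real ((1 - s) ^ m) * (deriv M (of_real s * \<xi>) * of_real s))"
        by (simp add: case_prod_unfold)
    qed simp
    then show ?thesis by (simp add: cbox_interval)
  qed
  then have "(\<lambda>\<xi>. integral {0..1} (\<lambda>s. of_real ((1 - s) ^ m) * M (of_real s * \<xi>))) analytic_on S"
    unfolding analytic_on_def using S(1) open_contains_ball by blast
  then have "(\<lambda>\<xi>. integral {0..1} (\<lambda>s. of_real ((1 - s) ^ m) * M (of_real s * \<xi>))) holomorphic_on S"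
    by (rule analytic_imp_holomorphic)
  then show ?thesis unfolding iter_prim_def[abs_def] by (intro holomorphic_intros) auto
qed

lemma conv_op_holomorphic:
  assumes S: "open S" "\<And>x. x \<in> S \<Longrightarrow> closed_segment 0 x \<subseteq> S" and M: "M holomorphic_on S"
  shows "conv_op M holomorphic_on S"
  unfolding conv_op_def[abs_def]
proof (rule gser_holomorphic[OF S(1)])
  show "iter_prim m M holomorphic_on S" for m by (rule iter_prim_holomorphic[OF assms])
  have cM: "continuous_on S M" using M by (rule holomorphic_on_imp_continuous_on)
  fix x assume "x \<in> S"
  then obtain \<delta> where \<delta>: "\<delta> > 0" "cball x \<delta> \<subseteq> S" using S(1) open_contains_cball by blast
  \<comment> \<open>The union of the segments from 0 to the points of a small disk around x: a
    compact subset of S on which M is bounded, giving estimates uniform in that disk.\<close>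
  let ?P = "(\<lambda>p. of_real (fst p) * snd p) ` ({0..1::real} \<times> cball x \<delta>)"
  have cmp: "compact ?P" by (intro compact_continuous_image continuous_intros compact_Times compact_cball) auto
  have sub: "?P \<subseteq> S"
  proof
    fix y assume "y \<in> ?P"
    then obtain s w where "s \<in> {0..1}" "w \<in> cball x \<delta>" "y = of_real s * w" by auto
    then show "y \<in> S" using S(2)[of w] \<delta>(2) segment_param[of s w] by blast
  qed
  have "bounded (M ` ?P)"
    by (rule compact_imp_bounded[OF compact_continuous_image[OF continuous_on_subset[OF cM sub] cmp]])
  then obtain B where B: "B > 0" "\<And>y. y \<in> ?P \<Longrightarrow> norm (M y) \<le> B" unfolding bounded_pos by blast
  have "norm (iter_prim m M y) \<le> ((norm x + \<delta>) * B) * (norm x + \<delta>) ^ m / fact m" if y: "y \<in> cball x \<delta>" for m y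
  proof -
    have ny: "norm y \<le> norm x + \<delta>" using y norm_triangle_ineq2[of y x] by (simp add: dist_norm norm_minus_commute)
    have "norm (iter_prim m M y) \<le> (norm y * B) * norm y ^ m / fact m"
    proof (rule iter_prim_bound)
      show "continuous_on (closed_segment 0 y) M"
        by (rule continuous_on_subset[OF cM]) (use y \<delta> S(2) in blast)
      fix w assume "w \<in> closed_segment 0 y"
      then obtain s where "0 \<le> s" "s \<le> 1" "w = of_real s * y" by (auto simp: in_segment scaleR_conv_of_real)
      then show "norm (M w) \<le> B" using y by (intro B(2)) (auto intro!: image_eqI[of _ _ "(s, y)"])
    qed
    also have "\<dots> \<le> ((norm x + \<delta>) * B) * (norm x + \<delta>) ^ m / fact m"
      using ny B \<delta> by (intro divide_right_mono mult_mono power_mono) auto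
    finally show ?thesis .
  qed
  then show "\<exists>\<delta>>0. cball x \<delta> \<subseteq> S \<and> (\<exists>D C. 0 \<le> D \<and> 0 \<le> C \<and> (\<forall>m. \<forall>y\<in>cball x \<delta>. norm (iter_prim m M y) \<le> D * C ^ m / fact m))"
    using \<delta> B
    by (intro exI[of _ \<delta>] conjI exI[of _ "(norm x + \<delta>) * B"] exI[of _ "norm x + \<delta>"]) auto
qed

section \<open>Action of the operator on exponentials\<close>

text \<open>Taylor's formula for \<open>exp\<close> with integral remainder: all terms of the
  derivative telescope except the one of order m.\<close>

lemma exp_Taylor_has_derivative:
  "((\<lambda>w. (\<Sum>j\<le>m. (1 - w) ^ j * x ^ j / fact j) * exp (w * x)) has_field_derivative
     x ^ Suc m / fact m * ((1 - w) ^ m * exp (w * x))) (at (w::complex))"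
proof (induction m)
  case 0
  show ?case by (auto intro!: derivative_eq_intros)
next
  case (Suc m)
  let ?c = "x ^ Suc m / fact (Suc m)"
  have "((\<lambda>w. (1 - w) ^ Suc m) has_field_derivative of_nat (Suc m) * (1 - w) ^ m * (- 1)) (at w)"
    by (auto intro!: derivative_eq_intros simp del: power_Suc of_nat_Suc)
  moreover have "((\<lambda>w. exp (w * x)) has_field_derivative x * exp (w * x)) (at w)"
    by (auto intro!: derivative_eq_intros)
  ultimately have "((\<lambda>w. ?c * ((1 - w) ^ Suc m * exp (w * x))) has_field_derivative
     ?c * (of_nat (Suc m) * (1 - w) ^ m * (- 1) * exp (w * x) + x * exp (w * x) * (1 - w) ^ Suc m)) (at w)"
    by (intro DERIV_cmult DERIV_mult)
  from DERIV_add[OF Suc this]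
  have "((\<lambda>w. (\<Sum>j\<le>Suc m. (1 - w) ^ j * x ^ j / fact j) * exp (w * x)) has_field_derivative
     x ^ Suc m / fact m * ((1 - w) ^ m * exp (w * x)) +
     ?c * (of_nat (Suc m) * (1 - w) ^ m * (- 1) * exp (w * x) + x * exp (w * x) * (1 - w) ^ Suc m)) (at w)"
    by (simp add: ring_distribs mult_ac del: power_Suc fact_Suc of_nat_Suc)
  moreover have "x ^ Suc m / fact m * ((1 - w) ^ m * exp (w * x)) +
     ?c * (of_nat (Suc m) * (1 - w) ^ m * (- 1) * exp (w * x) + x * exp (w * x) * (1 - w) ^ Suc m)
     = x ^ Suc (Suc m) / fact (Suc m) * ((1 - w) ^ Suc m * exp (w * x))"
  proof -
    have "?c * of_nat (Suc m) = x ^ Suc m / fact m"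
      by (simp add: fact_Suc del: of_nat_Suc power_Suc)
    then have "?c * (of_nat (Suc m) * (1 - w) ^ m * (- 1) * exp (w * x)) = - (x ^ Suc m / fact m * ((1 - w) ^ m * exp (w * x)))"
      by (metis (no_types, opaque_lifting) mult.assoc mult.commute mult_minus1)
    then show ?thesis unfolding distrib_left by (simp add: mult_ac)
  qed
  ultimately show ?case by simp
qed

text \<open>With \<open>c = - \<i> / \<theta>\<close>, dividing by \<open>c ^ Suc m\<close> is
  multiplying by \<open>(\<i> * \<theta>) ^ Suc m\<close>: up to the Taylor polynomial, powers of
  \<theta> act as repeated integration.\<close>

lemma iter_prim_exp:
  assumes "c \<noteq> 0"
  shows "iter_prim m (\<lambda>\<eta>. exp (c * \<eta>)) \<xi> = (exp (c * \<xi>) - (\<Sum>j\<le>m. (c * \<xi>) ^ j / fact j)) / c ^ Suc m"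
proof -
  let ?x = "c * \<xi>"
  let ?F = "\<lambda>w. (\<Sum>j\<le>m. (1 - w) ^ j * ?x ^ j / fact j) * exp (w * ?x)"
  have 1: "((\<lambda>s. ?x ^ Suc m / fact m * ((1 - of_real s) ^ m * exp (of_real s * ?x))) has_integral (?F (of_real 1) - ?F (of_real 0))) {0..1}"
    by (rule fundamental_theorem_of_calculus[where f = "\<lambda>s. ?F (of_real s)"])
       (simp, rule has_vector_derivative_real_field[OF exp_Taylor_has_derivative])
  have 2: "?F (of_real 1) - ?F (of_real 0) = exp ?x - (\<Sum>j\<le>m. ?x ^ j / fact j)"
  proof -
    have "(\<Sum>j\<le>m. (1 - complex_of_real 1) ^ j * ?x ^ j / fact j) = (\<Sum>j\<le>m. if j = 0 then 1 else 0)"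
      by (intro sum.cong) auto
    then show ?thesis by simp
  qed
  have "integral {0..1} (\<lambda>s. ?x ^ Suc m / fact m * ((1 - of_real s) ^ m * exp (of_real s * ?x))) = exp ?x - (\<Sum>j\<le>m. ?x ^ j / fact j)"
    by (rule integral_unique[OF 1[unfolded 2]])
  then have "?x ^ Suc m / fact m * integral {0..1} (\<lambda>s. (1 - of_real s) ^ m * exp (of_real s * ?x)) = exp ?x - (\<Sum>j\<le>m. ?x ^ j / fact j)"
    by (simp only: integral_mult_right)
  moreover have "iter_prim m (\<lambda>\<eta>. exp (c * \<eta>)) \<xi> * c ^ Suc m = ?x ^ Suc m / fact m * integral {0..1} (\<lambda>s. (1 - of_real s) ^ m * exp (of_real s * ?x))"
    unfolding iter_prim_def by (simp add: power_mult_distrib mult_ac del: power_Suc)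
  ultimately show ?thesis using assms by (simp add: eq_divide_eq del: power_Suc)
qed

text \<open>The Taylor polynomials left over when the factors \<open>\<theta> ^ Suc m\<close> are
  exchanged for integrations from 0; summed over all k and n they make up H.\<close>

definition exp_rem :: "complex \<Rightarrow> complex \<Rightarrow> complex" where
  "exp_rem \<theta> \<xi> = exp (- \<i> / \<theta> * \<xi>) * gker \<xi> \<theta> - gker_coeff 0 \<xi> * exp (- \<i> / \<theta> * \<xi>) - conv_op (\<lambda>\<eta>. exp (- \<i> / \<theta> * \<eta>)) \<xi>"

lemma exp_rem_holomorphic: "exp_rem \<theta> holomorphic_on UNIV"
  unfolding exp_rem_def[abs_def] gker_def
  by (intro holomorphic_intros gker_coeff_holomorphic conv_op_holomorphic) auto

text \<open>Uniformity in \<theta> is the point: \<open>exp (- \<i> * \<xi> / \<theta>)\<close> may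
  blow up as \<theta> tends to 0, but it cancels. What remains are products of
  \<open>\<theta> ^ Suc m\<close> with a polynomial of degree m in \<open>\<xi> / \<theta>\<close>,
  free of negative powers of \<theta>, and Cauchy's estimate turns them into a series in powers of
  \<open>pi / 4\<close>.\<close>

lemma exp_rem_bound:
  "\<exists>A b. 0 < A \<and> 0 < b \<and> (\<forall>\<theta> \<xi>. \<theta> \<noteq> 0 \<longrightarrow> norm \<theta> \<le> pi \<longrightarrow> norm (exp_rem \<theta> \<xi>) \<le> A * exp (b * norm \<xi>))"
proof -
  obtain A b where A: "0 < A" "0 < b" "\<And>m \<xi>. norm (gker_coeff m \<xi>) \<le> A * exp (b * norm \<xi>) / 4 ^ m"
    using gker_coeff_bound by auto
  have pi4: "pi < 4" using pi_less_4 .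
  define S where "S = (\<Sum>m. (pi / 4) ^ Suc m)"
  have sg: "summable (\<lambda>m. (pi / 4) ^ Suc m)"
    using summable_geometric[of "pi / 4"] pi4 by (subst summable_Suc_iff) simp
  have S0: "0 < S" unfolding S_def by (intro suminf_pos sg) simp
  have r: "norm (exp_rem \<theta> \<xi>) \<le> (A * S) * exp ((b + 1) * norm \<xi>)" if \<theta>: "\<theta> \<noteq> 0" "norm \<theta> \<le> pi" for \<theta> \<xi>
  proof -
    define c where "c = - \<i> / \<theta>"
    have c0: "c \<noteq> 0" and c\<theta>: "c * \<theta> = - \<i>" using \<theta> by (auto simp: c_def)
    define s where "s m = (\<Sum>j\<le>m. (c * \<xi>) ^ j / fact j)" for m
    have "(\<lambda>m. gker_coeff m \<xi> * \<theta> ^ m) sums gker \<xi> \<theta>" by (rule gker_sums) (use \<theta> pi4 in linarith)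
    then have "(\<lambda>m. gker_coeff (Suc m) \<xi> * \<theta> ^ Suc m) sums (gker \<xi> \<theta> - gker_coeff 0 \<xi>)" by (subst sums_Suc_iff) simp
    then have 1: "(\<lambda>m. exp (c * \<xi>) * (gker_coeff (Suc m) \<xi> * \<theta> ^ Suc m)) sums (exp (c * \<xi>) * (gker \<xi> \<theta> - gker_coeff 0 \<xi>))" by (rule sums_mult)
    have tops: "(\<lambda>m. gker_coeff (Suc m) \<xi> * (- \<i>) ^ Suc m * iter_prim m (\<lambda>\<eta>. exp (c * \<eta>)) \<xi>) sums conv_op (\<lambda>\<eta>. exp (c * \<eta>)) \<xi>"
      unfolding conv_op_def gser_def by (intro summable_sums conv_op_summable continuous_intros)
    have Pe: "exp_rem \<theta> \<xi> = exp (c * \<xi>) * (gker \<xi> \<theta> - gker_coeff 0 \<xi>) - conv_op (\<lambda>\<eta>. exp (c * \<eta>)) \<xi>"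
      unfolding exp_rem_def c_def right_diff_distrib by (simp only: mult.commute[of "gker_coeff 0 \<xi>"])
    have 2: "(\<lambda>m. exp (c * \<xi>) * (gker_coeff (Suc m) \<xi> * \<theta> ^ Suc m) - gker_coeff (Suc m) \<xi> * (- \<i>) ^ Suc m * iter_prim m (\<lambda>\<eta>. exp (c * \<eta>)) \<xi>) sums exp_rem \<theta> \<xi>"
      unfolding Pe by (rule sums_diff[OF 1 tops])
    \<comment> \<open>The exponentials cancel and only the partial sum \<open>s m\<close> of the
      exponential series stays.\<close>
    have eq: "exp (c * \<xi>) * (gker_coeff (Suc m) \<xi> * \<theta> ^ Suc m) - gker_coeff (Suc m) \<xi> * (- \<i>) ^ Suc m * iter_prim m (\<lambda>\<eta>. exp (c * \<eta>)) \<xi>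
        = gker_coeff (Suc m) \<xi> * (\<theta> ^ Suc m * s m)" for m
    proof -
      have "(- \<i>) ^ Suc m / c ^ Suc m = \<theta> ^ Suc m"
        unfolding c\<theta>[symmetric] power_mult_distrib using c0 by simp
      then have "(- \<i>) ^ Suc m * iter_prim m (\<lambda>\<eta>. exp (c * \<eta>)) \<xi> = \<theta> ^ Suc m * (exp (c * \<xi>) - s m)"
        unfolding iter_prim_exp[OF c0] s_def by (metis times_divide_eq_left times_divide_eq_right)
      then have "gker_coeff (Suc m) \<xi> * (- \<i>) ^ Suc m * iter_prim m (\<lambda>\<eta>. exp (c * \<eta>)) \<xi> = gker_coeff (Suc m) \<xi> * (\<theta> ^ Suc m * (exp (c * \<xi>) - s m))"
        by (simp only: mult.assoc)
      then show ?thesis by (simp only:) (simp add: algebra_simps del: power_Suc)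
    qed
    have le: "norm (gker_coeff (Suc m) \<xi> * (\<theta> ^ Suc m * s m)) \<le> (A * exp (b * norm \<xi>) * exp (norm \<xi>)) * (pi / 4) ^ Suc m" for m
    proof -
      have "norm (\<theta> ^ Suc m * s m) = norm (\<Sum>j\<le>m. \<theta> ^ Suc m * ((c * \<xi>) ^ j / fact j))" by (simp add: s_def sum_distrib_left)
      also have "\<dots> \<le> (\<Sum>j\<le>m. pi ^ Suc m * (inverse (fact j) * norm \<xi> ^ j))"
      proof (rule sum_norm_le)
        fix j assume j: "j \<in> {..m}"
        have nc: "norm c = 1 / norm \<theta>" by (simp add: c_def norm_divide)
        have "norm (\<theta> ^ Suc m * ((c * \<xi>) ^ j / fact j)) = norm \<theta> ^ Suc m / norm \<theta> ^ j * (inverse (fact j) * norm \<xi> ^ j)"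
          by (simp add: norm_mult norm_divide norm_power nc power_divide power_mult_distrib divide_inverse power_inverse norm_inverse mult_ac)
        also have "norm \<theta> ^ Suc m / norm \<theta> ^ j = norm \<theta> ^ (Suc m - j)" using j \<theta> by (simp add: power_diff)
        also have "\<dots> * (inverse (fact j) * norm \<xi> ^ j) \<le> pi ^ Suc m * (inverse (fact j) * norm \<xi> ^ j)"
        proof (rule mult_right_mono)
          have "norm \<theta> ^ (Suc m - j) \<le> pi ^ (Suc m - j)" using \<theta> by (intro power_mono) auto
          also have "\<dots> \<le> pi ^ Suc m" using pi_gt3 by (intro power_increasing) auto
          finally show "norm \<theta> ^ (Suc m - j) \<le> pi ^ Suc m" .
        qed simp
        finally show "norm (\<theta> ^ Suc m * ((c * \<xi>) ^ j / fact j)) \<le> pi ^ Suc m * (inverse (fact j) * norm \<xi> ^ j)" .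
      qed
      also have "\<dots> = pi ^ Suc m * (\<Sum>j\<le>m. inverse (fact j) * norm \<xi> ^ j)" by (simp add: sum_distrib_left)
      also have "\<dots> \<le> pi ^ Suc m * exp (norm \<xi>)"
      proof (rule mult_left_mono)
        have "(\<Sum>j\<le>m. inverse (fact j) * norm \<xi> ^ j) \<le> (\<Sum>j. inverse (fact j) * norm \<xi> ^ j)"
          by (rule sum_le_suminf[OF summable_exp]) auto
        also have "\<dots> = exp (norm \<xi>)" by (simp add: exp_def)
        finally show "(\<Sum>j\<le>m. inverse (fact j) * norm \<xi> ^ j) \<le> exp (norm \<xi>)" .
      qed simp
      finally have "norm (\<theta> ^ Suc m * s m) \<le> pi ^ Suc m * exp (norm \<xi>)" .
      then have "norm (gker_coeff (Suc m) \<xi>) * norm (\<theta> ^ Suc m * s m) \<le> (A * exp (b * norm \<xi>) / 4 ^ Suc m) * (pi ^ Suc m * exp (norm \<xi>))"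
        using A by (intro mult_mono A(3)) auto
      also have "\<dots> = (A * exp (b * norm \<xi>) * exp (norm \<xi>)) * (pi / 4) ^ Suc m"
        by (simp add: power_divide mult_ac del: power_Suc)
      finally show ?thesis by (simp only: norm_mult)
    qed
    have "norm (exp_rem \<theta> \<xi>) \<le> (\<Sum>m. (A * exp (b * norm \<xi>) * exp (norm \<xi>)) * (pi / 4) ^ Suc m)"
      using norm_suminf_le[OF le summable_mult[OF sg]] sums_unique[OF 2] unfolding eq by simp
    also have "\<dots> = (A * exp (b * norm \<xi>) * exp (norm \<xi>)) * S" unfolding S_def by (rule suminf_mult[OF sg])
    also have "\<dots> = (A * S) * exp ((b + 1) * norm \<xi>)" by (simp add: ring_distribs exp_add)
    finally show ?thesis .
  qed
  have p: "0 < A * S" "0 < b + 1" using A S0 by auto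
  show ?thesis by (rule exI[of _ "A * S"], rule exI[of _ "b + 1"]) (use r p in blast)
qed

section \<open>Action of the operator on simple poles\<close>

text \<open>The kernel K of the overview; its second argument stands for
  \<open>\<xi> - \<eta>\<close>.\<close>

definition conv_ker :: "complex \<Rightarrow> complex \<Rightarrow> complex" where
  "conv_ker \<xi> \<zeta> = gser (\<lambda>m. \<zeta> ^ m / fact m) \<xi>"

text \<open>The part without logarithm of the primitive of order m + 1 of
  \<open>1 / (\<eta> - \<omega>)\<close>; a polynomial in \<xi>.\<close>

definition pole_poly :: "complex \<Rightarrow> nat \<Rightarrow> complex \<Rightarrow> complex" where
  "pole_poly \<omega> m \<xi> = - (\<Sum>i<m. \<xi> ^ Suc i * (\<xi> - \<omega>) ^ (m - Suc i) / of_nat (Suc i)) / fact m"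

definition pole_rem :: "complex \<Rightarrow> complex \<Rightarrow> complex" where
  "pole_rem \<omega> \<xi> = gser (\<lambda>m. pole_poly \<omega> m \<xi>) \<xi>"

lemma conv_ker_holomorphic: "(\<lambda>\<xi>. conv_ker \<xi> (\<xi> - \<omega>)) holomorphic_on UNIV"
  unfolding conv_ker_def
proof (rule gser_holomorphic)
  show "(\<lambda>\<xi>. (\<xi> - \<omega>) ^ m / fact m) holomorphic_on UNIV" for m by (intro holomorphic_intros) auto
  fix x :: complex
  have "norm ((y - \<omega>) ^ m / fact m) \<le> 1 * (norm x + 1 + norm \<omega>) ^ m / fact m" if "y \<in> cball x 1" for m y
  proof -
    have "norm (y - \<omega>) \<le> norm x + 1 + norm \<omega>"
      using that norm_triangle_ineq4[of y \<omega>] norm_triangle_ineq2[of y x] by (simp add: dist_norm norm_minus_commute)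
    then show ?thesis by (auto simp: norm_divide norm_power intro!: divide_right_mono power_mono)
  qed
  moreover have "0 \<le> norm x + 1 + norm \<omega>" by simp
  ultimately show "\<exists>\<delta>>0. cball x \<delta> \<subseteq> UNIV \<and> (\<exists>D C. 0 \<le> D \<and> 0 \<le> C \<and> (\<forall>m. \<forall>y\<in>cball x \<delta>. norm ((y - \<omega>) ^ m / fact m) \<le> D * C ^ m / fact m))"
    by (meson subset_UNIV zero_le_one zero_less_one)
qed auto

lemma norm_pole_poly_le:
  assumes "norm \<xi> \<le> X" "norm (\<xi> - \<omega>) \<le> X"
  shows "norm (pole_poly \<omega> m \<xi>) \<le> 1 * (2 * X) ^ m / fact m"
proof -
  have X0: "0 \<le> X" using assms(1) norm_ge_zero[of \<xi>] by linarith
  have "norm (\<Sum>i<m. \<xi> ^ Suc i * (\<xi> - \<omega>) ^ (m - Suc i) / of_nat (Suc i)) \<le> (\<Sum>i<m. X ^ m)"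
  proof (rule sum_norm_le)
    fix i assume i: "i \<in> {..<m}"
    have "norm (\<xi> ^ Suc i * (\<xi> - \<omega>) ^ (m - Suc i) / of_nat (Suc i)) \<le> norm \<xi> ^ Suc i * norm (\<xi> - \<omega>) ^ (m - Suc i) / 1"
      unfolding norm_divide norm_mult norm_power norm_of_nat by (intro divide_left_mono) auto
    also have "\<dots> \<le> X ^ Suc i * X ^ (m - Suc i) / 1"
      using assms X0 by (intro divide_right_mono mult_mono power_mono) auto
    also have "\<dots> = X ^ m" using i by (simp flip: power_add del: power_Suc)
    finally show "norm (\<xi> ^ Suc i * (\<xi> - \<omega>) ^ (m - Suc i) / of_nat (Suc i)) \<le> X ^ m" .
  qed
  also have "\<dots> = real m * X ^ m" by simp
  \<comment> \<open>Replacing m by \<open>2 ^ m\<close> brings the bound into the form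
    \<open>C ^ m / fact m\<close>.\<close>
  also have "\<dots> \<le> 2 ^ m * X ^ m"
    using X0 less_exp[of m] by (intro mult_right_mono) (auto simp: less_imp_le)
  finally show ?thesis by (simp add: pole_poly_def norm_divide power_mult_distrib divide_right_mono)
qed

lemma pole_rem_holomorphic: "pole_rem \<omega> holomorphic_on UNIV"
  unfolding pole_rem_def[abs_def]
proof (rule gser_holomorphic)
  show "pole_poly \<omega> m holomorphic_on UNIV" for m unfolding pole_poly_def[abs_def] by (intro holomorphic_intros) auto
  fix x :: complex
  have "norm (pole_poly \<omega> m y) \<le> 1 * (2 * (norm x + 1 + norm \<omega>)) ^ m / fact m" if "y \<in> cball x 1" for m y
  proof (rule norm_pole_poly_le)
    show "norm y \<le> norm x + 1 + norm \<omega>" "norm (y - \<omega>) \<le> norm x + 1 + norm \<omega>"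
      using that norm_triangle_ineq4[of y \<omega>] norm_triangle_ineq2[of y x] norm_ge_zero[of \<omega>]
      by (simp_all add: dist_norm norm_minus_commute del: norm_ge_zero)
  qed
  moreover have "0 \<le> 2 * (norm x + 1 + norm \<omega>)" by simp
  ultimately show "\<exists>\<delta>>0. cball x \<delta> \<subseteq> UNIV \<and> (\<exists>D C. 0 \<le> D \<and> 0 \<le> C \<and> (\<forall>m. \<forall>y\<in>cball x \<delta>. norm (pole_poly \<omega> m y) \<le> D * C ^ m / fact m))"
    by (meson subset_UNIV zero_le_one zero_less_one)
qed auto

text \<open>The antiderivative \<open>?F\<close> is guessed: its sum over i differentiates to
  \<open>- \<xi>\<close> times the quotient of \<open>u ^ m - v ^ m\<close> by \<open>u - v\<close>,
  for \<open>u = \<xi> * (1 - w)\<close> and \<open>v = \<xi> - \<omega>\<close>, and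
  \<open>u - v = \<omega> - w * \<xi>\<close> is the denominator of the pole up to sign. The
  hypothesis on the segment keeps \<open>Ln\<close> differentiable along it.\<close>

lemma iter_prim_pole:
  assumes \<omega>: "\<omega> \<noteq> 0" and slit: "\<And>s. s \<in> {0..1} \<Longrightarrow> 1 - of_real s * \<xi> / \<omega> \<notin> \<real>\<^sub>\<le>\<^sub>0"
  shows "iter_prim m (\<lambda>\<eta>. 1 / (\<eta> - \<omega>)) \<xi> = Ln (1 - \<xi> / \<omega>) * ((\<xi> - \<omega>) ^ m / fact m) + pole_poly \<omega> m \<xi>"
proof -
  let ?F = "\<lambda>w. (\<xi> - \<omega>) ^ m * Ln (1 - w * \<xi> / \<omega>) + (\<Sum>i<m. \<xi> ^ Suc i * (1 - w) ^ Suc i * (\<xi> - \<omega>) ^ (m - Suc i) / of_nat (Suc i))"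
  have D: "(?F has_field_derivative \<xi> ^ Suc m * ((1 - of_real s) ^ m * (1 / (of_real s * \<xi> - \<omega>)))) (at (of_real s))"
    if s: "s \<in> {0..1}" for s :: real
  proof -
    let ?w = "complex_of_real s"
    have ne: "1 - ?w * \<xi> / \<omega> \<noteq> 0" using slit[OF s] by auto
    then have ne': "?w * \<xi> - \<omega> \<noteq> 0" using \<omega> by auto
    have L: "((\<lambda>w. Ln (1 - w * \<xi> / \<omega>)) has_field_derivative inverse (1 - ?w * \<xi> / \<omega>) * (- (\<xi> / \<omega>))) (at ?w)"
      using slit[OF s] \<omega> by (auto intro!: derivative_eq_intros simp: divide_inverse)
    have "inverse (1 - ?w * \<xi> / \<omega>) * (- (\<xi> / \<omega>)) = \<xi> / (?w * \<xi> - \<omega>)"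
    proof -
      have "1 - ?w * \<xi> / \<omega> = - (?w * \<xi> - \<omega>) / \<omega>" using \<omega> by (simp add: field_simps)
      moreover have "inverse (- a / \<omega>) * (- (\<xi> / \<omega>)) = \<xi> / a" if "a \<noteq> 0" for a
        using that \<omega> by (simp add: field_simps)
      ultimately show ?thesis using ne' by metis
    qed
    with L have L: "((\<lambda>w. Ln (1 - w * \<xi> / \<omega>)) has_field_derivative \<xi> / (?w * \<xi> - \<omega>)) (at ?w)" by simp
    have P: "((\<lambda>w. \<xi> ^ Suc i * (1 - w) ^ Suc i * (\<xi> - \<omega>) ^ (m - Suc i) / of_nat (Suc i)) has_field_derivative
        - (\<xi> * ((\<xi> * (1 - ?w)) ^ i * (\<xi> - \<omega>) ^ (m - Suc i)))) (at ?w)" for i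
    proof -
      have "((\<lambda>w. (1 - w) ^ Suc i) has_field_derivative of_nat (Suc i) * (1 - ?w) ^ i * (- 1)) (at ?w)"
        by (auto intro!: derivative_eq_intros simp del: power_Suc of_nat_Suc)
      then have "((\<lambda>w. (\<xi> ^ Suc i * (\<xi> - \<omega>) ^ (m - Suc i) / of_nat (Suc i)) * (1 - w) ^ Suc i) has_field_derivative
          (\<xi> ^ Suc i * (\<xi> - \<omega>) ^ (m - Suc i) / of_nat (Suc i)) * (of_nat (Suc i) * (1 - ?w) ^ i * (- 1))) (at ?w)"
        by (rule DERIV_cmult)
      moreover have "(\<xi> ^ Suc i * (\<xi> - \<omega>) ^ (m - Suc i) / of_nat (Suc i)) * (of_nat (Suc i) * (1 - ?w) ^ i * (- 1))
         = - (\<xi> * ((\<xi> * (1 - ?w)) ^ i * (\<xi> - \<omega>) ^ (m - Suc i)))"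
      proof -
        have *: "(\<xi> ^ Suc i * V / N) * (N * Y ^ i * (- 1)) = - (\<xi> * ((\<xi> * Y) ^ i * V))" if "N \<noteq> 0" for N V Y
          using that by (simp add: power_mult_distrib)
        show ?thesis by (rule *) (simp del: of_nat_Suc)
      qed
      moreover have f: "(\<lambda>w. \<xi> ^ Suc i * (1 - w) ^ Suc i * (\<xi> - \<omega>) ^ (m - Suc i) / of_nat (Suc i)) =
          (\<lambda>w. (\<xi> ^ Suc i * (\<xi> - \<omega>) ^ (m - Suc i) / of_nat (Suc i)) * (1 - w) ^ Suc i)"
        by (simp add: mult_ac del: of_nat_Suc power_Suc)
      ultimately show ?thesis unfolding f by (simp only:)
    qed
    let ?u = "\<xi> * (1 - ?w)" and ?v = "\<xi> - \<omega>"
    have "(?F has_field_derivative ?v ^ m * (\<xi> / (?w * \<xi> - \<omega>)) + (\<Sum>i<m. - (\<xi> * (?u ^ i * ?v ^ (m - Suc i))))) (at ?w)"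
      by (rule DERIV_add[OF DERIV_cmult[OF L] DERIV_sum[OF P]])
    moreover have "?v ^ m * (\<xi> / (?w * \<xi> - \<omega>)) + (\<Sum>i<m. - (\<xi> * (?u ^ i * ?v ^ (m - Suc i)))) = \<xi> ^ Suc m * ((1 - ?w) ^ m * (1 / (?w * \<xi> - \<omega>)))"
    proof -
      have "?u ^ m - ?v ^ m = (?u - ?v) * (\<Sum>i<m. ?v ^ (m - Suc i) * ?u ^ i)" by (rule power_diff_sumr2)
      also have "?u - ?v = - (?w * \<xi> - \<omega>)" by (simp add: algebra_simps)
      finally have "?v ^ m - (?w * \<xi> - \<omega>) * (\<Sum>i<m. ?u ^ i * ?v ^ (m - Suc i)) = ?u ^ m" by (simp add: algebra_simps)
      then have e1: "(\<xi> / (?w * \<xi> - \<omega>)) * (?v ^ m - (?w * \<xi> - \<omega>) * (\<Sum>i<m. ?u ^ i * ?v ^ (m - Suc i))) = (\<xi> / (?w * \<xi> - \<omega>)) * ?u ^ m" by simp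
      have e2: "(\<xi> / (?w * \<xi> - \<omega>)) * (?v ^ m - (?w * \<xi> - \<omega>) * (\<Sum>i<m. ?u ^ i * ?v ^ (m - Suc i)))
          = ?v ^ m * (\<xi> / (?w * \<xi> - \<omega>)) - \<xi> * (\<Sum>i<m. ?u ^ i * ?v ^ (m - Suc i))"
        using ne' by (simp add: right_diff_distrib mult.commute)
      have e3: "(\<Sum>i<m. - (\<xi> * (?u ^ i * ?v ^ (m - Suc i)))) = - (\<xi> * (\<Sum>i<m. ?u ^ i * ?v ^ (m - Suc i)))"
        by (simp add: sum_negf sum_distrib_left)
      have "?v ^ m * (\<xi> / (?w * \<xi> - \<omega>)) - \<xi> * (\<Sum>i<m. ?u ^ i * ?v ^ (m - Suc i)) = (\<xi> / (?w * \<xi> - \<omega>)) * ?u ^ m"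
        using e1 e2 by metis
      then show ?thesis unfolding e3 by (simp add: power_mult_distrib)
    qed
    ultimately show ?thesis by simp
  qed
  have "((\<lambda>s. \<xi> ^ Suc m * ((1 - of_real s) ^ m * (1 / (of_real s * \<xi> - \<omega>)))) has_integral (?F (of_real 1) - ?F (of_real 0))) {0..1}"
    by (rule fundamental_theorem_of_calculus[where f = "\<lambda>s. ?F (of_real s)"])
       (simp, rule has_vector_derivative_real_field[OF D])
  then have "integral {0..1} (\<lambda>s. \<xi> ^ Suc m * ((1 - of_real s) ^ m * (1 / (of_real s * \<xi> - \<omega>)))) = ?F (of_real 1) - ?F (of_real 0)"
    by (rule integral_unique)
  moreover have "?F (of_real 1) - ?F (of_real 0) = (\<xi> - \<omega>) ^ m * Ln (1 - \<xi> / \<omega>) - (\<Sum>i<m. \<xi> ^ Suc i * (\<xi> - \<omega>) ^ (m - Suc i) / of_nat (Suc i))"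
    by simp
  ultimately have "\<xi> ^ Suc m * integral {0..1} (\<lambda>s. (1 - of_real s) ^ m * (1 / (of_real s * \<xi> - \<omega>))) =
     (\<xi> - \<omega>) ^ m * Ln (1 - \<xi> / \<omega>) - (\<Sum>i<m. \<xi> ^ Suc i * (\<xi> - \<omega>) ^ (m - Suc i) / of_nat (Suc i))"
    by (simp only: integral_mult_right)
  then have "\<xi> ^ Suc m * integral {0..1} (\<lambda>s. (1 - of_real s) ^ m * (1 / (of_real s * \<xi> - \<omega>))) / fact m =
     ((\<xi> - \<omega>) ^ m * Ln (1 - \<xi> / \<omega>) - (\<Sum>i<m. \<xi> ^ Suc i * (\<xi> - \<omega>) ^ (m - Suc i) / of_nat (Suc i))) / fact m"
    by (simp only:)
  then show ?thesis
    unfolding iter_prim_def pole_poly_def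
    by (simp add: diff_divide_distrib mult_ac del: power_Suc of_nat_Suc)
qed

text \<open>The logarithm is the same for every m and factors out; the remaining series is the
  kernel at \<open>\<xi> - \<omega>\<close>.\<close>

lemma conv_op_pole:
  assumes \<omega>: "\<omega> \<noteq> 0" and slit: "\<And>s. s \<in> {0..1} \<Longrightarrow> 1 - of_real s * \<xi> / \<omega> \<notin> \<real>\<^sub>\<le>\<^sub>0"
  shows "conv_op (\<lambda>\<eta>. 1 / (\<eta> - \<omega>)) \<xi> = conv_ker \<xi> (\<xi> - \<omega>) * Ln (1 - \<xi> / \<omega>) + pole_rem \<omega> \<xi>"
proof -
  have s1: "summable (\<lambda>m. gker_coeff (Suc m) \<xi> * (- \<i>) ^ Suc m * ((\<xi> - \<omega>) ^ m / fact m))"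
    by (rule gser_summable[of _ 1 "norm (\<xi> - \<omega>)"]) (auto simp: norm_divide norm_power)
  have s1': "summable (\<lambda>m. gker_coeff (Suc m) \<xi> * (- \<i>) ^ Suc m * (Ln (1 - \<xi> / \<omega>) * ((\<xi> - \<omega>) ^ m / fact m)))"
    using summable_mult[OF s1, of "Ln (1 - \<xi> / \<omega>)"] by (simp add: mult_ac)
  have s2: "summable (\<lambda>m. gker_coeff (Suc m) \<xi> * (- \<i>) ^ Suc m * pole_poly \<omega> m \<xi>)"
    by (rule gser_summable[OF norm_pole_poly_le[of \<xi> "max (norm \<xi>) (norm (\<xi> - \<omega>))"]]) (auto simp: le_max_iff_disj)
  have "iter_prim m (\<lambda>\<eta>. 1 / (\<eta> - \<omega>)) \<xi> = Ln (1 - \<xi> / \<omega>) * ((\<xi> - \<omega>) ^ m / fact m) + pole_poly \<omega> m \<xi>" for m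
    by (rule iter_prim_pole[OF assms])
  then have "conv_op (\<lambda>\<eta>. 1 / (\<eta> - \<omega>)) \<xi> = gser (\<lambda>m. Ln (1 - \<xi> / \<omega>) * ((\<xi> - \<omega>) ^ m / fact m) + pole_poly \<omega> m \<xi>) \<xi>"
    by (simp only: conv_op_def)
  also have "\<dots> = Ln (1 - \<xi> / \<omega>) * conv_ker \<xi> (\<xi> - \<omega>) + pole_rem \<omega> \<xi>"
    unfolding conv_ker_def pole_rem_def gser_cmult[OF s1, symmetric] by (rule gser_add[OF s1' s2])
  finally show ?thesis by (simp add: mult.commute)
qed

section \<open>The Borel transform near the origin\<close>

lemma Arg_cis_eq: "- pi < x \<Longrightarrow> x \<le> pi \<Longrightarrow> Arg (cis x) = x"
  by (rule cis_Arg_unique) simp_all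

lemma cis_eq_1_iff: "cis x = 1 \<longleftrightarrow> (\<exists>j::int. x = 2 * pi * of_int j)"
proof
  assume "cis x = 1"
  then have "cos x = 1" by (simp add: complex_eq_iff)
  then show "\<exists>j::int. x = 2 * pi * of_int j" unfolding cos_one_2pi_int by (auto simp: mult_ac)
qed auto

locale borel_data = root_of_unity \<Lambda> m0 for \<Lambda> m0 +
  fixes n0 :: nat and n0' :: int and z logz :: complex
  assumes \<Lambda>_eq: "\<Lambda> = cis (2 * pi * real n0 / real m0)"
    and cop: "coprime n0 m0" and inv: "[int n0 * n0' = 1] (mod int m0)"
    and z1: "norm z < 1" and logz: "exp logz = z"
begin

definition freq :: "int \<Rightarrow> real" where "freq k = 2 * pi * of_int k / real m0"

text \<open>The \<open>n\<close>-th roots of unity other than \<open>\<Lambda>\<close> are \<open>\<Lambda> * cis (2 * pi * k / (n * m0))\<close>, where \<open>k\<close>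
  is taken such that the angle lies in \<open>]- pi, pi]\<close>, well inside the disk of analyticity of the kernel.\<close>

definition freq_set :: "nat \<Rightarrow> int set" where
  "freq_set n = {k. k \<noteq> 0 \<and> int m0 dvd k + int n * int n0 \<and> - (int n * int m0) < 2 * k \<and> 2 * k \<le> int n * int m0}"

text \<open>The angle \<theta> = c / n of the overview, for any n; \<open>freq k\<close> is the
  number c.\<close>

definition theta_first_index :: "nat \<Rightarrow> int \<Rightarrow> complex" where "theta_first_index n k = of_real (freq k / real n)"

lemma freq_set_empty [simp]: "freq_set 0 = {}" by (auto simp: freq_set_def)

lemma freq_nonzero: "k \<noteq> 0 \<Longrightarrow> freq k \<noteq> 0" using m0 by (simp add: freq_def)

lemma freq_set_pos: "k \<in> freq_set n \<Longrightarrow> 0 < n" by (cases n) auto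

lemma freq_set_subset: "freq_set n \<subseteq> {- (int n * int m0)..int n * int m0}" by (auto simp: freq_set_def)

lemma finite_freq_set: "finite (freq_set n)" by (rule finite_subset[OF freq_set_subset]) simp

lemma freq_set_angle:
  assumes "k \<in> freq_set n"
  shows "- pi < freq k / real n" "freq k / real n \<le> pi" "freq k / real n \<noteq> 0"
proof -
  have n: "0 < real n" "0 < real m0" using freq_set_pos[OF assms] m0 by auto
  have "- (int n * int m0) < 2 * k" "2 * k \<le> int n * int m0" using assms by (auto simp: freq_set_def)
  then have "real_of_int (- (int n * int m0)) < real_of_int (2 * k)" "real_of_int (2 * k) \<le> real_of_int (int n * int m0)"
    by (simp_all only: of_int_less_iff of_int_le_iff)
  then have r: "- (real n * real m0) < 2 * real_of_int k" "2 * real_of_int k \<le> real n * real m0" by simp_all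
  define y where "y = 2 * real_of_int k / (real n * real m0)"
  have e: "freq k / real n = pi * y" by (simp add: freq_def y_def mult_ac)
  have "- 1 < y" "y \<le> 1" unfolding y_def using r n by (simp_all add: divide_simps)
  then show "- pi < freq k / real n" "freq k / real n \<le> pi"
    unfolding e using mult_strict_left_mono[of "- 1" y pi] mult_left_mono[of y 1 pi] by simp_all
  show "freq k / real n \<noteq> 0" using freq_nonzero n assms by (auto simp: freq_set_def)
qed

lemma theta_first_index_props:
  assumes "k \<in> freq_set n"
  shows "theta_first_index n k \<noteq> 0" "norm (theta_first_index n k) \<le> pi"
  using freq_set_angle[OF assms] by (auto simp: theta_first_index_def simp del: of_real_divide)

text \<open>The n-th power of \<open>\<Lambda> * cis (freq k / n)\<close> has angle
  \<open>2 * pi * (k + n * n0) / m0\<close>, so the divisibility condition says that it is 1. The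
  half-open range of angles makes k unique and is the range of the principal argument.\<close>

lemma bij_betw_freq_set:
  assumes n: "0 < n"
  shows "bij_betw (\<lambda>k. \<Lambda> * cis (freq k / real n)) (freq_set n) ({L. L ^ n = 1} - {\<Lambda>})"
  unfolding bij_betw_def
proof (intro conjI equalityI subsetI)
  have rn: "0 < real n" "0 < real m0" using n m0 by auto
  show "inj_on (\<lambda>k. \<Lambda> * cis (freq k / real n)) (freq_set n)"
  proof (rule inj_onI)
    fix k l assume k: "k \<in> freq_set n" and l: "l \<in> freq_set n" and e: "\<Lambda> * cis (freq k / real n) = \<Lambda> * cis (freq l / real n)"
    from e have "cis (freq k / real n) = cis (freq l / real n)" using \<Lambda>_ne_0 by simp
    then have "freq k / real n = freq l / real n"
      using Arg_cis_eq[OF freq_set_angle(1,2)[OF k]] Arg_cis_eq[OF freq_set_angle(1,2)[OF l]] by metis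
    then show "k = l" using rn by (simp add: freq_def)
  qed
  fix L assume "L \<in> (\<lambda>k. \<Lambda> * cis (freq k / real n)) ` freq_set n"
  then obtain k where k: "k \<in> freq_set n" and L: "L = \<Lambda> * cis (freq k / real n)" by auto
  obtain j where j: "k + int n * int n0 = int m0 * j" using k by (auto simp: freq_set_def elim: dvdE)
  have "real_of_int (k + int n * int n0) = real_of_int (int m0 * j)" using j by simp
  then have j': "real_of_int k + real n * real n0 = real m0 * real_of_int j" by simp
  have "L ^ n = cis (real n * (2 * pi * real n0 / real m0 + freq k / real n))"
    unfolding L \<Lambda>_eq cis_mult Complex.DeMoivre ..
  also have "real n * (2 * pi * real n0 / real m0 + freq k / real n) = 2 * pi * ((real_of_int k + real n * real n0) / real m0)"
    using rn by (simp add: freq_def field_simps)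
  also have "\<dots> = 2 * pi * of_int j" unfolding j' using rn by simp
  finally have "L ^ n = 1" by simp
  moreover have "L \<noteq> \<Lambda>"
  proof
    assume "L = \<Lambda>"
    then have "cis (freq k / real n) = cis 0" using L \<Lambda>_ne_0 by simp
    then show False
      using Arg_cis_eq[OF freq_set_angle(1,2)[OF k]] Arg_cis_eq[of 0] freq_set_angle(3)[OF k] by simp
  qed
  ultimately show "L \<in> {L. L ^ n = 1} - {\<Lambda>}" by simp
next
  have rn: "0 < real n" "0 < real m0" using n m0 by auto
  fix L assume L: "L \<in> {L. L ^ n = 1} - {\<Lambda>}"
  define x where "x = Arg (L / \<Lambda>)"
  have nL: "norm (L / \<Lambda>) = 1" using L norm_root_unity[of L n] n norm_\<Lambda> by (simp add: norm_divide)
  then have cx: "cis x = L / \<Lambda>" unfolding x_def by (subst cis_Arg) (auto simp: sgn_div_norm sgn_eq)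
  have x: "- pi < x" "x \<le> pi" unfolding x_def using Arg_bounded by auto
  have x0: "x \<noteq> 0" using cx L \<Lambda>_ne_0 by auto
  have "cis (real n * (2 * pi * real n0 / real m0 + x)) = (\<Lambda> * cis x) ^ n"
    unfolding \<Lambda>_eq cis_mult Complex.DeMoivre ..
  also have "\<dots> = 1" unfolding cx using L \<Lambda>_ne_0 by simp
  finally obtain j :: int where j: "real n * (2 * pi * real n0 / real m0 + x) = 2 * pi * of_int j"
    unfolding cis_eq_1_iff by blast
  define k where "k = j * int m0 - int n * int n0"
  have ckk: "freq k = real n * x"
  proof -
    have "real n * x = 2 * pi * of_int j - real n * (2 * pi * real n0 / real m0)" using j by (simp add: ring_distribs)
    also have "\<dots> = freq k" using rn by (simp add: freq_def k_def field_simps)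
    finally show ?thesis ..
  qed
  have "k \<in> freq_set n"
  proof -
    have k2: "2 * pi * of_int k = real m0 * (real n * x)" using ckk rn by (simp add: freq_def field_simps)
    have "real m0 * (real n * x) \<le> real m0 * (real n * pi)" using x rn by (intro mult_left_mono) auto
    then have "pi * (2 * of_int k) \<le> pi * (real n * real m0)" using k2 by (simp add: mult_ac)
    then have "real_of_int (2 * k) \<le> real_of_int (int n * int m0)" by simp
    moreover have "real m0 * (real n * (- pi)) < real m0 * (real n * x)" using x rn by (intro mult_strict_left_mono) auto
    then have "pi * (- (real n * real m0)) < pi * (2 * of_int k)" using k2 by (simp add: mult_ac)
    then have "- (real n * real m0) < 2 * of_int k" by (simp only: mult_less_cancel_left_pos[OF pi_gt_zero])
    then have "real_of_int (- (int n * int m0)) < real_of_int (2 * k)" by simp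
    moreover have "k \<noteq> 0" using ckk x0 rn by (auto simp: freq_def)
    moreover have "int m0 dvd k + int n * int n0" by (simp add: k_def)
    ultimately show ?thesis unfolding freq_set_def of_int_less_iff of_int_le_iff by simp
  qed
  moreover have "L = \<Lambda> * cis (freq k / real n)" using ckk cx \<Lambda>_ne_0 rn by simp
  ultimately show "L \<in> (\<lambda>k. \<Lambda> * cis (freq k / real n)) ` freq_set n" by blast
qed

definition mode :: "nat \<Rightarrow> int \<Rightarrow> complex \<Rightarrow> complex" where
  "mode n k \<xi> = exp (- \<i> / theta_first_index n k * \<xi>)"

text \<open>The summand contains \<open>v / n\<close>; since \<open>\<theta> * n = c\<close>, this
  is \<open>\<theta> * v / c\<close>, and \<open>exp (v * \<xi>)\<close> splits into the mode and
  the regular exponential in \<open>gker\<close>.\<close>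

lemma Phi_delta_freq_set:
  assumes "norm z * exp (real m0 * norm \<xi>) < 1"
  shows "Phi_delta \<Lambda> z \<xi> = (\<Sum>n. (\<Sum>k\<in>freq_set n. - \<Lambda> / of_real (freq k) * (mode n k \<xi> * gker \<xi> (theta_first_index n k))) * z ^ n)"
  unfolding Phi_delta_series[OF z1 assms]
proof (rule suminf_cong)
  fix n
  show "(\<Sum>L\<in>{L. L ^ n = 1} - {\<Lambda>}. - L * (\<Lambda> / (L - \<Lambda>)) * exp (\<Lambda> / (L - \<Lambda>) * \<xi>)) / of_nat n * z ^ n
     = (\<Sum>k\<in>freq_set n. - \<Lambda> / of_real (freq k) * (mode n k \<xi> * gker \<xi> (theta_first_index n k))) * z ^ n"
  proof (cases "n = 0")
    case False
    then have n: "0 < n" by simp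
    have "(\<Sum>L\<in>{L. L ^ n = 1} - {\<Lambda>}. - L * (\<Lambda> / (L - \<Lambda>)) * exp (\<Lambda> / (L - \<Lambda>) * \<xi>)) / of_nat n =
       (\<Sum>k\<in>freq_set n. (- (\<Lambda> * cis (freq k / real n)) * (\<Lambda> / (\<Lambda> * cis (freq k / real n) - \<Lambda>)) * exp (\<Lambda> / (\<Lambda> * cis (freq k / real n) - \<Lambda>) * \<xi>)) / of_nat n)"
      unfolding sum_divide_distrib by (rule sum.reindex_bij_betw[OF bij_betw_freq_set[OF n], symmetric])
    also have "\<dots> = (\<Sum>k\<in>freq_set n. - \<Lambda> / of_real (freq k) * (mode n k \<xi> * gker \<xi> (theta_first_index n k)))"
    proof (rule sum.cong[OF refl])
      fix k assume k: "k \<in> freq_set n"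
      let ?t = "theta_first_index n k"
      have t0: "?t \<noteq> 0" using theta_first_index_props[OF k] by simp
      have c: "cis (freq k / real n) = exp (\<i> * ?t)" by (simp add: cis_conv_exp theta_first_index_def)
      have "\<Lambda> * exp (\<i> * ?t) - \<Lambda> = \<Lambda> * (exp (\<i> * ?t) - 1)" by (simp add: algebra_simps)
      then have v: "\<Lambda> / (\<Lambda> * exp (\<i> * ?t) - \<Lambda>) = 1 / (exp (\<i> * ?t) - 1)" using \<Lambda>_ne_0 by simp
      have ex: "exp (1 / (exp (\<i> * ?t) - 1) * \<xi>) = mode n k \<xi> * exp (cot_rem ?t * \<xi>)"
        unfolding inverse_exp_minus_1[OF t0] mode_def by (simp only: distrib_right exp_add)
      have tn: "?t * of_nat n = of_real (freq k)" using n by (simp add: theta_first_index_def)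
      have "inv_exp_quot ?t / of_real (freq k) = 1 / (exp (\<i> * ?t) - 1) / of_nat n"
        unfolding inv_exp_quot_eq[OF t0] tn[symmetric] using t0 n by simp
      then have "- (\<Lambda> * exp (\<i> * ?t)) * (1 / (exp (\<i> * ?t) - 1)) * (mode n k \<xi> * exp (cot_rem ?t * \<xi>)) / of_nat n
         = - (\<Lambda> * exp (\<i> * ?t)) * (inv_exp_quot ?t / of_real (freq k)) * (mode n k \<xi> * exp (cot_rem ?t * \<xi>))" by simp
      also have "\<dots> = - \<Lambda> / of_real (freq k) * (mode n k \<xi> * gker \<xi> ?t)" by (simp add: gker_def mult_ac)
      finally show "(- (\<Lambda> * cis (freq k / real n)) * (\<Lambda> / (\<Lambda> * cis (freq k / real n) - \<Lambda>)) * exp (\<Lambda> / (\<Lambda> * cis (freq k / real n) - \<Lambda>) * \<xi>)) / of_nat n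
          = - \<Lambda> / of_real (freq k) * (mode n k \<xi> * gker \<xi> ?t)"
        unfolding c v ex .
    qed
    finally show ?thesis by simp
  qed simp
qed

lemma norm_inverse_freq_le: "k \<noteq> 0 \<Longrightarrow> norm (1 / of_real (freq k) :: complex) \<le> real m0"
proof -
  assume "k \<noteq> 0"
  then have "1 \<le> \<bar>real_of_int k\<bar>" by linarith
  then have "1 * 1 \<le> (2 * pi) * \<bar>real_of_int k\<bar>" using pi_gt3 by (intro mult_mono) auto
  then have "real m0 / (2 * pi * \<bar>real_of_int k\<bar>) \<le> real m0 / 1" by (intro divide_left_mono) auto
  then show ?thesis by (simp add: freq_def norm_divide norm_mult abs_mult)
qed

text \<open>The factor \<open>3 n m0\<close> bounds the number of elements of \<open>freq_set n\<close>.\<close>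

lemma norm_freq_set_sum_le:
  fixes a :: "int \<Rightarrow> complex"
  assumes "S \<subseteq> freq_set n" "\<And>k. k \<in> S \<Longrightarrow> norm (a k) \<le> B" "0 \<le> B"
  shows "norm (\<Sum>k\<in>S. 1 / of_real (freq k) * a k) \<le> 3 * real m0 * (real n * real m0) * B"
proof (cases "n = 0")
  case False
  have "norm (\<Sum>k\<in>S. 1 / of_real (freq k) * a k) \<le> of_nat (card S) * (real m0 * B)"
  proof (rule sum_norm_bound)
    fix k assume k: "k \<in> S"
    then have "k \<noteq> 0" using assms(1) by (auto simp: freq_set_def)
    then show "norm (1 / of_real (freq k) * a k) \<le> real m0 * B"
      unfolding norm_mult using assms(2)[OF k] by (intro mult_mono norm_inverse_freq_le) auto
  qed
  also have "\<dots> \<le> (3 * (real n * real m0)) * (real m0 * B)"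
  proof (rule mult_right_mono)
    have "card S \<le> card {- (int n * int m0)..int n * int m0}"
      using assms(1) freq_set_subset by (intro card_mono) auto
    also have "\<dots> = 2 * (n * m0) + 1" by (simp add: nat_add_distrib nat_mult_distrib)
    also have "\<dots> \<le> 3 * (n * m0)" using False m0 by simp
    finally have "real (card S) \<le> real (3 * (n * m0))" by (rule of_nat_mono)
    then show "real (card S) \<le> 3 * (real n * real m0)" by simp
  qed (use assms in auto)
  finally show ?thesis by (simp add: mult_ac)
qed (use assms in auto)

section \<open>The two parts of the double series near the origin\<close>

text \<open>The part of M with frequencies beyond K; \<open>mero_tail 0\<close> is M itself near the
  origin.\<close>

definition mero_tail :: "nat \<Rightarrow> complex \<Rightarrow> complex" where
  "mero_tail K \<xi> = (\<Sum>n. (\<Sum>k\<in>{k\<in>freq_set n. int K < \<bar>k\<bar>}. 1 / of_real (freq k) * mode n k \<xi>) * z ^ n)"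

definition entire_part :: "complex \<Rightarrow> complex" where
  "entire_part \<xi> = (\<Sum>n. (\<Sum>k\<in>freq_set n. 1 / of_real (freq k) * exp_rem (theta_first_index n k) \<xi>) * z ^ n)"

lemma summable_weight:
  assumes "0 \<le> r" "r < 1"
  shows "summable (\<lambda>n. 3 * real m0 * (real n * real m0) * C * r ^ n)"
proof -
  have "summable (\<lambda>n. (3 * real m0 * C) * ((real n * real m0) ^ 1 * r ^ n))"
    by (intro summable_mult summable_power_mult_geometric) (use assms in auto)
  then show ?thesis by (simp add: mult_ac)
qed

lemma entire_part_bound_terms:
  "\<exists>A b. 0 < A \<and> 0 < b \<and> (\<forall>n \<xi>. norm ((\<Sum>k\<in>freq_set n. 1 / of_real (freq k) * exp_rem (theta_first_index n k) \<xi>) * z ^ n)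
     \<le> 3 * real m0 * (real n * real m0) * (A * exp (b * norm \<xi>)) * norm z ^ n)"
proof -
  obtain A b where A: "0 < A" "0 < b" and P: "\<forall>\<theta> \<xi>. \<theta> \<noteq> 0 \<longrightarrow> norm \<theta> \<le> pi \<longrightarrow> norm (exp_rem \<theta> \<xi>) \<le> A * exp (b * norm \<xi>)"
    using exp_rem_bound by auto
  have "norm ((\<Sum>k\<in>freq_set n. 1 / of_real (freq k) * exp_rem (theta_first_index n k) \<xi>) * z ^ n)
     \<le> 3 * real m0 * (real n * real m0) * (A * exp (b * norm \<xi>)) * norm z ^ n" for n \<xi>
    unfolding norm_mult norm_power
    by (intro mult_right_mono norm_freq_set_sum_le) (use P theta_first_index_props A in auto)
  note r = this
  show ?thesis by (rule exI[of _ A], rule exI[of _ b]) (use r A in blast)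
qed

lemma entire_part_summable: "summable (\<lambda>n. (\<Sum>k\<in>freq_set n. 1 / of_real (freq k) * exp_rem (theta_first_index n k) \<xi>) * z ^ n)"
proof -
  obtain A b where "\<forall>n \<xi>. norm ((\<Sum>k\<in>freq_set n. 1 / of_real (freq k) * exp_rem (theta_first_index n k) \<xi>) * z ^ n)
     \<le> 3 * real m0 * (real n * real m0) * (A * exp (b * norm \<xi>)) * norm z ^ n" using entire_part_bound_terms by auto
  then show ?thesis
    by (intro summable_comparison_test'[OF summable_weight[of "norm z" "A * exp (b * norm \<xi>)"], of 0]) (use z1 in auto)
qed

lemma entire_part_bound: "\<exists>A b. 0 < A \<and> 0 < b \<and> (\<forall>\<xi>. norm (entire_part \<xi>) \<le> A * exp (b * norm \<xi>))"
proof -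
  obtain A b where A: "0 < A" "0 < b" and t: "\<forall>n \<xi>. norm ((\<Sum>k\<in>freq_set n. 1 / of_real (freq k) * exp_rem (theta_first_index n k) \<xi>) * z ^ n)
     \<le> 3 * real m0 * (real n * real m0) * (A * exp (b * norm \<xi>)) * norm z ^ n" using entire_part_bound_terms by auto
  define S where "S = (\<Sum>n. 3 * real m0 * (real n * real m0) * 1 * norm z ^ n)"
  have s: "summable (\<lambda>n. 3 * real m0 * (real n * real m0) * 1 * norm z ^ n)" by (rule summable_weight) (use z1 in auto)
  have S0: "0 \<le> S" unfolding S_def by (rule suminf_nonneg[OF s]) simp
  have "norm (entire_part \<xi>) \<le> (A * (S + 1)) * exp (b * norm \<xi>)" for \<xi>
  proof -
    have "norm (entire_part \<xi>) \<le> (\<Sum>n. (A * exp (b * norm \<xi>)) * (3 * real m0 * (real n * real m0) * 1 * norm z ^ n))"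
      unfolding entire_part_def
      by (rule norm_suminf_le[OF _ summable_mult[OF s]]) (use t in \<open>simp add: mult_ac\<close>)
    also have "\<dots> = (A * exp (b * norm \<xi>)) * S" unfolding S_def by (rule suminf_mult[OF s])
    also have "\<dots> \<le> (A * exp (b * norm \<xi>)) * (S + 1)" using A by (intro mult_left_mono) auto
    finally show ?thesis by (simp add: mult_ac)
  qed
  note r = this
  have p: "0 < A * (S + 1)" using A S0 by simp
  show ?thesis by (rule exI[of _ "A * (S + 1)"], rule exI[of _ b]) (use r p A in blast)
qed

lemma entire_part_holomorphic: "entire_part holomorphic_on UNIV"
  unfolding entire_part_def[abs_def]
proof (rule holomorphic_suminf)
  show "(\<lambda>\<xi>. (\<Sum>k\<in>freq_set n. 1 / of_real (freq k) * exp_rem (theta_first_index n k) \<xi>) * z ^ n) holomorphic_on UNIV" for n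
    by (intro holomorphic_intros exp_rem_holomorphic) (auto simp: freq_set_def freq_nonzero)
  fix x :: complex
  obtain A b where A: "0 < A" "0 < b" and t: "\<forall>n \<xi>. norm ((\<Sum>k\<in>freq_set n. 1 / of_real (freq k) * exp_rem (theta_first_index n k) \<xi>) * z ^ n)
     \<le> 3 * real m0 * (real n * real m0) * (A * exp (b * norm \<xi>)) * norm z ^ n" using entire_part_bound_terms by auto
  have "norm ((\<Sum>k\<in>freq_set n. 1 / of_real (freq k) * exp_rem (theta_first_index n k) y) * z ^ n)
      \<le> 3 * real m0 * (real n * real m0) * (A * exp (b * (norm x + 1))) * norm z ^ n" if "y \<in> cball x 1" for y n
  proof -
    have "norm y \<le> norm x + 1" using that norm_triangle_ineq2[of y x] by (simp add: dist_norm norm_minus_commute)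
    then have le: "A * exp (b * norm y) \<le> A * exp (b * (norm x + 1))" using A by simp
    have "3 * real m0 * (real n * real m0) * (A * exp (b * norm y)) * norm z ^ n \<le> 3 * real m0 * (real n * real m0) * (A * exp (b * (norm x + 1))) * norm z ^ n"
      by (intro mult_right_mono[OF mult_left_mono[OF le]]) auto
    then show ?thesis using t order.trans by blast
  qed
  moreover have "summable (\<lambda>n. 3 * real m0 * (real n * real m0) * (A * exp (b * (norm x + 1))) * norm z ^ n)"
    by (rule summable_weight) (use z1 in auto)
  ultimately show "\<exists>d>0. cball x d \<subseteq> UNIV \<and> (\<exists>B. summable B \<and> (\<forall>n. \<forall>y\<in>cball x d.
      norm ((\<Sum>k\<in>freq_set n. 1 / of_real (freq k) * exp_rem (theta_first_index n k) y) * z ^ n) \<le> B n))"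
    by (intro exI[of _ 1] conjI exI[of _ "\<lambda>n. 3 * real m0 * (real n * real m0) * (A * exp (b * (norm x + 1))) * norm z ^ n"]) auto
qed simp

lemma z0: "z \<noteq> 0" using logz by auto

text \<open>The frequency k contributes to M multiples of the powers
  \<open>mode_base k \<xi> ^ n\<close>; resummed, they have poles where this number is an m0-th root
  of unity.\<close>

definition mode_base :: "int \<Rightarrow> complex \<Rightarrow> complex" where
  "mode_base k \<xi> = z * exp (- \<i> / of_real (freq k) * \<xi>)"

lemma norm_mode_base_le: "norm (mode_base k \<xi>) \<le> norm z * exp (norm \<xi> / \<bar>freq k\<bar>)"
proof -
  have "norm (exp (- \<i> / of_real (freq k) * \<xi>)) \<le> exp (norm (- \<i> / of_real (freq k) * \<xi>))" by (rule norm_exp)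
  also have "norm (- \<i> / of_real (freq k) * \<xi>) = norm \<xi> / \<bar>freq k\<bar>" by (simp add: norm_mult norm_divide)
  finally show ?thesis by (simp add: mode_base_def norm_mult mult_left_mono)
qed

lemma mode_mode_base: "k \<in> freq_set n \<Longrightarrow> mode n k \<xi> * z ^ n = mode_base k \<xi> ^ n"
proof -
  assume "k \<in> freq_set n"
  then have n: "0 < n" by (rule freq_set_pos)
  have "- \<i> / theta_first_index n k * \<xi> = of_nat n * (- \<i> / of_real (freq k) * \<xi>)" using n by (simp add: theta_first_index_def)
  then show ?thesis unfolding mode_def mode_base_def power_mult_distrib by (simp only: exp_of_nat_mult mult.commute)
qed

text \<open>On the disk of radius R, the number \<rho> bounds the bases of all remaining frequencies
  simultaneously.\<close>

lemma mero_tail_term_bound: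
  assumes "0 \<le> \<rho>" "\<And>k. k \<noteq> 0 \<Longrightarrow> int K < \<bar>k\<bar> \<Longrightarrow> norm z * exp (R / \<bar>freq k\<bar>) \<le> \<rho>" "norm \<xi> \<le> R"
  shows "norm ((\<Sum>k\<in>{k\<in>freq_set n. int K < \<bar>k\<bar>}. 1 / of_real (freq k) * mode n k \<xi>) * z ^ n)
     \<le> 3 * real m0 * (real n * real m0) * 1 * \<rho> ^ n"
proof -
  have "norm (\<Sum>k\<in>{k\<in>freq_set n. int K < \<bar>k\<bar>}. 1 / of_real (freq k) * (mode n k \<xi> * z ^ n)) \<le> 3 * real m0 * (real n * real m0) * \<rho> ^ n"
  proof (rule norm_freq_set_sum_le)
    fix k assume k: "k \<in> {k\<in>freq_set n. int K < \<bar>k\<bar>}"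
    have "norm (mode_base k \<xi>) \<le> norm z * exp (norm \<xi> / \<bar>freq k\<bar>)" by (rule norm_mode_base_le)
    also have "\<dots> \<le> norm z * exp (R / \<bar>freq k\<bar>)" using assms(3) by (intro mult_left_mono) (auto intro!: divide_right_mono)
    also have "\<dots> \<le> \<rho>" using k by (intro assms(2)) (auto simp: freq_set_def)
    finally show "norm (mode n k \<xi> * z ^ n) \<le> \<rho> ^ n"
      using k by (subst mode_mode_base) (auto simp: norm_power intro!: power_mono)
  qed (use assms in auto)
  then show ?thesis by (simp add: sum_distrib_right mult.assoc)
qed

lemma mero_tail_summable:
  assumes "0 \<le> \<rho>" "\<rho> < 1" "\<And>k. k \<noteq> 0 \<Longrightarrow> int K < \<bar>k\<bar> \<Longrightarrow> norm z * exp (R / \<bar>freq k\<bar>) \<le> \<rho>" "norm \<xi> \<le> R"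
  shows "summable (\<lambda>n. (\<Sum>k\<in>{k\<in>freq_set n. int K < \<bar>k\<bar>}. 1 / of_real (freq k) * mode n k \<xi>) * z ^ n)"
  by (rule summable_comparison_test'[OF summable_weight[OF assms(1,2), of 1], of 0])
     (rule mero_tail_term_bound[OF assms(1,3,4)])

lemma mero_tail_bound:
  assumes "0 \<le> \<rho>" "\<rho> < 1" "\<And>k. k \<noteq> 0 \<Longrightarrow> int K < \<bar>k\<bar> \<Longrightarrow> norm z * exp (R / \<bar>freq k\<bar>) \<le> \<rho>" "norm \<xi> \<le> R"
  shows "norm (mero_tail K \<xi>) \<le> (\<Sum>n. 3 * real m0 * (real n * real m0) * 1 * \<rho> ^ n)"
  unfolding mero_tail_def by (rule norm_suminf_le[OF mero_tail_term_bound[OF assms(1,3,4)] summable_weight[OF assms(1,2)]])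

lemma mero_tail_holomorphic:
  assumes "0 \<le> \<rho>" "\<rho> < 1" "\<And>k. k \<noteq> 0 \<Longrightarrow> int K < \<bar>k\<bar> \<Longrightarrow> norm z * exp (R / \<bar>freq k\<bar>) \<le> \<rho>"
  shows "mero_tail K holomorphic_on ball 0 R"
  unfolding mero_tail_def[abs_def]
proof (rule holomorphic_suminf)
  show "(\<lambda>\<xi>. (\<Sum>k\<in>{k\<in>freq_set n. int K < \<bar>k\<bar>}. 1 / of_real (freq k) * mode n k \<xi>) * z ^ n) holomorphic_on ball 0 R" for n
    unfolding mode_def by (intro holomorphic_intros) (auto simp: freq_set_def freq_nonzero)
  fix x :: complex assume "x \<in> ball 0 R"
  then have "\<exists>d>0. cball x d \<subseteq> ball 0 R"
    using open_ball[of "0::complex" R] unfolding open_contains_cball by blast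
  then obtain d where d: "d > 0" "cball x d \<subseteq> ball 0 R" by blast
  have "norm ((\<Sum>k\<in>{k\<in>freq_set n. int K < \<bar>k\<bar>}. 1 / of_real (freq k) * mode n k y) * z ^ n) \<le> 3 * real m0 * (real n * real m0) * 1 * \<rho> ^ n"
    if "y \<in> cball x d" for n and y :: complex
    by (rule mero_tail_term_bound[OF assms(1,3)]) (use d that in \<open>auto simp: subset_iff less_imp_le\<close>)
  then show "\<exists>d>0. cball x d \<subseteq> ball 0 R \<and> (\<exists>B. summable B \<and> (\<forall>n. \<forall>y\<in>cball x d.
      norm ((\<Sum>k\<in>{k\<in>freq_set n. int K < \<bar>k\<bar>}. 1 / of_real (freq k) * mode n k y) * z ^ n) \<le> B n))"
    using d summable_weight[OF assms(1,2), of 1] by blast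
qed simp

text \<open>The bound \<rho> is \<open>sqrt (norm z)\<close>. One radius serves both the Borel
  series and all modes, because \<open>1 / \<bar>freq k\<bar>\<close> is at most m0.\<close>

lemma small_radius:
  obtains r \<rho> where "0 < r" "0 \<le> \<rho>" "\<rho> < 1" "norm z * exp (real m0 * r) \<le> \<rho>"
    "\<And>k. k \<noteq> 0 \<Longrightarrow> norm z * exp (r / \<bar>freq k\<bar>) \<le> \<rho>"
proof -
  have nz: "0 < norm z" using z0 by simp
  define r where "r = - ln (norm z) / 2 / real m0"
  have "ln (norm z) < 0" using nz z1 by simp
  then have r: "0 < r" unfolding r_def by (intro divide_pos_pos) (use m0 in auto)
  have "norm z * exp (real m0 * r) = exp (ln (norm z)) * exp (- ln (norm z) / 2)" using m0 nz by (simp add: r_def)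
  also have "\<dots> = exp (ln (norm z) / 2)" by (simp flip: exp_add)
  finally have e: "norm z * exp (real m0 * r) = exp (ln (norm z) / 2)" .
  show ?thesis
  proof (rule that[OF r])
    show "exp (ln (norm z) / 2) < 1" using nz z1 by simp
    show "norm z * exp (real m0 * r) \<le> exp (ln (norm z) / 2)" using e by simp
    fix k :: int assume "k \<noteq> 0"
    then have "1 / \<bar>freq k\<bar> \<le> real m0" using norm_inverse_freq_le[of k] by (simp add: norm_divide)
    then have "r * (1 / \<bar>freq k\<bar>) \<le> r * real m0" using r by (intro mult_left_mono) auto
    then have "norm z * exp (r / \<bar>freq k\<bar>) \<le> norm z * exp (real m0 * r)" by (intro mult_left_mono) (auto simp: mult.commute)
    then show "norm z * exp (r / \<bar>freq k\<bar>) \<le> exp (ln (norm z) / 2)" using e by simp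
  qed simp
qed

text \<open>Term by term this is the definition of \<open>exp_rem\<close>; the operator passes
  through the sum over n by uniform convergence on the segment.\<close>

lemma Phi_delta_conv_op:
  assumes r: "0 < r" "0 \<le> \<rho>" "\<rho> < 1" "norm z * exp (real m0 * r) \<le> \<rho>"
    "\<And>k. k \<noteq> 0 \<Longrightarrow> norm z * exp (r / \<bar>freq k\<bar>) \<le> \<rho>" and \<xi>: "norm \<xi> \<le> r"
  shows "Phi_delta \<Lambda> z \<xi> = - \<Lambda> * (gker_coeff 0 \<xi> * mero_tail 0 \<xi> + conv_op (mero_tail 0) \<xi> + entire_part \<xi>)"
proof -
  define g where "g n \<eta> = (\<Sum>k\<in>freq_set n. 1 / of_real (freq k) * mode n k \<eta>) * z ^ n" for n \<eta>
  have ks: "{k \<in> freq_set n. int 0 < \<bar>k\<bar>} = freq_set n" for n by (auto simp: freq_set_def)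
  have Mg: "mero_tail 0 = (\<lambda>\<eta>. \<Sum>n. g n \<eta>)" unfolding mero_tail_def[abs_def] ks g_def ..
  have c: "\<And>k. k \<noteq> 0 \<Longrightarrow> int 0 < \<bar>k\<bar> \<Longrightarrow> norm z * exp (r / \<bar>freq k\<bar>) \<le> \<rho>" using r(5) .
  have gb: "norm (g n \<eta>) \<le> 3 * real m0 * (real n * real m0) * 1 * \<rho> ^ n" if "norm \<eta> \<le> r" for n \<eta>
  proof -
    have "norm ((\<Sum>k\<in>{k \<in> freq_set n. int 0 < \<bar>k\<bar>}. 1 / of_real (freq k) * mode n k \<eta>) * z ^ n) \<le> 3 * real m0 * (real n * real m0) * 1 * \<rho> ^ n"
      by (rule mero_tail_term_bound[OF r(2) _ that]) (use c in auto)
    then show ?thesis by (simp only: ks g_def)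
  qed
  have "norm z * exp (real m0 * norm \<xi>) \<le> norm z * exp (real m0 * r)"
    using \<xi> by (intro mult_left_mono) (auto intro!: mult_left_mono)
  then have lt: "norm z * exp (real m0 * norm \<xi>) < 1" using r by linarith
  have cee: "continuous_on S (mode n k)" if "k \<in> freq_set n" for n k S
    unfolding mode_def by (intro continuous_intros)
  have gc: "continuous_on S (g n)" for n S
    unfolding g_def by (intro continuous_intros cee) (auto simp: freq_set_def freq_nonzero)
  have "(\<lambda>n. conv_op (g n) \<xi>) sums conv_op (\<lambda>\<eta>. \<Sum>n. g n \<eta>) \<xi>"
  proof (rule conv_op_sums[OF gc summable_weight[OF r(2,3)]])
    fix n x assume "x \<in> closed_segment 0 \<xi>"
    then have "norm x \<le> r" using segment_bound1[of x 0 \<xi>] \<xi> by simp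
    then show "norm (g n x) \<le> 3 * real m0 * (real n * real m0) * 1 * \<rho> ^ n" by (rule gb)
  qed
  then have s1: "(\<lambda>n. conv_op (g n) \<xi>) sums conv_op (mero_tail 0) \<xi>" unfolding Mg .
  have s2: "(\<lambda>n. gker_coeff 0 \<xi> * g n \<xi>) sums (gker_coeff 0 \<xi> * mero_tail 0 \<xi>)"
    unfolding Mg
    by (intro sums_mult summable_sums summable_comparison_test'[OF summable_weight[OF r(2,3), of 1], of 0])
       (rule gb[OF \<xi>])
  have s3: "(\<lambda>n. (\<Sum>k\<in>freq_set n. 1 / of_real (freq k) * exp_rem (theta_first_index n k) \<xi>) * z ^ n) sums entire_part \<xi>"
    unfolding entire_part_def by (rule summable_sums[OF entire_part_summable])
  from sums_mult[OF sums_add[OF sums_add[OF s2 s1] s3], of "- \<Lambda>"]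
  have S: "(\<lambda>n. - \<Lambda> * (gker_coeff 0 \<xi> * g n \<xi> + conv_op (g n) \<xi> + (\<Sum>k\<in>freq_set n. 1 / of_real (freq k) * exp_rem (theta_first_index n k) \<xi>) * z ^ n)) sums
     (- \<Lambda> * (gker_coeff 0 \<xi> * mero_tail 0 \<xi> + conv_op (mero_tail 0) \<xi> + entire_part \<xi>))" .
  have "- \<Lambda> * (gker_coeff 0 \<xi> * g n \<xi> + conv_op (g n) \<xi> + (\<Sum>k\<in>freq_set n. 1 / of_real (freq k) * exp_rem (theta_first_index n k) \<xi>) * z ^ n)
      = (\<Sum>k\<in>freq_set n. - \<Lambda> / of_real (freq k) * (mode n k \<xi> * gker \<xi> (theta_first_index n k))) * z ^ n" for n
  proof -
    have "conv_op (g n) \<xi> = conv_op (\<lambda>\<eta>. \<Sum>k\<in>freq_set n. (z ^ n / of_real (freq k)) * mode n k \<eta>) \<xi>"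
      by (rule conv_op_cong) (simp add: g_def sum_distrib_left sum_distrib_right mult_ac)
    also have "\<dots> = (\<Sum>k\<in>freq_set n. conv_op (\<lambda>\<eta>. (z ^ n / of_real (freq k)) * mode n k \<eta>) \<xi>)"
      by (rule conv_op_sum[OF finite_freq_set]) (intro continuous_intros cee)
    also have "\<dots> = (\<Sum>k\<in>freq_set n. (z ^ n / of_real (freq k)) * conv_op (mode n k) \<xi>)"
      by (intro sum.cong refl conv_op_cmult cee)
    finally have T: "conv_op (g n) \<xi> = \<dots>" .
    have P: "mode n k \<xi> * gker \<xi> (theta_first_index n k) = gker_coeff 0 \<xi> * mode n k \<xi> + conv_op (mode n k) \<xi> + exp_rem (theta_first_index n k) \<xi>" for k
      by (simp add: exp_rem_def mode_def[abs_def])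
    show ?thesis
      unfolding T g_def P
      by (simp add: sum_distrib_left sum_distrib_right sum.distrib[symmetric] sum_negf[symmetric])
         (intro sum.cong refl, simp add: field_simps add_divide_distrib)
  qed
  with S show ?thesis unfolding Phi_delta_freq_set[OF lt] by (simp add: sums_iff)
qed

section \<open>Geometric resummation at a fixed frequency\<close>

definition first_index :: "int \<Rightarrow> nat" where "first_index k = (LEAST n. k \<in> freq_set n)"

text \<open>The divisibility condition is solved by \<open>- k * n0'\<close> modulo m0, and adding
  \<open>m0 * (2 * \<bar>k\<bar> + 1)\<close> enforces the bounds on the angle. That n is linear in
  \<open>\<bar>k\<bar>\<close> keeps \<open>first_index k / \<bar>freq k\<bar>\<close> bounded, as
  the growth estimate requires.\<close>

lemma ex_freq_set:
  assumes "k \<noteq> 0"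
  shows "\<exists>n. k \<in> freq_set n \<and> n \<le> m0 * (2 * nat \<bar>k\<bar> + 2)"
proof -
  have m: "0 < int m0" using m0 by simp
  define n where "n = nat ((- k * n0') mod int m0) + m0 * (2 * nat \<bar>k\<bar> + 1)"
  have r: "0 \<le> (- k * n0') mod int m0" "(- k * n0') mod int m0 < int m0" using m by auto
  have nn: "int n = (- k * n0') mod int m0 + int m0 * (2 * \<bar>k\<bar> + 1)" using r by (simp add: n_def ring_distribs)
  have "[int n = - k * n0'] (mod int m0)" unfolding nn cong_def by simp
  then have "[k + int n * int n0 = k + (- k * n0') * int n0] (mod int m0)"
    by (intro cong_add cong_mult cong_refl)
  also have "k + (- k * n0') * int n0 = k * (1 - int n0 * n0')" by (simp add: algebra_simps)
  also have "[k * (1 - int n0 * n0') = k * (1 - 1)] (mod int m0)"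
    by (intro cong_mult cong_diff cong_refl inv)
  finally have d: "int m0 dvd k + int n * int n0" by (simp add: cong_0_iff)
  have "1 * (2 * \<bar>k\<bar> + 1) \<le> int m0 * (2 * \<bar>k\<bar> + 1)" using m by (intro mult_right_mono) auto
  then have n1: "2 * \<bar>k\<bar> + 1 \<le> int n" unfolding nn mult_1 using r(1) by (rule order.trans[OF _ add_increasing[OF _ order.refl]])
  have "int n * 1 \<le> int n * int m0" using m by (intro mult_left_mono) auto
  then have "2 * \<bar>k\<bar> + 1 \<le> int n * int m0" using n1 by linarith
  then have "k \<in> freq_set n" using d assms by (auto simp: freq_set_def)
  moreover have "int n \<le> int (m0 * (2 * nat \<bar>k\<bar> + 2))" using nn r by (simp add: algebra_simps)
  then have "n \<le> m0 * (2 * nat \<bar>k\<bar> + 2)" by (simp only: of_nat_le_iff)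
  ultimately show ?thesis by blast
qed

lemma first_index_freq_set: "k \<noteq> 0 \<Longrightarrow> k \<in> freq_set (first_index k)"
  unfolding first_index_def by (rule LeastI_ex) (use ex_freq_set in blast)

lemma first_index_le:
  assumes "k \<noteq> 0"
  shows "first_index k \<le> m0 * (2 * nat \<bar>k\<bar> + 2)"
proof -
  obtain n where n: "k \<in> freq_set n" "n \<le> m0 * (2 * nat \<bar>k\<bar> + 2)" using ex_freq_set[OF assms] by blast
  have "first_index k \<le> n" unfolding first_index_def using n(1) by (rule Least_le)
  then show ?thesis using n(2) by linarith
qed

text \<open>The residue class of the first index is what brings \<open>n0'\<close> into the
  coefficients at the poles.\<close>

lemma first_index_cong:
  assumes "k \<noteq> 0"
  shows "[int (first_index k) = - k * n0'] (mod int m0)"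
proof -
  have "int m0 dvd k + int (first_index k) * int n0" using first_index_freq_set[OF assms] by (simp add: freq_set_def)
  then have "[k + int (first_index k) * int n0 = 0] (mod int m0)" by (simp add: cong_0_iff)
  then have "[(k + int (first_index k) * int n0) * n0' = 0 * n0'] (mod int m0)" by (intro cong_mult cong_refl)
  then have a: "[k * n0' + int (first_index k) * (int n0 * n0') = 0] (mod int m0)" by (simp add: algebra_simps)
  have "[k * n0' + int (first_index k) * (int n0 * n0') = k * n0' + int (first_index k) * 1] (mod int m0)"
    by (intro cong_add cong_mult cong_refl inv)
  then have "[k * n0' + int (first_index k) * 1 = 0] (mod int m0)" using a cong_sym cong_trans by blast
  then have "[k * n0' + int (first_index k) * 1 - k * n0' = 0 - k * n0'] (mod int m0)" by (intro cong_diff cong_refl)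
  then show ?thesis by simp
qed

text \<open>Divisibility fixes n modulo m0 because n0 is invertible there, and the bounds on the
  angle persist when n grows.\<close>

lemma freq_set_progression:
  assumes "k \<noteq> 0"
  shows "k \<in> freq_set n \<longleftrightarrow> n \<in> range (\<lambda>j. first_index k + m0 * j)"
proof
  assume n: "k \<in> freq_set n"
  have le: "first_index k \<le> n" unfolding first_index_def using n by (rule Least_le)
  have "int m0 dvd (k + int n * int n0) - (k + int (first_index k) * int n0)"
    using n first_index_freq_set[OF assms] by (intro dvd_diff) (auto simp: freq_set_def)
  also have "(k + int n * int n0) - (k + int (first_index k) * int n0) = int ((n - first_index k) * n0)"
    using le by (simp add: of_nat_diff algebra_simps)
  finally have "m0 dvd (n - first_index k) * n0" by (simp only: int_dvd_int_iff)
  moreover have "coprime m0 n0" using cop by (simp add: coprime_commute)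
  ultimately have "m0 dvd n - first_index k" by (simp add: coprime_dvd_mult_left_iff)
  then obtain j where "n - first_index k = m0 * j" by (elim dvdE)
  then have "n = first_index k + m0 * j" using le by simp
  then show "n \<in> range (\<lambda>j. first_index k + m0 * j)" by blast
next
  assume "n \<in> range (\<lambda>j. first_index k + m0 * j)"
  then obtain j where n: "n = first_index k + m0 * j" by auto
  have k: "k \<in> freq_set (first_index k)" by (rule first_index_freq_set[OF assms])
  have "int m0 dvd (k + int (first_index k) * int n0) + int m0 * (int j * int n0)"
    by (rule dvd_add[OF _ dvd_triv_left]) (use k in \<open>simp add: freq_set_def\<close>)
  also have "(k + int (first_index k) * int n0) + int m0 * (int j * int n0) = k + int n * int n0"
    by (simp add: n algebra_simps)
  finally have "int m0 dvd k + int n * int n0" .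
  moreover have "int (first_index k) * int m0 \<le> int n * int m0" by (intro mult_right_mono) (auto simp: n)
  ultimately show "k \<in> freq_set n" using k unfolding freq_set_def by auto
qed

text \<open>The sum of the geometric series with first exponent \<open>first_index k\<close> and
  step m0, continued to all \<xi> outside its poles.\<close>

definition mode_sum :: "int \<Rightarrow> complex \<Rightarrow> complex" where
  "mode_sum k \<xi> = mode_base k \<xi> ^ first_index k / (1 - mode_base k \<xi> ^ m0)"

text \<open>The meromorphic continuation of M to a disk on which the tail beyond K converges; near 0
  its value does not depend on K.\<close>

definition mero_sum :: "nat \<Rightarrow> complex \<Rightarrow> complex" where
  "mero_sum K \<xi> = (\<Sum>k\<in>{- int K..int K} - {0}. 1 / of_real (freq k) * mode_sum k \<xi>) + mero_tail K \<xi>"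

lemma mode_sum_sums:
  assumes k: "k \<noteq> 0" and W: "norm (mode_base k \<xi>) < 1"
  shows "(\<lambda>n. if k \<in> freq_set n then mode_base k \<xi> ^ n else 0) sums mode_sum k \<xi>"
proof -
  have "(\<lambda>j. (mode_base k \<xi> ^ m0) ^ j) sums (1 / (1 - mode_base k \<xi> ^ m0))"
    by (rule geometric_sums) (use W m0 in \<open>simp add: norm_power power_less_one_iff\<close>)
  then have "(\<lambda>j. mode_base k \<xi> ^ first_index k * (mode_base k \<xi> ^ m0) ^ j) sums (mode_base k \<xi> ^ first_index k * (1 / (1 - mode_base k \<xi> ^ m0)))"
    by (rule sums_mult)
  then have "(\<lambda>j. mode_base k \<xi> ^ (first_index k + m0 * j)) sums mode_sum k \<xi>" by (simp add: mode_sum_def power_add power_mult)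
  moreover have "(if k \<in> freq_set (first_index k + m0 * j) then mode_base k \<xi> ^ (first_index k + m0 * j) else 0) = mode_base k \<xi> ^ (first_index k + m0 * j)" for j
    using freq_set_progression[OF k] by auto
  ultimately have "(\<lambda>j. if k \<in> freq_set (first_index k + m0 * j) then mode_base k \<xi> ^ (first_index k + m0 * j) else 0) sums mode_sum k \<xi>" by simp
  then show ?thesis
  proof (subst (asm) sums_mono_reindex)
    show "strict_mono (\<lambda>j. first_index k + m0 * j)" using m0 by (simp add: strict_mono_def)
    show "(if k \<in> freq_set n then mode_base k \<xi> ^ n else 0) = 0" if "n \<notin> range (\<lambda>j. first_index k + m0 * j)" for n
      using that freq_set_progression[OF k] by simp
  qed
qed

text \<open>Only finitely many frequencies are summed over n separately, so the rearrangement is the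
  addition of finitely many convergent series.\<close>

lemma mero_tail_0_eq_mero_sum:
  assumes r: "0 \<le> \<rho>" "\<rho> < 1" "\<And>k. k \<noteq> 0 \<Longrightarrow> norm z * exp (r / \<bar>freq k\<bar>) \<le> \<rho>" and \<xi>: "norm \<xi> \<le> r"
  shows "mero_tail 0 \<xi> = mero_sum K \<xi>"
proof -
  let ?I = "{- int K..int K} - {0}"
  have W: "norm (mode_base k \<xi>) < 1" if "k \<noteq> 0" for k
  proof -
    have "norm (mode_base k \<xi>) \<le> norm z * exp (norm \<xi> / \<bar>freq k\<bar>)" by (rule norm_mode_base_le)
    also have "\<dots> \<le> norm z * exp (r / \<bar>freq k\<bar>)" using \<xi> by (intro mult_left_mono) (auto intro!: divide_right_mono)
    finally show ?thesis using r that by fastforce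
  qed
  have s1: "(\<lambda>n. \<Sum>k\<in>?I. 1 / of_real (freq k) * (if k \<in> freq_set n then mode_base k \<xi> ^ n else 0)) sums (\<Sum>k\<in>?I. 1 / of_real (freq k) * mode_sum k \<xi>)"
    by (intro sums_sum sums_mult mode_sum_sums W) auto
  have s2: "(\<lambda>n. (\<Sum>k\<in>{k\<in>freq_set n. int K < \<bar>k\<bar>}. 1 / of_real (freq k) * mode n k \<xi>) * z ^ n) sums mero_tail K \<xi>"
    unfolding mero_tail_def by (rule summable_sums[OF mero_tail_summable[OF r(1,2) _ \<xi>]]) (use r in auto)
  have eq: "(\<Sum>k\<in>?I. 1 / of_real (freq k) * (if k \<in> freq_set n then mode_base k \<xi> ^ n else 0))
      + (\<Sum>k\<in>{k\<in>freq_set n. int K < \<bar>k\<bar>}. 1 / of_real (freq k) * mode n k \<xi>) * z ^ n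
      = (\<Sum>k\<in>{k\<in>freq_set n. int 0 < \<bar>k\<bar>}. 1 / of_real (freq k) * mode n k \<xi>) * z ^ n" for n
  proof -
    let ?f = "\<lambda>k. 1 / of_real (freq k) * mode_base k \<xi> ^ n"
    have e: "(\<Sum>k\<in>S. 1 / of_real (freq k) * mode n k \<xi>) * z ^ n = (\<Sum>k\<in>S. ?f k)" if "S \<subseteq> freq_set n" for S
      unfolding sum_distrib_right by (rule sum.cong[OF refl]) (use that mode_mode_base[of _ n \<xi>] in \<open>auto simp: mult.assoc\<close>)
    have "(\<Sum>k\<in>?I. 1 / of_real (freq k) * (if k \<in> freq_set n then mode_base k \<xi> ^ n else 0)) = (\<Sum>k\<in>?I. if k \<in> freq_set n then ?f k else 0)"
      by (intro sum.cong) auto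
    also have "\<dots> = (\<Sum>k\<in>?I \<inter> {k. k \<in> freq_set n}. ?f k)" by (subst sum.inter_restrict) auto
    also have "?I \<inter> {k. k \<in> freq_set n} = {k\<in>freq_set n. \<bar>k\<bar> \<le> int K}" by (auto simp: freq_set_def)
    finally have 1: "(\<Sum>k\<in>?I. 1 / of_real (freq k) * (if k \<in> freq_set n then mode_base k \<xi> ^ n else 0)) = (\<Sum>k\<in>{k\<in>freq_set n. \<bar>k\<bar> \<le> int K}. ?f k)" .
    have "{k\<in>freq_set n. \<bar>k\<bar> \<le> int K} \<union> {k\<in>freq_set n. int K < \<bar>k\<bar>} = {k\<in>freq_set n. int 0 < \<bar>k\<bar>}" by (auto simp: freq_set_def)
    moreover have "(\<Sum>k\<in>{k\<in>freq_set n. \<bar>k\<bar> \<le> int K} \<union> {k\<in>freq_set n. int K < \<bar>k\<bar>}. ?f k)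
       = (\<Sum>k\<in>{k\<in>freq_set n. \<bar>k\<bar> \<le> int K}. ?f k) + (\<Sum>k\<in>{k\<in>freq_set n. int K < \<bar>k\<bar>}. ?f k)"
      by (rule sum.union_disjoint) (use finite_freq_set in auto)
    moreover have "(\<Sum>k\<in>{k\<in>freq_set n. int K < \<bar>k\<bar>}. 1 / of_real (freq k) * mode n k \<xi>) * z ^ n = (\<Sum>k\<in>{k\<in>freq_set n. int K < \<bar>k\<bar>}. ?f k)"
      "(\<Sum>k\<in>{k\<in>freq_set n. int 0 < \<bar>k\<bar>}. 1 / of_real (freq k) * mode n k \<xi>) * z ^ n = (\<Sum>k\<in>{k\<in>freq_set n. int 0 < \<bar>k\<bar>}. ?f k)"
      by (rule e, blast)+
    ultimately show ?thesis unfolding 1 by simp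
  qed
  from sums_add[OF s1 s2] have "(\<lambda>n. (\<Sum>k\<in>{k\<in>freq_set n. int 0 < \<bar>k\<bar>}. 1 / of_real (freq k) * mode n k \<xi>) * z ^ n) sums mero_sum K \<xi>"
    unfolding eq mero_sum_def .
  then show ?thesis unfolding mero_tail_def by (rule sums_unique[symmetric])
qed

end

section \<open>The moving singular points\<close>

text \<open>Riemann's removability criterion at one point after the other; the function changes at
  each step, so the induction ranges over f.\<close>

lemma holomorphic_extend_finite:
  assumes "finite F" "open S" "f holomorphic_on S - F"
    and "\<And>x. x \<in> F \<Longrightarrow> ((\<lambda>w. (w - x) * f w) \<longlongrightarrow> 0) (at x)" and "F \<subseteq> S"
  shows "\<exists>g. g holomorphic_on S \<and> (\<forall>w\<in>S - F. g w = f w)"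
  using assms
proof (induction F arbitrary: f)
  case empty
  then show ?case by auto
next
  case (insert x F)
  have op: "open (S - F)" using insert.hyps(1) insert.prems(1) by (simp add: finite_imp_closed open_Diff)
  have "\<exists>g1. g1 holomorphic_on S - F \<and> (\<forall>w\<in>S - F - {x}. g1 w = f w)"
  proof -
    have True: "x \<in> S" using insert.prems(4) by simp
    have hol: "f holomorphic_on (S - F) - {x}" 
    proof -
      have "S - insert x F = S - F - {x}" by blast
      then show ?thesis using insert.prems(2) by (simp only:)
    qed
    have "x \<in> interior (S - F)" using True insert.hyps(2) op by (simp add: interior_open)
    moreover have "((\<lambda>w. (w - x) * f w) \<longlongrightarrow> 0) (at x)" by (rule insert.prems(3)) simp
    ultimately show ?thesis using holomorphic_on_extend_lim[OF hol] by blast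
  qed
  then obtain g1 where g1: "g1 holomorphic_on S - F" "\<And>w. w \<in> S - F - {x} \<Longrightarrow> g1 w = f w" by blast
  have lim: "((\<lambda>w. (w - y) * g1 w) \<longlongrightarrow> 0) (at y)" if yF: "y \<in> F" for y
  proof (rule Lim_transform_eventually)
    have y: "y \<in> F" "y \<in> S" using yF insert.prems(4) by auto
    show "((\<lambda>w. (w - y) * f w) \<longlongrightarrow> 0) (at y)" using insert.prems(3) y by simp
    have "open (S - insert x F - {y} \<union> {y})"
    proof -
      have "open (S - (insert x F - {y}))" using insert.hyps(1) insert.prems(1) by (simp add: finite_imp_closed open_Diff)
      also have "S - (insert x F - {y}) = S - insert x F - {y} \<union> {y}" using y by auto
      finally show ?thesis .
    qed
    then have "\<forall>\<^sub>F w in at y. w \<in> S - insert x F"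
      unfolding eventually_at_topological using y by (intro exI[of _ "S - insert x F - {y} \<union> {y}"]) auto
    then show "\<forall>\<^sub>F w in at y. (w - y) * f w = (w - y) * g1 w"
      by eventually_elim (use g1(2) in auto)
  qed
  from insert.IH[OF insert.prems(1) g1(1) lim] insert.prems(4)
  obtain g where "g holomorphic_on S" "\<And>w. w \<in> S - F \<Longrightarrow> g w = g1 w" by auto
  then show ?case using g1(2) by (intro exI[of _ g]) auto
qed

context borel_data begin

definition sing_pt :: "int \<Rightarrow> int \<Rightarrow> complex" where
  "sing_pt a b = of_real (freq a) * (- \<i> * logz + of_real (2 * pi * of_int b / real m0))"

definition sing_pts :: "complex set" where "sing_pts = {sing_pt a b | a b. a \<noteq> 0}"

definition sing_coeff :: "int \<Rightarrow> int \<Rightarrow> complex" where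
  "sing_coeff a b = 1 / of_nat m0 * exp (2 * of_real pi * \<i> * of_int a * of_int b * of_int n0' / of_nat m0)"

text \<open>The germ needs its coefficients indexed by the points themselves; the choice is
  unambiguous because the point determines a and b.\<close>

definition sing_weight :: "complex \<Rightarrow> complex" where
  "sing_weight \<omega> = (SOME c. \<exists>a b. a \<noteq> 0 \<and> \<omega> = sing_pt a b \<and> c = sing_coeff a b)"

lemma Re_logz: "Re logz < 0"
proof -
  have "norm z = exp (Re logz)" using logz by (metis norm_exp_eq_Re)
  then show ?thesis using z1 by simp
qed

text \<open>Since \<open>norm z < 1\<close>, \<open>Re logz\<close> is negative, so the imaginary
  part alone determines a. Injectivity, finiteness in disks and the absence of 0 all start from
  this.\<close>

lemma Im_sing_pt: "Im (sing_pt a b) = freq a * (- Re logz)"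
  by (simp add: sing_pt_def)

lemma sing_pt_inj:
  assumes "sing_pt a b = sing_pt a' b'" "a \<noteq> 0"
  shows "a = a'" "b = b'"
proof -
  have "freq a * (- Re logz) = freq a' * (- Re logz)" using Im_sing_pt assms(1) by metis
  then have "freq a = freq a'" using Re_logz by simp
  then show a: "a = a'" using m0 by (simp add: freq_def)
  have "of_real (2 * pi * of_int b / real m0) = (of_real (2 * pi * of_int b' / real m0) :: complex)"
    using assms freq_nonzero[OF assms(2)] unfolding sing_pt_def a[symmetric] by simp
  then have "2 * pi * of_int b / real m0 = 2 * pi * of_int b' / real m0" by (simp only: of_real_eq_iff)
  then show "b = b'" using m0 by simp
qed

lemma sing_weight_sing_pt:
  assumes "a \<noteq> 0"
  shows "sing_weight (sing_pt a b) = sing_coeff a b"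
  unfolding sing_weight_def
proof (rule some_equality)
  show "\<exists>a' b'. a' \<noteq> 0 \<and> sing_pt a b = sing_pt a' b' \<and> sing_coeff a b = sing_coeff a' b'" using assms by auto
  fix c assume "\<exists>a' b'. a' \<noteq> 0 \<and> sing_pt a b = sing_pt a' b' \<and> c = sing_coeff a' b'"
  then obtain a' b' where "sing_pt a b = sing_pt a' b'" "c = sing_coeff a' b'" by auto
  then show "c = sing_coeff a b" using sing_pt_inj[OF _ assms, of b a' b'] by simp
qed

lemma sing_pts_0: "0 \<notin> sing_pts"
proof
  assume "0 \<in> sing_pts"
  then obtain a b where "a \<noteq> 0" "sing_pt a b = 0" unfolding sing_pts_def by auto
  then have "freq a * (- Re logz) = 0" using Im_sing_pt[of a b] by simp
  then show False using freq_nonzero[OF \<open>a \<noteq> 0\<close>] Re_logz by simp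
qed

lemma abs_freq_ge: "\<bar>of_int k\<bar> / real m0 \<le> \<bar>freq k\<bar>"
proof -
  have "1 * \<bar>real_of_int k\<bar> \<le> (2 * pi) * \<bar>real_of_int k\<bar>" using pi_gt3 by (intro mult_right_mono) auto
  then have "\<bar>real_of_int k\<bar> / real m0 \<le> (2 * pi) * \<bar>real_of_int k\<bar> / real m0" by (intro divide_right_mono) auto
  then show ?thesis by (simp add: freq_def abs_mult)
qed

lemma finite_sing_pts: "finite (sing_pts \<inter> ball 0 R)"
proof -
  \<comment> \<open>The imaginary part bounds a; then, \<open>\<bar>freq a\<bar>\<close> being at
    least \<open>1 / m0\<close>, the other factor and with it b is bounded.\<close>
  define N1 where "N1 = \<lceil>R * real m0 / (- Re logz)\<rceil>"
  define N2 where "N2 = \<lceil>(R * real m0 + norm logz) * real m0\<rceil>"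
  have "sing_pts \<inter> ball 0 R \<subseteq> (\<lambda>(a, b). sing_pt a b) ` ({- N1..N1} \<times> {- N2..N2})"
  proof
    fix \<omega> assume "\<omega> \<in> sing_pts \<inter> ball 0 R"
    then obtain a b where ab: "a \<noteq> 0" "\<omega> = sing_pt a b" "norm (sing_pt a b) < R" by (auto simp: sing_pts_def)
    have "\<bar>freq a\<bar> * (- Re logz) = \<bar>Im (sing_pt a b)\<bar>" unfolding Im_sing_pt abs_mult using Re_logz by simp
    also have "\<dots> \<le> R" using abs_Im_le_cmod[of "sing_pt a b"] ab(3) by linarith
    finally have "\<bar>freq a\<bar> * (- Re logz) \<le> R" .
    then have "\<bar>of_int a\<bar> / real m0 * (- Re logz) \<le> R"
      using mult_right_mono[OF abs_freq_ge[of a], of "- Re logz"] Re_logz by linarith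
    then have "\<bar>real_of_int a\<bar> \<le> R * real m0 / (- Re logz)" using m0 Re_logz by (simp add: field_simps)
    then have "real_of_int \<bar>a\<bar> \<le> real_of_int N1" unfolding N1_def by linarith
    then have a: "a \<in> {- N1..N1}" by simp linarith
    have "1 / real m0 \<le> \<bar>freq a\<bar>"
    proof -
      have "1 \<le> \<bar>real_of_int a\<bar>" using ab(1) by linarith
      then have "1 / real m0 \<le> \<bar>real_of_int a\<bar> / real m0" by (intro divide_right_mono) auto
      then show ?thesis using abs_freq_ge[of a] by linarith
    qed
    moreover define X where "X = norm (- \<i> * logz + of_real (2 * pi * of_int b / real m0))"
    ultimately have "1 / real m0 * X \<le> \<bar>freq a\<bar> * X" by (intro mult_right_mono) auto
    also have "\<dots> = norm (sing_pt a b)" by (simp only: X_def sing_pt_def norm_mult norm_of_real)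
    finally have "real m0 * (1 / real m0 * X) \<le> real m0 * R" using ab(3) by (intro mult_left_mono) auto
    then have "X \<le> R * real m0" using m0 by (simp add: mult.commute)
    then have "norm (- \<i> * logz + of_real (2 * pi * of_int b / real m0)) \<le> R * real m0" by (simp only: X_def)
    moreover have "norm (of_real (2 * pi * of_int b / real m0) :: complex) \<le> norm (- \<i> * logz + of_real (2 * pi * of_int b / real m0)) + norm (- \<i> * logz)"
      using norm_triangle_ineq4[of "- \<i> * logz + of_real (2 * pi * of_int b / real m0)" "- \<i> * logz"] by simp
    ultimately have "\<bar>2 * pi * of_int b / real m0\<bar> \<le> R * real m0 + norm logz" by (simp only: norm_of_real) (simp add: norm_mult)
    moreover have "\<bar>of_int b\<bar> / real m0 \<le> \<bar>2 * pi * of_int b / real m0\<bar>" using abs_freq_ge[of b] by (simp add: freq_def)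
    ultimately have "\<bar>real_of_int b\<bar> / real m0 \<le> R * real m0 + norm logz" by linarith
    then have "\<bar>real_of_int b\<bar> \<le> (R * real m0 + norm logz) * real m0" using m0 by (simp add: field_simps)
    then have "real_of_int \<bar>b\<bar> \<le> real_of_int N2" unfolding N2_def by linarith
    then have b: "b \<in> {- N2..N2}" by simp linarith
    show "\<omega> \<in> (\<lambda>(a, b). sing_pt a b) ` ({- N1..N1} \<times> {- N2..N2})" using a b ab(2) by auto
  qed
  then show ?thesis by (rule finite_subset) simp
qed

lemma mode_base_exp: "mode_base k \<xi> = exp (logz - \<i> / of_real (freq k) * \<xi>)"
proof -
  have "mode_base k \<xi> = exp logz * exp (- \<i> / of_real (freq k) * \<xi>)" by (simp only: mode_base_def logz)
  also have "\<dots> = exp (logz + - \<i> / of_real (freq k) * \<xi>)" by (simp only: exp_add)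
  finally show ?thesis by simp
qed

text \<open>This locates the poles of \<open>mode_sum k\<close>: the logarithms of 1 are the numbers
  \<open>2 * pi * \<i> * n\<close>, and n corresponds to \<open>b = - n\<close>.\<close>

lemma mode_base_pow_eq_1_iff:
  assumes k: "k \<noteq> 0"
  shows "mode_base k \<xi> ^ m0 = 1 \<longleftrightarrow> (\<exists>b. \<xi> = sing_pt k b)"
proof -
  have c: "complex_of_real (freq k) \<noteq> 0" using freq_nonzero[OF k] by simp
  have m: "(of_nat m0 :: complex) \<noteq> 0" using m0 by simp
  have "mode_base k \<xi> ^ m0 = 1 \<longleftrightarrow> (\<exists>n::int. of_nat m0 * (logz - \<i> / of_real (freq k) * \<xi>) = of_int (2 * n) * of_real pi * \<i>)"
  proof -
    have "mode_base k \<xi> ^ m0 = exp (of_nat m0 * (logz - \<i> / of_real (freq k) * \<xi>))" unfolding mode_base_exp by (simp add: exp_of_nat_mult)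
    then show ?thesis using exp_eq[of "of_nat m0 * (logz - \<i> / of_real (freq k) * \<xi>)" 0] by simp
  qed
  also have "\<dots> \<longleftrightarrow> (\<exists>b. \<xi> = sing_pt k b)"
  proof -
    have *: "of_nat m0 * (logz - \<i> / of_real (freq k) * \<xi>) = of_int (2 * n) * of_real pi * \<i> \<longleftrightarrow> \<xi> = sing_pt k (- n)" for n
    proof -
      have "of_nat m0 * (logz - \<i> / of_real (freq k) * \<xi>) = of_int (2 * n) * of_real pi * \<i>
        \<longleftrightarrow> logz - \<i> / of_real (freq k) * \<xi> = of_int (2 * n) * of_real pi * \<i> / of_nat m0"
        using m by (simp add: eq_divide_eq mult.commute)
      also have "\<dots> \<longleftrightarrow> \<i> / of_real (freq k) * \<xi> = logz - of_int (2 * n) * of_real pi * \<i> / of_nat m0"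
      proof -
        have "x - y = r \<longleftrightarrow> y = x - r" for x y r :: complex by (auto simp: algebra_simps)
        then show ?thesis .
      qed
      also have "\<dots> \<longleftrightarrow> \<xi> = of_real (freq k) * (- \<i>) * (logz - of_int (2 * n) * of_real pi * \<i> / of_nat m0)"
      proof
        assume h: "\<i> / of_real (freq k) * \<xi> = logz - of_int (2 * n) * of_real pi * \<i> / of_nat m0"
        show "\<xi> = of_real (freq k) * (- \<i>) * (logz - of_int (2 * n) * of_real pi * \<i> / of_nat m0)"
          unfolding h[symmetric] using c by simp
      next
        assume h: "\<xi> = of_real (freq k) * (- \<i>) * (logz - of_int (2 * n) * of_real pi * \<i> / of_nat m0)"
        show "\<i> / of_real (freq k) * \<xi> = logz - of_int (2 * n) * of_real pi * \<i> / of_nat m0"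
          unfolding h using c by simp
      qed
      also have "of_real (freq k) * (- \<i>) * (logz - of_int (2 * n) * of_real pi * \<i> / of_nat m0) = sing_pt k (- n)"
        by (simp add: sing_pt_def algebra_simps)
      finally show ?thesis .
    qed
    show ?thesis unfolding * by (metis minus_minus)
  qed
  finally show ?thesis .
qed

lemma mode_base_holomorphic: "k \<noteq> 0 \<Longrightarrow> mode_base k holomorphic_on S"
  unfolding mode_base_def[abs_def] by (intro holomorphic_intros) (auto simp: freq_nonzero)

lemma mode_sum_holomorphic:
  assumes "k \<noteq> 0" "\<And>b. sing_pt k b \<notin> S"
  shows "mode_sum k holomorphic_on S"
  unfolding mode_sum_def[abs_def] using assms
  by (intro holomorphic_intros mode_base_holomorphic) (auto simp: mode_base_pow_eq_1_iff[OF assms(1)])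

lemma mero_sum_holomorphic:
  assumes "0 \<le> \<rho>" "\<rho> < 1" "\<And>k. k \<noteq> 0 \<Longrightarrow> int K < \<bar>k\<bar> \<Longrightarrow> norm z * exp (R / \<bar>freq k\<bar>) \<le> \<rho>"
    and "S \<subseteq> ball 0 R" "S \<inter> sing_pts = {}"
  shows "mero_sum K holomorphic_on S"
  unfolding mero_sum_def[abs_def]
proof (intro holomorphic_intros mode_sum_holomorphic holomorphic_on_subset[OF mero_tail_holomorphic[OF assms(1-3)] assms(4)])
  fix k b assume "k \<in> {- int K..int K} - {0}"
  then show "sing_pt k b \<notin> S" using assms(5) by (auto simp: sing_pts_def)
qed (auto simp: freq_nonzero)

lemma mode_base_sing_pt: "a \<noteq> 0 \<Longrightarrow> mode_base a (sing_pt a b) = exp (- (2 * of_real pi * \<i> * of_int b / of_nat m0))"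
proof -
  assume a: "a \<noteq> 0"
  have "\<i> / of_real (freq a) * sing_pt a b = logz + 2 * of_real pi * \<i> * of_int b / of_nat m0"
    using freq_nonzero[OF a] by (simp add: sing_pt_def field_simps)
  then show ?thesis by (simp add: mode_base_exp)
qed

text \<open>At the pole the base is \<open>exp (- 2 * pi * \<i> * b / m0)\<close>; as the first
  index is \<open>- a * n0'\<close> modulo m0, its power is the root of unity in
  \<open>sing_coeff\<close>.\<close>

lemma mode_base_sing_pt_first_index:
  assumes a: "a \<noteq> 0"
  shows "mode_base a (sing_pt a b) ^ first_index a = of_nat m0 * sing_coeff a b"
proof -
  have "[int (first_index a) = - a * n0'] (mod int m0)" by (rule first_index_cong[OF a])
  then obtain j where j: "int (first_index a) = - a * n0' + int m0 * j" by (metis cong_iff_lin cong_sym)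
  have "(of_nat (first_index a) :: complex) = of_int (int (first_index a))" by simp
  also have "\<dots> = - of_int a * of_int n0' + of_nat m0 * of_int j" unfolding j by simp
  finally have nkc: "(of_nat (first_index a) :: complex) = \<dots>" .
  have "mode_base a (sing_pt a b) ^ first_index a = exp (of_nat (first_index a) * (- (2 * of_real pi * \<i> * of_int b / of_nat m0)))"
    unfolding mode_base_sing_pt[OF a] by (simp only: exp_of_nat_mult)
  also have "of_nat (first_index a) * (- (2 * of_real pi * \<i> * of_int b / of_nat m0)) =
     2 * of_real pi * \<i> * of_int a * of_int b * of_int n0' / of_nat m0 + of_int (2 * (- (j * b))) * of_real pi * \<i>"
    unfolding nkc using m0 by (simp add: field_simps)
  also have "exp \<dots> = exp (2 * of_real pi * \<i> * of_int a * of_int b * of_int n0' / of_nat m0)"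
    unfolding exp_eq by (rule exI[of _ "- (j * b)"]) simp
  finally show ?thesis using m0 by (simp add: sing_coeff_def)
qed

text \<open>Only the frequency a is singular at \<open>sing_pt a b\<close>. There
  \<open>mode_base a \<xi> ^ m0\<close> has derivative \<open>- \<i> * m0 / freq a\<close>; the
  factor \<open>1 / freq a\<close> in front cancels and the numerator supplies
  \<open>m0 * sing_coeff a b\<close>.\<close>

lemma mero_sum_pole:
  assumes \<rho>: "0 \<le> \<rho>" "\<rho> < 1" "\<And>k. k \<noteq> 0 \<Longrightarrow> int K < \<bar>k\<bar> \<Longrightarrow> norm z * exp (R / \<bar>freq k\<bar>) \<le> \<rho>"
    and a: "a \<noteq> 0" "sing_pt a b \<in> ball 0 R"
  shows "((\<lambda>\<xi>. (\<xi> - sing_pt a b) * mero_sum K \<xi>) \<longlongrightarrow> - \<i> * sing_coeff a b) (at (sing_pt a b))"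
proof -
  let ?w = "sing_pt a b"
  let ?I = "{- int K..int K} - {0}"
  have W1: "mode_base a ?w ^ m0 = 1" using mode_base_pow_eq_1_iff[OF a(1)] by blast
  \<comment> \<open>A base that is a root of unity has modulus 1, but beyond the cutoff the bases
    are smaller; so a is among the frequencies summed explicitly.\<close>
  have aI: "a \<in> ?I"
  proof (rule ccontr)
    assume "a \<notin> ?I"
    then have "int K < \<bar>a\<bar>" using a by auto
    have "norm (mode_base a ?w) \<le> norm z * exp (norm ?w / \<bar>freq a\<bar>)" by (rule norm_mode_base_le)
    also have "\<dots> \<le> norm z * exp (R / \<bar>freq a\<bar>)" using a(2) by (intro mult_left_mono) (auto intro!: divide_right_mono)
    also have "\<dots> < 1" using \<rho>(3)[OF a(1) \<open>int K < \<bar>a\<bar>\<close>] \<rho>(2) by linarith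
    finally show False using norm_root_unity[OF W1 m0] by simp
  qed
  have freq: "complex_of_real (freq a) \<noteq> 0" using freq_nonzero[OF a(1)] by simp
  define G where "G \<xi> = (\<Sum>k\<in>?I - {a}. 1 / of_real (freq k) * mode_sum k \<xi>) + mero_tail K \<xi>" for \<xi>
  have eqG: "mero_sum K \<xi> = 1 / of_real (freq a) * mode_sum a \<xi> + G \<xi>" for \<xi>
    unfolding mero_sum_def G_def using aI by (subst sum.remove[of _ a]) auto
  have isC: "isCont (\<lambda>\<xi>. mode_sum k \<xi>) ?w" if "k \<in> ?I - {a}" for k
  proof -
    have k0: "k \<noteq> 0" using that by auto
    have cW: "isCont (mode_base k) ?w" for k unfolding mode_base_def[abs_def] by (intro continuous_intros) 
    have "mode_base k ?w ^ m0 \<noteq> 1"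
    proof
      assume "mode_base k ?w ^ m0 = 1"
      then obtain b' where "sing_pt a b = sing_pt k b'" using mode_base_pow_eq_1_iff[OF k0] by blast
      then show False using sing_pt_inj[OF _ a(1)] that by blast
    qed
    then show ?thesis unfolding mode_sum_def by (intro continuous_intros cW) auto
  qed
  have "isCont (mero_tail K) ?w"
    using mero_tail_holomorphic[OF \<rho>] a(2)
    by (meson continuous_on_eq_continuous_at holomorphic_on_imp_continuous_on open_ball)
  then have cG: "isCont G ?w" unfolding G_def by (intro continuous_intros isC) auto
  have "((\<lambda>\<xi>. (\<xi> - ?w) * G \<xi>) \<longlongrightarrow> (?w - ?w) * G ?w) (at ?w)"
    using cG by (intro tendsto_intros) (auto simp: isCont_def)
  then have l1: "((\<lambda>\<xi>. (\<xi> - ?w) * G \<xi>) \<longlongrightarrow> 0) (at ?w)" by simp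
  have "((\<lambda>\<xi>. mode_base a \<xi>) has_field_derivative mode_base a ?w * (- \<i> / of_real (freq a))) (at ?w)"
    unfolding mode_base_def using freq by (auto intro!: derivative_eq_intros)
  then have "((\<lambda>\<xi>. mode_base a \<xi> ^ m0) has_field_derivative of_nat m0 * (mode_base a ?w * (- \<i> / of_real (freq a))) * mode_base a ?w ^ (m0 - 1)) (at ?w)"
    by (auto intro!: derivative_eq_intros)
  moreover have "of_nat m0 * (mode_base a ?w * (- \<i> / of_real (freq a))) * mode_base a ?w ^ (m0 - 1) = of_nat m0 * (- \<i> / of_real (freq a)) * mode_base a ?w ^ m0"
    using m0 by (cases m0) auto
  ultimately have "((\<lambda>\<xi>. mode_base a \<xi> ^ m0) has_field_derivative of_nat m0 * (- \<i> / of_real (freq a))) (at ?w)"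
    unfolding W1 mult_1_right by (simp only:)
  then have "((\<lambda>\<xi>. (mode_base a \<xi> ^ m0 - mode_base a ?w ^ m0) / (\<xi> - ?w)) \<longlongrightarrow> of_nat m0 * (- \<i> / of_real (freq a))) (at ?w)"
    by (simp add: has_field_derivative_iff)
  from tendsto_inverse[OF this] have l2: "((\<lambda>\<xi>. inverse ((mode_base a \<xi> ^ m0 - mode_base a ?w ^ m0) / (\<xi> - ?w))) \<longlongrightarrow> inverse (of_nat m0 * (- \<i> / of_real (freq a)))) (at ?w)"
    using m0 freq by simp
  have "((\<lambda>\<xi>. mode_base a \<xi> ^ first_index a) \<longlongrightarrow> mode_base a ?w ^ first_index a) (at ?w)"
    unfolding mode_base_def by (intro tendsto_intros)
  from tendsto_mult[OF tendsto_mult[OF tendsto_const[of "- 1 / of_real (freq a)"] this] l2]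
  have l3: "((\<lambda>\<xi>. - 1 / of_real (freq a) * mode_base a \<xi> ^ first_index a * inverse ((mode_base a \<xi> ^ m0 - mode_base a ?w ^ m0) / (\<xi> - ?w))) \<longlongrightarrow>
      - 1 / of_real (freq a) * mode_base a ?w ^ first_index a * inverse (of_nat m0 * (- \<i> / of_real (freq a)))) (at ?w)" .
  have v: "- 1 / of_real (freq a) * mode_base a ?w ^ first_index a * inverse (of_nat m0 * (- \<i> / of_real (freq a))) = - \<i> * sing_coeff a b"
    unfolding mode_base_sing_pt_first_index[OF a(1)] using m0 freq by (simp add: field_simps)
  have "((\<lambda>\<xi>. - 1 / of_real (freq a) * mode_base a \<xi> ^ first_index a * inverse ((mode_base a \<xi> ^ m0 - mode_base a ?w ^ m0) / (\<xi> - ?w)) + (\<xi> - ?w) * G \<xi>) \<longlongrightarrow>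
      - \<i> * sing_coeff a b + 0) (at ?w)" by (rule tendsto_add[OF l3[unfolded v] l1])
  moreover have "- 1 / of_real (freq a) * mode_base a \<xi> ^ first_index a * inverse ((mode_base a \<xi> ^ m0 - mode_base a ?w ^ m0) / (\<xi> - ?w)) + (\<xi> - ?w) * G \<xi>
     = (\<xi> - ?w) * mero_sum K \<xi>" for \<xi>
  proof -
    have inv: "inverse ((mode_base a \<xi> ^ m0 - 1) / (\<xi> - ?w)) = - (\<xi> - ?w) * inverse (1 - mode_base a \<xi> ^ m0)"
    proof -
      have "mode_base a \<xi> ^ m0 - 1 = - (1 - mode_base a \<xi> ^ m0)" by simp
      then show ?thesis by (simp only: divide_inverse inverse_mult_distrib inverse_minus_eq inverse_inverse_eq mult_minus_left mult_minus_right mult.commute)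
    qed
    show ?thesis unfolding eqG mode_sum_def W1 inv by (simp add: divide_inverse algebra_simps)
  qed
  ultimately show ?thesis by simp
qed

section \<open>Cutoff in the frequency and partial fractions on a disk\<close>

lemma ln_norm_z: "ln (norm z) < 0"
  using z1 z0 by simp

text \<open>The cutoff is linear in R while \<rho> does not depend on R: along a line the number of
  explicit terms then grows linearly and the tail stays bounded.\<close>

lemma cutoff:
  "\<exists>\<rho> c. 0 \<le> \<rho> \<and> \<rho> < 1 \<and> 0 < c \<and> (\<forall>R\<ge>0. \<exists>K. real K \<le> c * R + 1 \<and>
     (\<forall>k. k \<noteq> 0 \<longrightarrow> int K < \<bar>k\<bar> \<longrightarrow> norm z * exp (R / \<bar>freq k\<bar>) \<le> \<rho>))"
proof -
  define l where "l = - ln (norm z)"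
  have l: "0 < l" using ln_norm_z by (simp add: l_def)
  \<comment> \<open>For \<open>\<bar>k\<bar>\<close> at least \<open>c * R\<close> the quotient
    \<open>R / \<bar>freq k\<bar>\<close> is at most \<open>l / 2\<close>, so the base is at most
    \<open>exp (- l / 2)\<close>, the square root of \<open>norm z\<close>.\<close>
  define c where "c = 2 * real m0 / l"
  have c: "0 < c" using l m0 by (simp add: c_def)
  have main: "\<exists>K. real K \<le> c * R + 1 \<and> (\<forall>k. k \<noteq> 0 \<longrightarrow> int K < \<bar>k\<bar> \<longrightarrow> norm z * exp (R / \<bar>freq k\<bar>) \<le> exp (- l / 2))"
    if R: "0 \<le> R" for R
  proof (intro exI[of _ "nat \<lceil>c * R\<rceil>"] conjI allI impI)
    have cR: "0 \<le> c * R" using c R by simp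
    show "real (nat \<lceil>c * R\<rceil>) \<le> c * R + 1" using cR by linarith
    fix k :: int assume k: "k \<noteq> 0" "int (nat \<lceil>c * R\<rceil>) < \<bar>k\<bar>"
    then have "c * R \<le> \<bar>of_int k\<bar>" using cR by linarith
    then have "c * R / real m0 \<le> \<bar>of_int k\<bar> / real m0" by (intro divide_right_mono) auto
    then have "c * R / real m0 \<le> \<bar>freq k\<bar>" using abs_freq_ge[of k] by linarith
    then have le: "2 * R / l \<le> \<bar>freq k\<bar>" using m0 by (simp add: c_def)
    have "0 < \<bar>freq k\<bar>" using freq_nonzero[OF k(1)] by simp
    then have "R / \<bar>freq k\<bar> \<le> l / 2" using le l by (simp add: field_simps)
    then have "norm z * exp (R / \<bar>freq k\<bar>) \<le> norm z * exp (l / 2)" by (intro mult_left_mono) auto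
    also have "norm z * exp (l / 2) = exp (- l / 2)"
    proof -
      have "norm z = exp (- l)" using z0 by (simp add: l_def)
      then show ?thesis by (simp flip: exp_add)
    qed
    finally show "norm z * exp (R / \<bar>freq k\<bar>) \<le> exp (- l / 2)" .
  qed
  show ?thesis by (rule exI[of _ "exp (- l / 2)"], rule exI[of _ c]) (use main c l in auto)
qed

text \<open>Subtracting the principal parts at the finitely many simple poles in the disk leaves
  removable singularities.\<close>

lemma mero_sum_decomposition:
  assumes R: "0 < R"
  obtains K N where "N holomorphic_on ball 0 R"
    "\<And>\<xi>. \<xi> \<in> ball 0 R - sing_pts \<Longrightarrow> mero_sum K \<xi> = N \<xi> + (\<Sum>\<omega>\<in>sing_pts \<inter> ball 0 R. (- \<i> * sing_weight \<omega>) * (1 / (\<xi> - \<omega>)))"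
proof -
  obtain \<rho> c where \<rho>: "0 \<le> \<rho>" "\<rho> < 1" "0 < c" and ex: "\<forall>R\<ge>0. \<exists>K. real K \<le> c * R + 1 \<and>
     (\<forall>k. k \<noteq> 0 \<longrightarrow> int K < \<bar>k\<bar> \<longrightarrow> norm z * exp (R / \<bar>freq k\<bar>) \<le> \<rho>)"
    using cutoff by auto
  then obtain K where K: "\<And>k. k \<noteq> 0 \<Longrightarrow> int K < \<bar>k\<bar> \<Longrightarrow> norm z * exp (R / \<bar>freq k\<bar>) \<le> \<rho>"
    using R by (meson less_imp_le)
  let ?F = "sing_pts \<inter> ball 0 R"
  let ?s = "\<lambda>\<xi>. \<Sum>\<omega>\<in>?F. (- \<i> * sing_weight \<omega>) * (1 / (\<xi> - \<omega>))"
  have "\<exists>g. g holomorphic_on ball 0 R \<and> (\<forall>w\<in>ball 0 R - ?F. g w = mero_sum K w - ?s w)"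
  proof (rule holomorphic_extend_finite[OF finite_sing_pts])
    have "mero_sum K holomorphic_on ball 0 R - ?F" by (rule mero_sum_holomorphic[OF \<rho>(1,2) K]) auto
    then show "(\<lambda>w. mero_sum K w - ?s w) holomorphic_on ball 0 R - ?F"
      by (intro holomorphic_intros) auto
    fix x assume x: "x \<in> ?F"
    then obtain a b where ab: "a \<noteq> 0" "x = sing_pt a b" by (auto simp: sing_pts_def)
    have 1: "((\<lambda>w. (w - x) * mero_sum K w) \<longlongrightarrow> - \<i> * sing_weight x) (at x)"
      using mero_sum_pole[OF \<rho>(1,2) K ab(1)] x ab sing_weight_sing_pt[OF ab(1)] by simp
    let ?o = "\<lambda>\<xi>. \<Sum>\<omega>\<in>?F - {x}. (- \<i> * sing_weight \<omega>) * (1 / (\<xi> - \<omega>))"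
    have "((\<lambda>w. (w - x) * ?o w) \<longlongrightarrow> (x - x) * ?o x) (at x)"
      by (intro tendsto_intros) auto
    from tendsto_diff[OF tendsto_diff[OF 1 tendsto_const[of "- \<i> * sing_weight x"]] this]
    have 2: "((\<lambda>w. (w - x) * mero_sum K w - (- \<i> * sing_weight x) - (w - x) * ?o w) \<longlongrightarrow> 0) (at x)" by simp
    show "((\<lambda>w. (w - x) * (mero_sum K w - ?s w)) \<longlongrightarrow> 0) (at x)"
    proof (rule Lim_transform_eventually[OF 2])
      show "\<forall>\<^sub>F w in at x. (w - x) * mero_sum K w - (- \<i> * sing_weight x) - (w - x) * ?o w = (w - x) * (mero_sum K w - ?s w)"
        unfolding eventually_at_filter
      proof (intro always_eventually allI impI)
        fix w assume w: "w \<noteq> x"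
        have "?s w = (- \<i> * sing_weight x) * (1 / (w - x)) + ?o w" using x by (subst sum.remove[OF finite_sing_pts, of x]) auto
        then show "(w - x) * mero_sum K w - (- \<i> * sing_weight x) - (w - x) * ?o w = (w - x) * (mero_sum K w - ?s w)"
          using w by (simp only:) (simp add: field_simps)
      qed
    qed
  qed auto
  then obtain g where g: "g holomorphic_on ball 0 R" "\<And>w. w \<in> ball 0 R - ?F \<Longrightarrow> g w = mero_sum K w - ?s w" by blast
  show ?thesis
  proof (rule that[OF g(1)])
    fix \<xi> assume "\<xi> \<in> ball 0 R - sing_pts"
    then have "\<xi> \<in> ball 0 R - ?F" by blast
    from g(2)[OF this] show "mero_sum K \<xi> = g \<xi> + ?s \<xi>" by simp
  qed
qed

text \<open>The partial fractions of M are inserted into the formula near the origin. The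
  contributions of N and the entire remainders \<open>pole_rem\<close> go into g; the factor
  \<open>- \<Lambda> * (- \<i>)\<close> yields \<open>\<i> * \<Lambda>\<close>.\<close>

lemma Phi_delta_rep:
  assumes R: "0 < R"
  shows "\<exists>g. g holomorphic_on ball 0 R \<and> (\<forall>\<^sub>F \<xi> in nhds 0. Phi_delta \<Lambda> z \<xi> =
     g \<xi> + (\<Sum>\<omega>\<in>sing_pts \<inter> ball 0 R. sing_weight \<omega> * (\<i> * \<Lambda> * gker_coeff 0 \<xi> / (\<xi> - \<omega>) + \<i> * \<Lambda> * conv_ker \<xi> (\<xi> - \<omega>) * Ln (1 - \<xi> / \<omega>))))"
proof -
  obtain r \<rho> where r: "0 < r" "0 \<le> \<rho>" "\<rho> < 1" "norm z * exp (real m0 * r) \<le> \<rho>"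
    "\<And>k. k \<noteq> 0 \<Longrightarrow> norm z * exp (r / \<bar>freq k\<bar>) \<le> \<rho>" using small_radius by metis
  obtain K N where N: "N holomorphic_on ball 0 R" and
    dec: "\<And>\<xi>. \<xi> \<in> ball 0 R - sing_pts \<Longrightarrow> mero_sum K \<xi> = N \<xi> + (\<Sum>\<omega>\<in>sing_pts \<inter> ball 0 R. (- \<i> * sing_weight \<omega>) * (1 / (\<xi> - \<omega>)))"
    using mero_sum_decomposition[OF R] by metis
  let ?F = "sing_pts \<inter> ball 0 R"
  obtain d where d: "0 < d" "\<And>w. w \<in> ?F \<Longrightarrow> w \<noteq> 0 \<Longrightarrow> d \<le> dist 0 w"
    using finite_set_avoid[OF finite_sing_pts[of R], of 0] by blast
  have dF: "d \<le> norm w" if "w \<in> ?F" for w using d(2)[OF that] that sing_pts_0 by auto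
  \<comment> \<open>Small enough for the formula near the origin to hold and for the segments from 0
    to stay away from the poles.\<close>
  define e where "e = min r (min R d)"
  have e: "0 < e" "e \<le> r" "e \<le> R" "e \<le> d" using r R d by (auto simp: e_def)
  define g where "g \<xi> = - \<Lambda> * (gker_coeff 0 \<xi> * N \<xi> + conv_op N \<xi> + entire_part \<xi> + (\<Sum>\<omega>\<in>?F. (- \<i> * sing_weight \<omega>) * pole_rem \<omega> \<xi>))" for \<xi>
  have "conv_op N holomorphic_on ball 0 R"
  proof (rule conv_op_holomorphic[OF _ _ N])
    fix x :: complex assume "x \<in> ball 0 R"
    then show "closed_segment 0 x \<subseteq> ball 0 R" using R by (intro closed_segment_subset) auto
  qed simp
  then have gh: "g holomorphic_on ball 0 R"
    unfolding g_def
    by (intro holomorphic_intros N holomorphic_on_subset[OF gker_coeff_holomorphic] holomorphic_on_subset[OF entire_part_holomorphic]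
        holomorphic_on_subset[OF pole_rem_holomorphic]) auto
  have eq: "Phi_delta \<Lambda> z \<xi> =
     g \<xi> + (\<Sum>\<omega>\<in>?F. sing_weight \<omega> * (\<i> * \<Lambda> * gker_coeff 0 \<xi> / (\<xi> - \<omega>) + \<i> * \<Lambda> * conv_ker \<xi> (\<xi> - \<omega>) * Ln (1 - \<xi> / \<omega>)))"
    if \<xi>: "norm \<xi> < e" for \<xi>
  proof -
    have seg: "norm x < e" if "x \<in> closed_segment 0 \<xi>" for x
      using segment_bound1[OF that] \<xi> by simp
    have avoid: "x \<in> ball 0 R - sing_pts" if "norm x < e" for x
      using that e dF[of x] by auto
    have M: "mero_tail 0 x = N x + (\<Sum>\<omega>\<in>?F. (- \<i> * sing_weight \<omega>) * (1 / (x - \<omega>)))" if "norm x < e" for x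
      using mero_tail_0_eq_mero_sum[OF r(2,3,5), of x K] dec[OF avoid[OF that]] that e by simp
    have cN: "continuous_on (closed_segment 0 \<xi>) N"
      by (rule continuous_on_subset[OF holomorphic_on_imp_continuous_on[OF N]]) (use seg e in fastforce)
    have cP: "continuous_on (closed_segment 0 \<xi>) (\<lambda>x. 1 / (x - \<omega>))" if "\<omega> \<in> ?F" for \<omega>
      by (intro continuous_intros) (use seg avoid that in auto)
    have cP': "continuous_on (closed_segment 0 \<xi>) (\<lambda>x. (- \<i> * sing_weight \<omega>) * (1 / (x - \<omega>)))" if "\<omega> \<in> ?F" for \<omega>
      by (intro continuous_on_mult_left cP that)
    have "conv_op (mero_tail 0) \<xi> = conv_op (\<lambda>x. N x + (\<Sum>\<omega>\<in>?F. (- \<i> * sing_weight \<omega>) * (1 / (x - \<omega>)))) \<xi>"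
      by (rule conv_op_cong) (rule M[OF seg])
    also have "\<dots> = conv_op N \<xi> + conv_op (\<lambda>x. \<Sum>\<omega>\<in>?F. (- \<i> * sing_weight \<omega>) * (1 / (x - \<omega>))) \<xi>"
      by (rule conv_op_add[OF cN]) (intro continuous_on_sum cP')
    also have "conv_op (\<lambda>x. \<Sum>\<omega>\<in>?F. (- \<i> * sing_weight \<omega>) * (1 / (x - \<omega>))) \<xi> = (\<Sum>\<omega>\<in>?F. conv_op (\<lambda>x. (- \<i> * sing_weight \<omega>) * (1 / (x - \<omega>))) \<xi>)"
      by (rule conv_op_sum[OF finite_sing_pts cP'])
    also have "\<dots> = (\<Sum>\<omega>\<in>?F. (- \<i> * sing_weight \<omega>) * (conv_ker \<xi> (\<xi> - \<omega>) * Ln (1 - \<xi> / \<omega>) + pole_rem \<omega> \<xi>))"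
    proof (rule sum.cong[OF refl])
      fix \<omega> assume \<omega>: "\<omega> \<in> ?F"
      then have \<omega>0: "\<omega> \<noteq> 0" using sing_pts_0 by auto
      have slit: "1 - of_real s * \<xi> / \<omega> \<notin> \<real>\<^sub>\<le>\<^sub>0" if s: "s \<in> {0..1}" for s
      proof -
        have "norm (of_real s * \<xi>) < norm \<omega>" using seg[OF segment_param[OF s]] e dF[OF \<omega>] by linarith
        then have "norm (of_real s * \<xi> / \<omega>) < 1" using \<omega>0 by (simp only: norm_divide) (simp add: divide_simps)
        then have "Re (of_real s * \<xi> / \<omega>) < 1" using complex_Re_le_cmod[of "of_real s * \<xi> / \<omega>"] by linarith
        then have "0 < Re (1 - of_real s * \<xi> / \<omega>)" unfolding minus_complex.sel by simp
        then show ?thesis by (simp only: complex_nonpos_Reals_iff) linarith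
      qed
      have pole: "conv_op (\<lambda>x. 1 / (x - \<omega>)) \<xi> = conv_ker \<xi> (\<xi> - \<omega>) * Ln (1 - \<xi> / \<omega>) + pole_rem \<omega> \<xi>"
        by (rule conv_op_pole[OF \<omega>0]) (rule slit)
      show "conv_op (\<lambda>x. (- \<i> * sing_weight \<omega>) * (1 / (x - \<omega>))) \<xi> = (- \<i> * sing_weight \<omega>) * (conv_ker \<xi> (\<xi> - \<omega>) * Ln (1 - \<xi> / \<omega>) + pole_rem \<omega> \<xi>)"
        unfolding conv_op_cmult[OF cP[OF \<omega>]] pole ..
    qed
    finally have T: "conv_op (mero_tail 0) \<xi> = conv_op N \<xi> + (\<Sum>\<omega>\<in>?F. (- \<i> * sing_weight \<omega>) * (conv_ker \<xi> (\<xi> - \<omega>) * Ln (1 - \<xi> / \<omega>) + pole_rem \<omega> \<xi>))" .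
    have "Phi_delta \<Lambda> z \<xi> = - \<Lambda> * (gker_coeff 0 \<xi> * mero_tail 0 \<xi> + conv_op (mero_tail 0) \<xi> + entire_part \<xi>)"
      by (rule Phi_delta_conv_op[OF r]) (use \<xi> e in simp_all)
    also have "\<dots> = g \<xi> + (- \<Lambda> * (gker_coeff 0 \<xi> * (\<Sum>\<omega>\<in>?F. (- \<i> * sing_weight \<omega>) * (1 / (\<xi> - \<omega>))))
        + - \<Lambda> * (\<Sum>\<omega>\<in>?F. (- \<i> * sing_weight \<omega>) * (conv_ker \<xi> (\<xi> - \<omega>) * Ln (1 - \<xi> / \<omega>))))"
    proof -
      have "- L * (G * (n + s0) + (t + (s1 + s2)) + h) = - L * (G * n + t + h + s2) + (- L * (G * s0) + - L * s1)"
        for L G n s0 t s1 s2 h :: complex by (simp add: algebra_simps)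
      moreover have "(\<Sum>\<omega>\<in>?F. (- \<i> * sing_weight \<omega>) * (conv_ker \<xi> (\<xi> - \<omega>) * Ln (1 - \<xi> / \<omega>) + pole_rem \<omega> \<xi>)) =
         (\<Sum>\<omega>\<in>?F. (- \<i> * sing_weight \<omega>) * (conv_ker \<xi> (\<xi> - \<omega>) * Ln (1 - \<xi> / \<omega>))) + (\<Sum>\<omega>\<in>?F. (- \<i> * sing_weight \<omega>) * pole_rem \<omega> \<xi>)"
        by (simp only: distrib_left sum.distrib)
      ultimately show ?thesis unfolding T M[OF \<xi>] g_def by (simp only:)
    qed
    also have "\<dots> = g \<xi> + ((\<Sum>\<omega>\<in>?F. - \<Lambda> * (gker_coeff 0 \<xi> * ((- \<i> * sing_weight \<omega>) * (1 / (\<xi> - \<omega>)))))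
        + (\<Sum>\<omega>\<in>?F. - \<Lambda> * ((- \<i> * sing_weight \<omega>) * (conv_ker \<xi> (\<xi> - \<omega>) * Ln (1 - \<xi> / \<omega>)))))"
      by (simp only: sum_distrib_left)
    also have "\<dots> = g \<xi> + (\<Sum>\<omega>\<in>?F. sing_weight \<omega> * (\<i> * \<Lambda> * gker_coeff 0 \<xi> / (\<xi> - \<omega>) + \<i> * \<Lambda> * conv_ker \<xi> (\<xi> - \<omega>) * Ln (1 - \<xi> / \<omega>)))"
      unfolding sum.distrib[symmetric] by (intro arg_cong2[where f = "(+)"] refl sum.cong) (simp add: field_simps)
    finally show ?thesis .
  qed
  have "\<forall>\<^sub>F \<xi> in nhds 0. Phi_delta \<Lambda> z \<xi> =
     g \<xi> + (\<Sum>\<omega>\<in>?F. sing_weight \<omega> * (\<i> * \<Lambda> * gker_coeff 0 \<xi> / (\<xi> - \<omega>) + \<i> * \<Lambda> * conv_ker \<xi> (\<xi> - \<omega>) * Ln (1 - \<xi> / \<omega>)))"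
    unfolding eventually_nhds_metric using eq e(1) by (intro exI[of _ e]) (auto simp: dist_norm)
  then show ?thesis using gh by blast
qed

lemma sing_weight_nonzero: "\<omega> \<in> sing_pts \<Longrightarrow> sing_weight \<omega> \<noteq> 0"
  using m0 by (auto simp: sing_pts_def sing_weight_sing_pt sing_coeff_def)

lemma log_pole_germ_Phi:
  "log_pole_germ (Phi_delta \<Lambda> z) sing_pts sing_weight (\<lambda>\<xi>. \<i> * \<Lambda> * gker_coeff 0 \<xi>) (\<lambda>\<omega> \<xi>. \<i> * \<Lambda> * conv_ker \<xi> (\<xi> - \<omega>))"
proof
  show "(\<lambda>\<xi>. \<i> * \<Lambda> * gker_coeff 0 \<xi>) holomorphic_on UNIV" by (intro holomorphic_intros gker_coeff_holomorphic)
  show "(\<lambda>\<xi>. \<i> * \<Lambda> * conv_ker \<xi> (\<xi> - \<omega>)) holomorphic_on UNIV" for \<omega> by (intro holomorphic_intros conv_ker_holomorphic)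
  show "sing_weight \<omega> * (\<i> * \<Lambda> * gker_coeff 0 \<omega>) \<noteq> 0" if "\<omega> \<in> sing_pts" for \<omega>
    using sing_weight_nonzero[OF that] \<Lambda>_ne_0 by (simp add: gker_coeff_0)
qed (use finite_sing_pts sing_pts_0 Phi_delta_rep in auto)

sublocale germ: log_pole_germ "Phi_delta \<Lambda> z" sing_pts sing_weight "\<lambda>\<xi>. \<i> * \<Lambda> * gker_coeff 0 \<xi>" "\<lambda>\<omega> \<xi>. \<i> * \<Lambda> * conv_ker \<xi> (\<xi> - \<omega>)"
  by (rule log_pole_germ_Phi)

lemma star_disjoint: "star sing_pts \<inter> sing_pts = {}"
proof -
  have "1 - x / x \<in> \<real>\<^sub>\<le>\<^sub>0" if "x \<in> sing_pts" for x using that sing_pts_0 by (cases "x = 0") auto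
  then show ?thesis by (auto simp: star_def)
qed

text \<open>A formula in terms of \<open>mero_sum\<close> itself, whose size can be estimated
  explicitly; uniqueness of continuation extends it from the origin to the star inside the
  disk.\<close>

lemma main_branch_mero_sum:
  assumes K: "0 \<le> \<rho>'" "\<rho>' < 1" "\<And>k. k \<noteq> 0 \<Longrightarrow> int K < \<bar>k\<bar> \<Longrightarrow> norm z * exp (R / \<bar>freq k\<bar>) \<le> \<rho>'"
    and \<xi>: "\<xi> \<in> star sing_pts \<inter> ball 0 R"
  shows "main_branch (Phi_delta \<Lambda> z) \<xi> = - \<Lambda> * (gker_coeff 0 \<xi> * mero_sum K \<xi> + conv_op (mero_sum K) \<xi> + entire_part \<xi>)"
proof (rule main_branch_starlike(3)[OF germ.star_ball _ _ \<xi>])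
  have hM: "mero_sum K holomorphic_on star sing_pts \<inter> ball 0 R"
    by (rule mero_sum_holomorphic[OF K]) (use star_disjoint in auto)
  then show "(\<lambda>\<xi>. - \<Lambda> * (gker_coeff 0 \<xi> * mero_sum K \<xi> + conv_op (mero_sum K) \<xi> + entire_part \<xi>)) holomorphic_on star sing_pts \<inter> ball 0 R"
    by (intro holomorphic_intros conv_op_holomorphic germ.star_ball holomorphic_on_subset[OF gker_coeff_holomorphic]
        holomorphic_on_subset[OF entire_part_holomorphic]) auto
  obtain r \<rho> where r: "0 < r" "0 \<le> \<rho>" "\<rho> < 1" "norm z * exp (real m0 * r) \<le> \<rho>"
    "\<And>k. k \<noteq> 0 \<Longrightarrow> norm z * exp (r / \<bar>freq k\<bar>) \<le> \<rho>" using small_radius by metis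
  have "Phi_delta \<Lambda> z w = - \<Lambda> * (gker_coeff 0 w * mero_sum K w + conv_op (mero_sum K) w + entire_part w)" if w: "norm w < r" for w
  proof -
    have "conv_op (mero_tail 0) w = conv_op (mero_sum K) w"
    proof (rule conv_op_cong)
      fix x assume "x \<in> closed_segment 0 w"
      then have "norm x \<le> r" using segment_bound1[of x 0 w] w by simp
      then show "mero_tail 0 x = mero_sum K x" using mero_tail_0_eq_mero_sum[OF r(2,3,5), of x K] by simp
    qed
    then show ?thesis
      using Phi_delta_conv_op[OF r, of w] mero_tail_0_eq_mero_sum[OF r(2,3,5), of w K] w by simp
  qed
  then show "\<forall>\<^sub>F w in nhds 0. Phi_delta \<Lambda> z w = - \<Lambda> * (gker_coeff 0 w * mero_sum K w + conv_op (mero_sum K) w + entire_part w)"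
    unfolding eventually_nhds_metric using r(1) by (intro exI[of _ r]) (auto simp: dist_norm)
qed

section \<open>Exponential growth on lines\<close>

text \<open>For \<open>\<xi> = t * u\<close> all frequencies lead to one function \<phi> of the
  single real variable \<open>t / freq k\<close>, so a bound uniform in k reduces to a bound for
  \<phi>. It has no zero since the line avoids the poles of frequency 1 already.\<close>

lemma line_distance:
  assumes u: "u \<noteq> 0" and av: "\<And>t::real. of_real t * u \<notin> sing_pts"
  shows "\<exists>\<delta>>0. \<forall>k t. k \<noteq> 0 \<longrightarrow> \<delta> \<le> norm (1 - mode_base k (of_real t * u) ^ m0)"
proof -
  define \<phi> where "\<phi> s = 1 - exp (of_nat m0 * (logz - \<i> * of_real s * u))" for s :: real
  have \<phi>W: "1 - mode_base k (of_real t * u) ^ m0 = \<phi> (t / freq k)" for k t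
  proof -
    have "logz - \<i> / of_real (freq k) * (of_real t * u) = logz - \<i> * of_real (t / freq k) * u" by simp
    then show ?thesis unfolding mode_base_exp \<phi>_def by (simp only: exp_of_nat_mult)
  qed
  have \<phi>0: "\<phi> s \<noteq> 0" for s
  proof
    assume "\<phi> s = 0"
    moreover have "s * freq 1 / freq 1 = s" using freq_nonzero[of 1] by simp
    ultimately have "mode_base 1 (of_real (s * freq 1) * u) ^ m0 = 1" using \<phi>W[of 1 "s * freq 1"] by simp
    then obtain b where "of_real (s * freq 1) * u = sing_pt 1 b" using mode_base_pow_eq_1_iff[of 1] by auto
    then have "of_real (s * freq 1) * u \<in> sing_pts" unfolding sing_pts_def
      by (intro CollectI exI[of _ "1::int"] exI[of _ b]) simp
    then show False using av by blast
  qed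
  have ne: "norm (exp (of_nat m0 * (logz - \<i> * of_real s * u))) = exp (real m0 * (Re logz + s * Im u))" for s
    by (simp add: norm_exp_eq_Re)
  have m1: "1 \<le> real m0" using m0 by simp
  have "\<exists>\<delta>>0. \<forall>s. \<delta> \<le> norm (\<phi> s)"
  proof (cases "Im u = 0")
    \<comment> \<open>The modulus of the exponential is then the constant
      \<open>exp (m0 * Re logz)\<close>, which is below 1.\<close>
    case True
    have "1 - exp (real m0 * Re logz) \<le> norm (\<phi> s)" for s
      using norm_triangle_ineq2[of 1 "exp (of_nat m0 * (logz - \<i> * of_real s * u))"] unfolding \<phi>_def ne True by simp
    moreover have "exp (real m0 * Re logz) < 1" using Re_logz m0 by (simp add: mult_pos_neg)
    ultimately show ?thesis by (intro exI[of _ "1 - exp (real m0 * Re logz)"]) auto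
  next
    case False
    \<comment> \<open>Beyond S the exponent has real part of modulus at least 1, so the exponential
      has modulus at least 2 or at most 1/2; the bounded range is left to compactness.\<close>
    define S where "S = (1 - Re logz) / \<bar>Im u\<bar>"
    have S: "0 \<le> S" using Re_logz by (simp add: S_def)
    have cont: "continuous_on {- S..S} (\<lambda>s. norm (\<phi> s))" unfolding \<phi>_def by (intro continuous_intros)
    obtain s0 where s0: "s0 \<in> {- S..S}" "\<And>s. s \<in> {- S..S} \<Longrightarrow> norm (\<phi> s0) \<le> norm (\<phi> s)"
      using continuous_attains_inf[OF compact_Icc _ cont] S by auto
    have out: "1/2 \<le> norm (\<phi> s)" if s: "s \<notin> {- S..S}" for s
    proof -
      let ?E = "exp (of_nat m0 * (logz - \<i> * of_real s * u))"
      have "S < \<bar>s\<bar>" using s by auto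
      then have "S * \<bar>Im u\<bar> < \<bar>s\<bar> * \<bar>Im u\<bar>" using False by (intro mult_strict_right_mono) auto
      then have big: "1 - Re logz < \<bar>s * Im u\<bar>" using False by (simp add: S_def abs_mult)
      have e1: "exp (- 1) \<le> (1/2::real)" using exp_ge_add_one_self[of "1::real"] by (simp add: exp_minus divide_simps)
      show ?thesis
      proof (cases "0 \<le> s * Im u")
        case True
        then have "1 \<le> Re logz + s * Im u" using big by linarith
        then have "1 * 1 \<le> real m0 * (Re logz + s * Im u)" using m1 by (intro mult_mono) auto
        then have "exp 1 \<le> norm ?E" unfolding ne by simp
        then have "2 \<le> norm ?E" using exp_ge_add_one_self[of "1::real"] by linarith
        then show ?thesis using norm_triangle_ineq2[of ?E 1] unfolding \<phi>_def by (simp add: norm_minus_commute)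
      next
        case neg: False
        then have "1 \<le> - (Re logz + s * Im u)" using big Re_logz by linarith
        then have "1 * 1 \<le> real m0 * - (Re logz + s * Im u)" using m1 by (intro mult_mono) auto
        then have "real m0 * (Re logz + s * Im u) \<le> - 1" unfolding mult_minus_right by linarith
        then have "norm ?E \<le> exp (- 1)" unfolding ne by (simp only: exp_le_cancel_iff)
        then show ?thesis using norm_triangle_ineq2[of 1 ?E] e1 unfolding \<phi>_def norm_one by linarith
      qed
    qed
    show ?thesis
    proof (intro exI[of _ "min (norm (\<phi> s0)) (1/2)"] conjI allI)
      show "0 < min (norm (\<phi> s0)) (1/2)" using \<phi>0 by simp
      fix s show "min (norm (\<phi> s0)) (1/2) \<le> norm (\<phi> s)"
        using s0(2)[of s] out[of s] by (cases "s \<in> {- S..S}") auto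
    qed
  qed
  then show ?thesis unfolding \<phi>W by blast
qed

text \<open>The first index is at most \<open>4 * m0 * \<bar>k\<bar>\<close> and
  \<open>\<bar>freq k\<bar>\<close> at least \<open>\<bar>k\<bar> / m0\<close>; so the exponential
  rate \<open>first_index k / \<bar>freq k\<bar>\<close> is at most \<open>4 * m0 ^ 2\<close> for
  every k.\<close>

lemma norm_mode_sum_le:
  assumes k: "k \<noteq> 0" and \<delta>: "0 < \<delta>" "\<delta> \<le> norm (1 - mode_base k \<xi> ^ m0)"
  shows "norm (mode_sum k \<xi>) \<le> exp (4 * real m0 ^ 2 * norm \<xi>) / \<delta>"
proof -
  have c: "0 < \<bar>freq k\<bar>" using freq_nonzero[OF k] by simp
  have k1: "1 \<le> \<bar>real_of_int k\<bar>" using k by linarith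
  have "norm (mode_base k \<xi>) \<le> norm z * exp (norm \<xi> / \<bar>freq k\<bar>)" by (rule norm_mode_base_le)
  also have "\<dots> \<le> 1 * exp (norm \<xi> / \<bar>freq k\<bar>)" using z1 by (intro mult_right_mono) auto
  finally have "norm (mode_base k \<xi>) ^ first_index k \<le> exp (norm \<xi> / \<bar>freq k\<bar>) ^ first_index k" by (intro power_mono) auto
  also have "\<dots> = exp (real (first_index k) * (norm \<xi> / \<bar>freq k\<bar>))" by (rule exp_of_nat_mult[symmetric])
  also have "\<dots> \<le> exp (4 * real m0 ^ 2 * norm \<xi>)"
  proof -
    have "real (first_index k) \<le> real (m0 * (2 * nat \<bar>k\<bar> + 2))" using first_index_le[OF k] by (rule of_nat_mono)
    also have "\<dots> = real m0 * (2 * \<bar>real_of_int k\<bar> + 2)" by (simp add: distrib_left)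
    also have "\<dots> \<le> real m0 * (4 * \<bar>real_of_int k\<bar>)" using k1 by (intro mult_left_mono) auto
    also have "\<dots> = 4 * real m0 ^ 2 * (\<bar>real_of_int k\<bar> / real m0)" using m0 by (simp add: power2_eq_square)
    also have "\<dots> \<le> 4 * real m0 ^ 2 * \<bar>freq k\<bar>" by (intro mult_left_mono abs_freq_ge) auto
    finally have "real (first_index k) / \<bar>freq k\<bar> \<le> 4 * real m0 ^ 2" using c by (simp add: divide_le_eq)
    then have "real (first_index k) / \<bar>freq k\<bar> * norm \<xi> \<le> 4 * real m0 ^ 2 * norm \<xi>" by (intro mult_right_mono) auto
    then show ?thesis by simp
  qed
  finally show ?thesis unfolding mode_sum_def norm_divide norm_power using \<delta> by (intro frac_le) auto
qed

lemma card_Icc_minus_0: "real (card ({- int K..int K} - {0})) \<le> 2 * real K + 1"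
proof -
  have "card ({- int K..int K} - {0}) \<le> card {- int K..int K}" by (rule card_mono) auto
  moreover have "card {- int K..int K} = 2 * K + 1" by simp
  ultimately show ?thesis by linarith
qed

text \<open>The cutoff K depends on \<xi>, the constants do not: the number of explicit modes is at
  most linear in \<open>norm \<xi>\<close>, each is controlled by \<open>line_distance\<close>, and
  the tail is bounded by a constant.\<close>

lemma exponential_growth:
  assumes u: "u \<noteq> 0" and av: "\<And>t::real. of_real t * u \<notin> sing_pts"
  shows "\<exists>C \<tau>. \<forall>t::real. norm (main_branch (Phi_delta \<Lambda> z) (of_real t * u)) \<le> C * exp (\<tau> * norm (of_real t * u))"
proof -
  obtain \<delta> where \<delta>: "0 < \<delta>" "\<And>k t. k \<noteq> 0 \<Longrightarrow> \<delta> \<le> norm (1 - mode_base k (of_real t * u) ^ m0)"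
    using line_distance[OF assms] by auto
  obtain \<rho> c where \<rho>: "0 \<le> \<rho>" "\<rho> < 1" "0 < c" and cut: "\<forall>R\<ge>0. \<exists>K. real K \<le> c * R + 1 \<and>
     (\<forall>k. k \<noteq> 0 \<longrightarrow> int K < \<bar>k\<bar> \<longrightarrow> norm z * exp (R / \<bar>freq k\<bar>) \<le> \<rho>)"
    using cutoff by auto
  obtain A b where A: "0 < A" "0 < b" and T: "\<forall>M \<xi> B. continuous_on (closed_segment 0 \<xi>) M \<longrightarrow> 0 \<le> B \<longrightarrow>
     (\<forall>x\<in>closed_segment 0 \<xi>. norm (M x) \<le> B) \<longrightarrow> norm (conv_op M \<xi>) \<le> A * exp (b * norm \<xi>) * B"
    using conv_op_bound by auto
  obtain A' b' where A': "0 < A'" "0 < b'" and H: "\<forall>\<xi>. norm (entire_part \<xi>) \<le> A' * exp (b' * norm \<xi>)"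
    using entire_part_bound by auto
  define C\<rho> where "C\<rho> = (\<Sum>n. 3 * real m0 * (real n * real m0) * 1 * \<rho> ^ n)"
  have C\<rho>: "0 \<le> C\<rho>" unfolding C\<rho>_def by (rule suminf_nonneg[OF summable_weight[OF \<rho>(1,2)]]) (use \<rho> in simp)
  define C2 where "C2 = (2 * c + 3) * real m0 / \<delta> + C\<rho>"
  \<comment> \<open>The summand 1 pays for the number of modes, which is linear in the modulus and
    so below a multiple of its exponential; the rest is the rate of a single mode.\<close>
  define \<sigma> where "\<sigma> = 1 + 4 * real m0 ^ 2"
  have C2: "0 \<le> C2" "0 \<le> \<sigma>" using \<rho> \<delta> C\<rho> by (auto simp: C2_def \<sigma>_def)
  have "norm (main_branch (Phi_delta \<Lambda> z) (of_real t * u)) \<le> (C2 + A * C2 + A') * exp ((1 + \<sigma> + b + b') * norm (of_real t * u))" for t :: real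
  proof -
    define \<xi> where "\<xi> = of_real t * u"
    define X where "X = norm \<xi>"
    have X: "0 \<le> X" by (simp add: X_def)
    have "0 \<le> X + 1" using X by simp
    then have "\<exists>K. real K \<le> c * (X + 1) + 1 \<and>
       (\<forall>k. k \<noteq> 0 \<longrightarrow> int K < \<bar>k\<bar> \<longrightarrow> norm z * exp ((X + 1) / \<bar>freq k\<bar>) \<le> \<rho>)"
      by (rule cut[rule_format])
    then obtain K where K: "real K \<le> c * (X + 1) + 1" "\<And>k. k \<noteq> 0 \<Longrightarrow> int K < \<bar>k\<bar> \<Longrightarrow> norm z * exp ((X + 1) / \<bar>freq k\<bar>) \<le> \<rho>"
      by auto
    have star: "\<xi> \<in> star sing_pts"
    proof (rule ccontr)
      assume "\<xi> \<notin> star sing_pts"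
      then obtain s where "of_real s * \<xi> \<in> sing_pts" using not_in_star_iff[OF sing_pts_0] by blast
      then have "of_real (s * t) * u \<in> sing_pts" by (simp add: \<xi>_def mult.assoc)
      then show False using av by blast
    qed
    then have inS: "\<xi> \<in> star sing_pts \<inter> ball 0 (X + 1)" by (simp add: X_def)
    have seg: "closed_segment 0 \<xi> \<subseteq> star sing_pts \<inter> ball 0 (X + 1)" by (rule germ.star_ball(2)[OF inS])
    have "mero_sum K holomorphic_on star sing_pts \<inter> ball 0 (X + 1)"
      by (rule mero_sum_holomorphic[OF \<rho>(1,2) K(2)]) (use star_disjoint in auto)
    then have cM: "continuous_on (closed_segment 0 \<xi>) (mero_sum K)"
      using holomorphic_on_imp_continuous_on continuous_on_subset seg by blast
    have MRb: "norm (mero_sum K x) \<le> C2 * exp (\<sigma> * X)" if x: "x \<in> closed_segment 0 \<xi>" for x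
    proof -
      obtain s where s: "x = of_real s * \<xi>" using x by (auto simp: in_segment scaleR_conv_of_real)
      have xu: "x = of_real (s * t) * u" by (simp add: s \<xi>_def)
      have nx: "norm x \<le> X" using segment_bound1[OF x] by (simp add: X_def)
      let ?I = "{- int K..int K} - {0}"
      have "norm (\<Sum>k\<in>?I. 1 / of_real (freq k) * mode_sum k x) \<le> of_nat (card ?I) * (real m0 * (exp (4 * real m0 ^ 2 * X) / \<delta>))"
      proof (rule sum_norm_bound)
        fix k assume "k \<in> ?I"
        then have k: "k \<noteq> 0" by auto
        have "norm (mode_sum k x) \<le> exp (4 * real m0 ^ 2 * norm x) / \<delta>"
          by (rule norm_mode_sum_le[OF k \<delta>(1)]) (use \<delta>(2)[OF k] xu in metis)
        also have "\<dots> \<le> exp (4 * real m0 ^ 2 * X) / \<delta>"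
          using nx \<delta>(1) by (intro divide_right_mono) (auto intro!: mult_left_mono)
        finally show "norm (1 / of_real (freq k) * mode_sum k x) \<le> real m0 * (exp (4 * real m0 ^ 2 * X) / \<delta>)"
          unfolding norm_mult by (intro mult_mono norm_inverse_freq_le[OF k]) auto
      qed
      also have "\<dots> \<le> ((2 * c + 3) * exp X) * (real m0 * (exp (4 * real m0 ^ 2 * X) / \<delta>))"
      proof (rule mult_right_mono)
        have "real (card ?I) \<le> 2 * real K + 1" by (rule card_Icc_minus_0)
        also have "\<dots> \<le> 2 * (c * (X + 1) + 1) + 1" by (intro add_mono mult_left_mono K(1)) auto
        also have "\<dots> \<le> (2 * c + 3) * (1 + X)" using X \<rho>(3) by (simp add: algebra_simps)
        also have "\<dots> \<le> (2 * c + 3) * exp X" using \<rho>(3) exp_ge_add_one_self[of X] by (intro mult_left_mono) auto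
        finally show "real (card ?I) \<le> (2 * c + 3) * exp X" .
      qed (use \<delta> in auto)
      also have "\<dots> = (2 * c + 3) * real m0 / \<delta> * exp (\<sigma> * X)" by (simp add: \<sigma>_def distrib_right exp_add)
      finally have 1: "norm (\<Sum>k\<in>?I. 1 / of_real (freq k) * mode_sum k x) \<le> (2 * c + 3) * real m0 / \<delta> * exp (\<sigma> * X)" .
      have "C\<rho> * 1 \<le> C\<rho> * exp (\<sigma> * X)" using C\<rho> C2 X by (intro mult_left_mono) auto
      moreover have "norm (mero_tail K x) \<le> C\<rho>"
        unfolding C\<rho>_def by (rule mero_tail_bound[OF \<rho>(1,2) K(2)]) (use nx in auto)
      ultimately have 2: "norm (mero_tail K x) \<le> C\<rho> * exp (\<sigma> * X)" by linarith
      show ?thesis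
        unfolding mero_sum_def C2_def distrib_right[of "(2 * c + 3) * real m0 / \<delta>"] by (rule order.trans[OF norm_triangle_ineq add_mono[OF 1 2]])
    qed
    have "norm (conv_op (mero_sum K) \<xi>) \<le> A * exp (b * X) * (C2 * exp (\<sigma> * X))"
      unfolding X_def using T[rule_format, OF cM, of "C2 * exp (\<sigma> * X)"] MRb C2 unfolding X_def by auto
    also have "\<dots> = A * C2 * exp (b * X + \<sigma> * X)" by (simp add: exp_add)
    also have "\<dots> \<le> A * C2 * exp ((1 + \<sigma> + b + b') * X)"
      using A A' C2 X by (intro mult_left_mono) (auto simp: distrib_right)
    finally have t1: "norm (conv_op (mero_sum K) \<xi>) \<le> A * C2 * exp ((1 + \<sigma> + b + b') * X)" .
    have "norm (gker_coeff 0 \<xi>) \<le> exp (norm (- \<xi> / 2))" unfolding gker_coeff_0 norm_mult using norm_exp[of "- \<xi> / 2"] by simp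
    also have "\<dots> \<le> exp X" using X by (simp add: X_def norm_divide)
    finally have "norm (gker_coeff 0 \<xi> * mero_sum K \<xi>) \<le> exp X * (C2 * exp (\<sigma> * X))"
      unfolding norm_mult by (intro mult_mono MRb) auto
    also have "\<dots> = C2 * exp (X + \<sigma> * X)" by (simp add: exp_add)
    also have "\<dots> \<le> C2 * exp ((1 + \<sigma> + b + b') * X)"
      using A A' C2 X by (intro mult_left_mono) (auto simp: distrib_right)
    finally have t2: "norm (gker_coeff 0 \<xi> * mero_sum K \<xi>) \<le> C2 * exp ((1 + \<sigma> + b + b') * X)" .
    have "norm (entire_part \<xi>) \<le> A' * exp (b' * X)" using H by (simp add: X_def)
    also have "\<dots> \<le> A' * exp ((1 + \<sigma> + b + b') * X)"
      using A A' C2 X by (intro mult_left_mono) (auto simp: distrib_right)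
    finally have t3: "norm (entire_part \<xi>) \<le> A' * exp ((1 + \<sigma> + b + b') * X)" .
    have "main_branch (Phi_delta \<Lambda> z) \<xi> = - \<Lambda> * (gker_coeff 0 \<xi> * mero_sum K \<xi> + conv_op (mero_sum K) \<xi> + entire_part \<xi>)"
      by (rule main_branch_mero_sum[OF \<rho>(1,2) _ inS]) (rule K(2))
    then have "norm (main_branch (Phi_delta \<Lambda> z) \<xi>) = norm (gker_coeff 0 \<xi> * mero_sum K \<xi> + conv_op (mero_sum K) \<xi> + entire_part \<xi>)"
      by (simp only: norm_mult norm_minus_cancel norm_\<Lambda> mult_1)
    also have "\<dots> \<le> norm (gker_coeff 0 \<xi> * mero_sum K \<xi>) + norm (conv_op (mero_sum K) \<xi>) + norm (entire_part \<xi>)"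
      by (rule order.trans[OF norm_triangle_ineq add_right_mono[OF norm_triangle_ineq]])
    also have "\<dots> \<le> C2 * exp ((1 + \<sigma> + b + b') * X) + A * C2 * exp ((1 + \<sigma> + b + b') * X) + A' * exp ((1 + \<sigma> + b + b') * X)"
      by (intro add_mono t1 t2 t3)
    finally show ?thesis unfolding X_def \<xi>_def by (simp add: distrib_right)
  qed
  then show ?thesis by blast
qed

end

text \<open>In the variable \<zeta> = \<xi> - \<omega> this is the entire function multiplying the
  logarithm.\<close>

lemma conv_ker_translate_holomorphic: "(\<lambda>\<zeta>. \<i> * conv_ker (\<omega> + \<zeta>) \<zeta>) holomorphic_on UNIV"
proof -
  have "((\<lambda>\<xi>. conv_ker \<xi> (\<xi> - \<omega>)) \<circ> (\<lambda>\<zeta>. \<omega> + \<zeta>)) holomorphic_on UNIV"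
    by (rule holomorphic_on_compose_gen[OF _ conv_ker_holomorphic]) (auto intro!: holomorphic_intros)
  then show ?thesis by (intro holomorphic_intros) (simp add: o_def)
qed

theorem theorem4p2:
  fixes n0 m0 :: nat and n0' :: int and \<Lambda>0 :: complex and lg :: "complex \<Rightarrow> complex"
  assumes "m0 \<ge> 1" and "n0 \<le> m0 - 1" and "coprime n0 m0"
    and "\<Lambda>0 = exp (2 * of_real pi * \<i> * of_nat n0 / of_nat m0)"
    and "[int n0 * n0' = 1] (mod int m0)"
    and "\<And>z. z \<in> ball 0 1 - {0} \<Longrightarrow> exp (lg z) = z"
  shows
    "(\<forall>z\<in>ball 0 1 - {0}. \<forall>\<gamma>.
        path \<gamma> \<and> pathstart \<gamma> = 0 \<and> path_image \<gamma> \<inter> moving_points lg m0 z = {} \<longrightarrow>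
        (\<exists>F. continuation_along (Phi_delta \<Lambda>0 z) \<gamma> F))
     \<and>
     (\<exists>L. (\<forall>\<omega>. L \<omega> holomorphic_on UNIV) \<and>
        (\<forall>z\<in>ball 0 1 - {0}. \<forall>a b \<omega>. a \<noteq> 0 \<and> \<omega> = moving_point lg m0 a b z \<longrightarrow>
          (\<exists>\<epsilon>>0. \<forall>U\<in>components (main_sheet (Phi_delta \<Lambda>0 z) \<inter> ball \<omega> \<epsilon>).
             \<exists>l R. l holomorphic_on U \<and> (\<forall>\<xi>\<in>U. exp (l \<xi>) = \<xi> - \<omega>) \<and>
                   R holomorphic_on ball \<omega> \<epsilon> \<and>
                   (\<forall>\<xi>\<in>U. main_branch (Phi_delta \<Lambda>0 z) \<xi> =
                      \<Lambda>0 * C_coeff m0 n0' a b *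
                        (exp (- \<omega> / 2) / (\<xi> - \<omega>) + L \<omega> (\<xi> - \<omega>) * l \<xi>) + R \<xi>))))
     \<and>
     (\<forall>z\<in>ball 0 1 - {0}. \<forall>u \<Delta>.
        u \<noteq> 0 \<and> \<Delta> = range (\<lambda>t::real. t *\<^sub>R u) \<and> \<Delta> \<inter> moving_points lg m0 z = {} \<longrightarrow>
        (\<exists>K \<tau>. \<forall>\<xi>\<in>\<Delta>. norm (main_branch (Phi_delta \<Lambda>0 z) \<xi>) \<le> K * exp (\<tau> * norm \<xi>)))"
proof -
  have data: "borel_data \<Lambda>0 m0 n0 n0' z (lg z)" if z: "z \<in> ball 0 1 - {0}" for z
  proof
    show "0 < m0" using assms(1) by simp
    show e: "\<Lambda>0 = cis (2 * pi * real n0 / real m0)"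
      unfolding assms(4) cis_conv_exp by (simp add: mult_ac)
    have "real m0 * (2 * pi * real n0 / real m0) = 2 * pi * real_of_int (int n0)" using assms(1) by simp
    then show "\<Lambda>0 ^ m0 = 1" unfolding e Complex.DeMoivre by (simp only: cis_eq_1_iff) blast
  qed (use assms z in auto)
  have sing_pt: "borel_data.sing_pt m0 (lg z) a b = moving_point lg m0 a b z" if z: "z \<in> ball 0 1 - {0}" for z a b
    unfolding borel_data.sing_pt_def[OF data[OF z]] borel_data.freq_def[OF data[OF z]] moving_point_def by simp
  have sing_pts: "borel_data.sing_pts m0 (lg z) = moving_points lg m0 z" if z: "z \<in> ball 0 1 - {0}" for z
    unfolding borel_data.sing_pts_def[OF data[OF z]] moving_points_def sing_pt[OF z] ..
  have sing_coeff: "borel_data.sing_coeff m0 n0' a b = C_coeff m0 n0' a b" if z: "z \<in> ball 0 1 - {0}" for z :: complex and a b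
    unfolding borel_data.sing_coeff_def[OF data[OF z]] C_coeff_def ..
  have 1: "\<exists>F. continuation_along (Phi_delta \<Lambda>0 z) \<gamma> F"
    if z: "z \<in> ball 0 1 - {0}" and g: "path \<gamma>" "pathstart \<gamma> = 0" "path_image \<gamma> \<inter> moving_points lg m0 z = {}" for z \<gamma>
    using log_pole_germ.continuation_exists[OF borel_data.log_pole_germ_Phi[OF data[OF z]], of \<gamma>] g
    unfolding sing_pts[OF z] pathstart_def by blast
  \<comment> \<open>One function for each \<omega>: neither z nor the component of the main sheet
    enters.\<close>
  define L where "L \<omega> \<zeta> = \<i> * conv_ker (\<omega> + \<zeta>) \<zeta>" for \<omega> \<zeta>
  have L: "L \<omega> holomorphic_on UNIV" for \<omega>
    unfolding L_def[abs_def] by (rule conv_ker_translate_holomorphic)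
  have 2: "\<exists>\<epsilon>>0. \<forall>U\<in>components (main_sheet (Phi_delta \<Lambda>0 z) \<inter> ball \<omega> \<epsilon>).
             \<exists>l R. l holomorphic_on U \<and> (\<forall>\<xi>\<in>U. exp (l \<xi>) = \<xi> - \<omega>) \<and>
                   R holomorphic_on ball \<omega> \<epsilon> \<and>
                   (\<forall>\<xi>\<in>U. main_branch (Phi_delta \<Lambda>0 z) \<xi> =
                      \<Lambda>0 * C_coeff m0 n0' a b *
                        (exp (- \<omega> / 2) / (\<xi> - \<omega>) + L \<omega> (\<xi> - \<omega>) * l \<xi>) + R \<xi>)"
    if z: "z \<in> ball 0 1 - {0}" and a: "a \<noteq> 0" "\<omega> = moving_point lg m0 a b z" for z a b \<omega>
  proof -
    note d = data[OF z]
    have w: "\<omega> = borel_data.sing_pt m0 (lg z) a b" unfolding sing_pt[OF z] by (rule a(2))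
    have mem: "\<omega> \<in> borel_data.sing_pts m0 (lg z)" unfolding borel_data.sing_pts_def[OF d] w using a(1) by blast
    have r: "borel_data.sing_weight m0 n0' (lg z) \<omega> = C_coeff m0 n0' a b"
      unfolding w borel_data.sing_weight_sing_pt[OF d a(1)] by (rule sing_coeff[OF z])
    \<comment> \<open>The factor \<i> meets the value \<open>- \<i> * exp (- \<omega> / 2)\<close>
      of \<open>gker_coeff 0 \<omega>\<close>.\<close>
    have eq: "C_coeff m0 n0' a b * (\<i> * \<Lambda>0 * gker_coeff 0 \<omega> / (\<xi> - \<omega>) + \<i> * \<Lambda>0 * conv_ker \<xi> (\<xi> - \<omega>) * l)
       = \<Lambda>0 * C_coeff m0 n0' a b * (exp (- \<omega> / 2) / (\<xi> - \<omega>) + L \<omega> (\<xi> - \<omega>) * l)" for \<xi> l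
      by (simp add: gker_coeff_0 L_def algebra_simps)
    show ?thesis
      using log_pole_germ.local_form[OF borel_data.log_pole_germ_Phi[OF d] mem] unfolding r eq .
  qed
  have 3: "\<exists>K \<tau>. \<forall>\<xi>\<in>\<Delta>. norm (main_branch (Phi_delta \<Lambda>0 z) \<xi>) \<le> K * exp (\<tau> * norm \<xi>)"
    if z: "z \<in> ball 0 1 - {0}" and u: "u \<noteq> 0" "\<Delta> = range (\<lambda>t::real. t *\<^sub>R u)" "\<Delta> \<inter> moving_points lg m0 z = {}" for z u \<Delta>
  proof -
    have "of_real t * u \<notin> borel_data.sing_pts m0 (lg z)" for t :: real
      using u(2,3) unfolding sing_pts[OF z] by (auto simp: scaleR_conv_of_real)
    from borel_data.exponential_growth[OF data[OF z] u(1) this] obtain C \<tau> where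
      "\<And>t::real. norm (main_branch (Phi_delta \<Lambda>0 z) (of_real t * u)) \<le> C * exp (\<tau> * norm (of_real t * u))" by blast
    then show ?thesis unfolding u(2) by (intro exI[of _ C] exI[of _ \<tau>]) (auto simp: scaleR_conv_of_real)
  qed
  show ?thesis
  proof (rule conjI[OF _ conjI])
    show "\<forall>z\<in>ball 0 1 - {0}. \<forall>\<gamma>. path \<gamma> \<and> pathstart \<gamma> = 0 \<and> path_image \<gamma> \<inter> moving_points lg m0 z = {} \<longrightarrow>
        (\<exists>F. continuation_along (Phi_delta \<Lambda>0 z) \<gamma> F)"
      by (intro ballI allI impI, elim conjE) (rule 1)
    show "\<exists>L. (\<forall>\<omega>. L \<omega> holomorphic_on UNIV) \<and>
        (\<forall>z\<in>ball 0 1 - {0}. \<forall>a b \<omega>. a \<noteq> 0 \<and> \<omega> = moving_point lg m0 a b z \<longrightarrow>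
          (\<exists>\<epsilon>>0. \<forall>U\<in>components (main_sheet (Phi_delta \<Lambda>0 z) \<inter> ball \<omega> \<epsilon>).
             \<exists>l R. l holomorphic_on U \<and> (\<forall>\<xi>\<in>U. exp (l \<xi>) = \<xi> - \<omega>) \<and>
                   R holomorphic_on ball \<omega> \<epsilon> \<and>
                   (\<forall>\<xi>\<in>U. main_branch (Phi_delta \<Lambda>0 z) \<xi> =
                      \<Lambda>0 * C_coeff m0 n0' a b *
                        (exp (- \<omega> / 2) / (\<xi> - \<omega>) + L \<omega> (\<xi> - \<omega>) * l \<xi>) + R \<xi>)))"
    proof (rule exI[of _ L], rule conjI)
      show "\<forall>\<omega>. L \<omega> holomorphic_on UNIV" using L by (rule allI)
    qed (intro ballI allI impI, elim conjE, rule 2)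
    show "\<forall>z\<in>ball 0 1 - {0}. \<forall>u \<Delta>.
        u \<noteq> 0 \<and> \<Delta> = range (\<lambda>t::real. t *\<^sub>R u) \<and> \<Delta> \<inter> moving_points lg m0 z = {} \<longrightarrow>
        (\<exists>K \<tau>. \<forall>\<xi>\<in>\<Delta>. norm (main_branch (Phi_delta \<Lambda>0 z) \<xi>) \<le> K * exp (\<tau> * norm \<xi>))"
      by (intro ballI allI impI, elim conjE) (rule 3)
  qed
qed

end
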